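(* Fix an integer $k\geq 2$ and a finite alphabet $\Sigma\supseteq[k]$. Let $W=12\cdots kk\cdots 21$ (a word of length $2k$). For any fixed real $\rho\geq 0$, as $n\to\infty$, \[ \mathbb{E}_{R\sim\Sigma^n}\operatorname{LCS}\bigl(R,W^{(\rho n)}\bigr)=\Biggl(\Bigl(1-\frac{m}{2k}\Bigr)\rho+\frac{\sum_{j\geq 0}\binom{2k-2j}{m-1-2j}}{|\Sigma|\cdot\sum_{j\geq 0}\binom{2k-2j}{m-2j}}\Biggr)n-\tau\sqrt n+O(1), \] where $m\in[2k]$ is the largest integer for which \[ \frac{2k\cdot\sum_{j\geq 0}\binom{2k-2j}{m-1-2j}}{|\Sigma|\cdot\sum_{j\geq 0}\binom{2k-2j}{m-2j}}-\frac{2k\cdot\sum_{j\geq 0}\binom{2k-2j}{m-2-2j}}{|\Sigma|\cdot\sum_{j\geq 0}\binom{2k-2j}{m-1-2j}}\leq\rho \qquad (\ast) \] (with $m=0$ if no integer in $[2k]$ satisfies $(\ast)$), and $\tau=\tau(k,|\Sigma|,\rho)$ is a real constant with $\tau\geq 0$ always, and $\tau>0$ if and only if $m\ge 1$ and equality holds in $(\ast)$ for this $m$.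
   Context: $[k]=\{1,\dots,k\}$. An alphabet is a finite set. $R\sim\Sigma^n$ means that $R$ is a uniformly random word of length $n$ over $\Sigma$. $\operatorname{LCS}(U,V)$ is the length of the longest common (not necessarily contiguous) subsequence of the words $U$ and $V$. For a word $W$ and $N\ge 0$, $W^{(N)}$ is the word of length $N$ consisting of the first $N$ letters of the infinite word $WWW\cdots$; when $N=\rho n$ is not an integer it is rounded down (the effect is absorbed by the $O(1)$). The implied constant in $O(1)$ may depend on $k,|\Sigma|,\rho$ but not on $n$. Convention: $\binom{a}{b}=0$ whenever $b<0$, so all the sums are finite. *)

theory Defs
  imports "HOL-Probability.Probability" "HOL-Library.Stream" "HOL-Library.Sublist"
begin

definition LCS :: "'a list \<Rightarrow> 'a list \<Rightarrow> nat" where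
  "LCS u v = Max (length ` {w. subseq w u \<and> subseq w v})"

definition random_word :: "'a set \<Rightarrow> nat \<Rightarrow> 'a list pmf" where
  "random_word A n = pmf_of_set {w. set w \<subseteq> A \<and> length w = n}"

text \<open>The first \<open>N\<close> letters of \<open>w w w \<dots>\<close>; only meaningful for nonempty \<open>w\<close>.\<close>

definition periodic_prefix :: "'a list \<Rightarrow> nat \<Rightarrow> 'a list" where
  "periodic_prefix w N = stake N (cycle w)"

definition updown_word :: "nat \<Rightarrow> nat list" where
  "updown_word k = [1..<Suc k] @ rev [1..<Suc k]"

definition expected_LCS :: "nat set \<Rightarrow> nat \<Rightarrow> real \<Rightarrow> nat \<Rightarrow> real" where
  "expected_LCS A k \<rho> n =
     measure_pmf.expectation (random_word A n)
       (\<lambda>R. real (LCS R (periodic_prefix (updown_word k) (nat \<lfloor>\<rho> * real n\<rfloor>))))"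

definition binom :: "int \<Rightarrow> int \<Rightarrow> real" where
  "binom a b = (if b < 0 then 0 else real_of_int a gchoose nat b)"

text \<open>The terms with \<open>2 * j > i\<close> vanish, so the series below is a finite sum.\<close>

definition binom_sum :: "nat \<Rightarrow> int \<Rightarrow> real" where
  "binom_sum k i = (\<Sum>j::nat. binom (2 * int k - 2 * int j) (i - 2 * int j))"

definition threshold :: "nat \<Rightarrow> nat \<Rightarrow> nat \<Rightarrow> real" where
  "threshold k s m =
     2 * real k * binom_sum k (int m - 1) / (real s * binom_sum k (int m))
     - 2 * real k * binom_sum k (int m - 2) / (real s * binom_sum k (int m - 1))"

text \<open>The largest \<open>m\<close> in \<open>{1..2 * k}\<close> whose threshold is at most \<open>\<rho>\<close>, and \<open>0\<close> if there is none.\<close>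

definition phase :: "nat \<Rightarrow> nat \<Rightarrow> real \<Rightarrow> nat" where
  "phase k s \<rho> = Max (insert 0 {m \<in> {1..2 * k}. threshold k s m \<le> \<rho>})"

definition linear_coeff :: "nat \<Rightarrow> nat \<Rightarrow> real \<Rightarrow> nat \<Rightarrow> real" where
  "linear_coeff k s \<rho> m =
     (1 - real m / (2 * real k)) * \<rho>
     + binom_sum k (int m - 1) / (real s * binom_sum k (int m))"

end

theory Submission imports Defs begin

text \<open>Reading a letter of \<open>R\<close> changes the function \<open>N \<mapsto> LCS R W\<^sub>N\<close> by a local rule for its
  0-1 increments. Started from zero, the increments decrease from one period of the word to the
  next, so that along multiples of the period the function is concave with slopes \<open>0, \<dots>, 2k\<close>,
  that is, a sum of \<open>2k\<close> layers \<open>min I D\<^sub>m\<close> whose depths decrease in \<open>m\<close>. Up to \<open>O(1)\<close>, \<open>D\<^sub>m\<close> is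
  the difference of the total fluxes of the same dynamics on a ring of \<open>2k\<close> sites carrying
  \<open>m - 1\<close> and \<open>m\<close> particles. For the up-down word the ring dynamics has an explicit stationary
  (signed) measure, a tridiagonal determinant, which gives the speeds; the thresholds are \<open>2k\<close>
  times the speed differences, and their monotonicity comes from the monotonicity of the \<open>D\<^sub>m\<close>.
  A synchronizing word makes the Poisson equation solvable, which turns \<open>D\<^sub>m\<close> into a martingale
  with drift. A drift other than \<open>\<rho> / 2k\<close> contributes linearly up to \<open>O(1)\<close>; in the equality case the
  mean absolute value of a martingale appears. It is \<open>\<tau> \<surd>n + O(1)\<close> because its characteristic function at
  \<open>l\<close> is Gaussian up to \<open>O(l\<^sup>2)\<close> and \<open>\<bar>x\<bar>\<close> is proportional to \<open>\<integral> (1 - cos (l x)) / l\<^sup>2 dl\<close>.\<close>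

section \<open>Longest common subsequences against a fixed infinite word\<close>

text \<open>The link between the LCS and the ring is a Legendre transform. Along multiples of the
  period the heights \<open>f\<close> are concave, and the maximum of \<open>f I - m * I\<close>
  over \<open>I\<close> is the sum of the depths with index above \<open>m\<close>. Heights that
  repeat after one period up to adding \<open>m\<close> form the ring with \<open>m\<close>
  particles, and the total flux is their vertical shift; comparing heights in both directions
  recovers this maximum up to \<open>m\<close>. The weights on the ring may be signed: pairing them
  with the Poisson equation identifies its constant as soon as the total weight is nonzero. The
  remainder O(1) in the equality case dictates the precision of the Fourier argument. The error must
  be of order \<open>l^2\<close> uniformly in \<open>n\<close> to be integrable against
  \<open>1 / l^2\<close> near 0. Errors accumulate over about \<open>1 / l^2\<close> steps, so one
  step must be exact up to order \<open>l^4\<close>; hence the correctors of orders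
  \<open>l^2\<close> and \<open>l^3\<close>. The cubic term in the exponent is harmless because in
  the real part it enters only through a cosine.\<close>

lemma finite_common_subseqs: "finite {w. subseq w u \<and> subseq w v}"
  using finite_set[of "List.subseqs u"] by (rule finite_subset[rotated]) (auto simp: set_subseqs_eq)

lemma LCS_ge: "subseq w u \<Longrightarrow> subseq w v \<Longrightarrow> length w \<le> LCS u v"
  unfolding LCS_def using finite_common_subseqs[of u v] by (intro Max_ge) auto

lemma LCS_witness: obtains w where "subseq w u" "subseq w v" "length w = LCS u v"
proof -
  have "LCS u v \<in> length ` {w. subseq w u \<and> subseq w v}"
    unfolding LCS_def using finite_common_subseqs[of u v]
    by (intro Max_in) (auto intro!: exI[of _ "[]"])
  then show ?thesis using that by auto
qed

lemma LCS_mono: "subseq u u' \<Longrightarrow> subseq v v' \<Longrightarrow> LCS u v \<le> LCS u' v'"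
  by (metis LCS_witness LCS_ge subseq_order.order_trans)

lemma LCS_le_left: "LCS u v \<le> length u" and LCS_le_right: "LCS u v \<le> length v"
  by (metis LCS_witness not_subseq_length not_less)+

lemma subseq_snocE:
  assumes "subseq w (u @ [x])"
  obtains "subseq w u" | w' where "w = w' @ [x]" "subseq w' u"
proof -
  obtain w1 w2 where w: "w = w1 @ w2" "subseq w1 u" "subseq w2 [x]"
    using assms by (auto simp: subseq_append_iff)
  then have "w2 = [] \<or> w2 = [x]" by (auto elim: list_emb.cases)
  then show ?thesis using w that by auto
qed

lemma LCS_snoc_same: "LCS (u @ [x]) (v @ [x]) = Suc (LCS u v)"
proof (rule antisym)
  obtain w where w: "subseq w (u @ [x])" "subseq w (v @ [x])" "length w = LCS (u @ [x]) (v @ [x])"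
    by (rule LCS_witness)
  have "length w \<le> Suc (LCS u v)"
  proof (cases w rule: rev_cases)
    case (snoc w' y)
    have "subseq w' u" using w(1) unfolding snoc
      by (elim subseq_snocE) (auto intro: subseq_order.order_trans[OF subseq_rev_drop_many[OF subseq_order.refl]])
    moreover have "subseq w' v" using w(2) unfolding snoc
      by (elim subseq_snocE) (auto intro: subseq_order.order_trans[OF subseq_rev_drop_many[OF subseq_order.refl]])
    ultimately show ?thesis using LCS_ge[of w' u v] snoc by simp
  qed simp
  then show "LCS (u @ [x]) (v @ [x]) \<le> Suc (LCS u v)" using w by simp
  obtain w where "subseq w u" "subseq w v" "length w = LCS u v" by (rule LCS_witness)
  then show "Suc (LCS u v) \<le> LCS (u @ [x]) (v @ [x])"
    using LCS_ge[of "w @ [x]" "u @ [x]" "v @ [x]"] by simp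
qed

lemma LCS_snoc_diff:
  assumes "x \<noteq> y"
  shows "LCS (u @ [x]) (v @ [y]) = max (LCS u (v @ [y])) (LCS (u @ [x]) v)"
proof (rule antisym)
  obtain w where w: "subseq w (u @ [x])" "subseq w (v @ [y])" "length w = LCS (u @ [x]) (v @ [y])"
    by (rule LCS_witness)
  have "subseq w u \<or> subseq w v"
    using w(1,2) assms by (elim subseq_snocE) auto
  then have "length w \<le> max (LCS u (v @ [y])) (LCS (u @ [x]) v)"
    using w LCS_ge[of w u "v @ [y]"] LCS_ge[of w "u @ [x]" v] by auto
  then show "LCS (u @ [x]) (v @ [y]) \<le> max (LCS u (v @ [y])) (LCS (u @ [x]) v)" using w by simp
  show "max (LCS u (v @ [y])) (LCS (u @ [x]) v) \<le> LCS (u @ [x]) (v @ [y])"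
    by (auto intro!: LCS_mono subseq_rev_drop_many)
qed

text \<open>Integer-valued, so that increments can be subtracted freely; the infinite word
  \<open>s\<close> lets one recursion cover all prefixes.\<close>

definition lcs_to :: "(nat \<Rightarrow> 'a) \<Rightarrow> 'a list \<Rightarrow> nat \<Rightarrow> int" where
  "lcs_to s R N = int (LCS R (map s [0..<N]))"

lemma lcs_to_Nil [simp]: "lcs_to s [] N = 0"
  using LCS_le_left[of "[]"] by (simp add: lcs_to_def)

lemma lcs_to_0 [simp]: "lcs_to s R 0 = 0"
  using LCS_le_right[of R "[]"] by (simp add: lcs_to_def)

lemma lcs_to_snoc_Suc:
  "lcs_to s (R @ [a]) (Suc N) =
     (if s N = a then lcs_to s R N + 1 else max (lcs_to s R (Suc N)) (lcs_to s (R @ [a]) N))"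
  by (auto simp: lcs_to_def LCS_snoc_same LCS_snoc_diff)

lemma lcs_to_le_length: "lcs_to s R N \<le> int (length R)"
  using LCS_le_left by (auto simp: lcs_to_def)

lemma lcs_to_snoc_ge: "lcs_to s R N \<le> lcs_to s (R @ [a]) N"
  by (auto simp: lcs_to_def intro!: LCS_mono)

lemma lcs_to_Suc_ge: "lcs_to s R N \<le> lcs_to s R (Suc N)"
  by (auto simp: lcs_to_def intro!: LCS_mono)

lemma lcs_to_mono: "N \<le> N' \<Longrightarrow> lcs_to s R N \<le> lcs_to s R N'"
  by (rule lift_Suc_mono_le[of "lcs_to s R"]) (rule lcs_to_Suc_ge)

lemma lcs_to_Suc_le: "lcs_to s R (Suc N) \<le> lcs_to s R N + 1"
proof (induction R rule: rev_induct)
  case (snoc a R)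
  then show ?case using lcs_to_snoc_ge[of s R N a] by (auto simp: lcs_to_snoc_Suc)
qed simp

lemma lcs_to_add_le: "lcs_to s R (N + d) \<le> lcs_to s R N + int d"
  using lcs_to_Suc_le[of s R] by (induction d) (auto intro: order_trans, smt (verit))

text \<open>The increments along one period decrease with the distance from the start: a
  discrepancy argument comparing the dynamic programme with its shift by one period.\<close>

lemma lcs_to_shift:
  assumes "\<And>i. s (i + p) = s i"
  shows "lcs_to s R (Suc N + p) - lcs_to s R (Suc N) \<le> lcs_to s R (N + p) - lcs_to s R N"
    and "lcs_to s R (N + p) - lcs_to s R N \<le> lcs_to s (R @ [a]) (N + p) - lcs_to s (R @ [a]) N"
proof -
  define D where "D R N = lcs_to s R (N + p) - lcs_to s R N" for R N
  \<comment> \<open>By periodicity the cells \<open>Suc N\<close> and \<open>Suc N + p\<close> take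
    the same branch. At a match the new difference is \<open>D R N\<close>; otherwise a difference
    of two maxima lies between \<open>D R (Suc N)\<close> and \<open>D (R @ [a]) N\<close>. Both
    inequalities thus pass to the fourth corner of a cell.\<close>
  have aux: "D (R @ [a]) (Suc N) \<le> D (R @ [a]) N \<and> D R (Suc N) \<le> D (R @ [a]) (Suc N)"
    if "D R (Suc N) \<le> D R N" "D R N \<le> D (R @ [a]) N" for R N a
    using that unfolding D_def add_Suc by (auto simp: lcs_to_snoc_Suc assms max_def)
  have aux2: "D R N \<le> D (R @ [a]) N" if "\<And>N. D R (Suc N) \<le> D R N" for R N a
  proof (induction N)
    case 0 then show ?case by (simp add: D_def lcs_to_snoc_ge)
  next
    case (Suc N) then show ?case using aux that by blast
  qed
  have 1: "D R (Suc N) \<le> D R N" for R N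
  proof (induction R arbitrary: N rule: rev_induct)
    case Nil then show ?case by (simp add: D_def)
  next
    case (snoc a R) then show ?case using aux aux2 by blast
  qed
  show "lcs_to s R (Suc N + p) - lcs_to s R (Suc N) \<le> lcs_to s R (N + p) - lcs_to s R N"
    using 1[of R N] by (simp add: D_def)
  show "lcs_to s R (N + p) - lcs_to s R N \<le> lcs_to s (R @ [a]) (N + p) - lcs_to s (R @ [a]) N"
    using aux2[of R N a] 1 by (simp add: D_def)
qed

section \<open>Concave integer functions as sums of layers\<close>

lemma initial_segment:
  fixes P :: "nat \<Rightarrow> bool"
  assumes "finite {i. P i}" "\<And>i j. i \<le> j \<Longrightarrow> P j \<Longrightarrow> P i"
  shows "P i \<longleftrightarrow> i < card {i. P i}"
proof -
  obtain n where n: "{i. P i} = {..<n}"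
  proof (cases "\<exists>i. \<not> P i")
    case True
    define n where "n = (LEAST i. \<not> P i)"
    have "\<not> P n" using LeastI_ex[OF True] unfolding n_def .
    moreover have "P i" if "i < n" for i using not_less_Least[OF that[unfolded n_def]] by simp
    ultimately have "{i. P i} = {..<n}" using assms(2) by (metis (no_types, lifting) Collect_cong lessThan_def not_le)
    then show ?thesis using that by blast
  next
    case False
    then have "{i. P i} = UNIV" by auto
    then show ?thesis using assms(1) by simp
  qed
  then show ?thesis by auto
qed

locale concave_layers =
  fixes f :: "nat \<Rightarrow> int" and K :: nat and b :: int
  assumes f0: "f 0 = 0"
    and incr: "\<And>i. 0 \<le> f (Suc i) - f i" "\<And>i. f (Suc i) - f i \<le> int K"
    and conc: "\<And>i. f (Suc (Suc i)) - f (Suc i) \<le> f (Suc i) - f i"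
    and bdd: "\<And>i. f i \<le> b"
begin

text \<open>The increments form a partition, and \<open>layer m\<close> is part \<open>m\<close> of
  the conjugate partition. At \<open>m = 0\<close> the set is infinite and the value is the default
  \<open>0\<close>.\<close>

definition layer :: "nat \<Rightarrow> nat" where
  "layer m = card {i. int m \<le> f (Suc i) - f i}"

lemma incr_antimono: "i \<le> j \<Longrightarrow> f (Suc j) - f j \<le> f (Suc i) - f i"
  by (rule lift_Suc_antimono_le[of "\<lambda>i. f (Suc i) - f i"]) (use conc in auto)

text \<open>By concavity an increment of at least \<open>m\<close> at \<open>i\<close> forces such
  increments at all earlier places, so \<open>f\<close> has already risen by \<open>Suc i\<close>,
  which \<open>b\<close> bounds.\<close>

lemma finite_layer:
  assumes "m \<ge> 1" shows "finite {i. int m \<le> f (Suc i) - f i}"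
proof -
  have "int i \<le> f i" if "\<forall>j<i. int m \<le> f (Suc j) - f j" for i
    using that
  proof (induction i)
    case (Suc i)
    then have "int i \<le> f i" "int m \<le> f (Suc i) - f i" by auto
    then show ?case using assms by linarith
  qed (simp add: f0)
  then have *: "int (Suc i) \<le> f (Suc i)" if "int m \<le> f (Suc i) - f i" for i
    using that incr_antimono[of _ i] by (smt (verit) less_Suc_eq_le)
  have "i \<le> nat b" if "int m \<le> f (Suc i) - f i" for i
    using *[OF that] bdd[of "Suc i"] by linarith
  then show ?thesis by (meson finite_nat_set_iff_bounded_le mem_Collect_eq)
qed

lemma less_layer_iff:
  assumes "m \<ge> 1"
  shows "i < layer m \<longleftrightarrow> int m \<le> f (Suc i) - f i"
proof -
  have "int m \<le> f (Suc i) - f i \<longleftrightarrow> i < card {i. int m \<le> f (Suc i) - f i}"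
  proof (rule initial_segment[OF finite_layer[OF assms]])
    fix i j assume "i \<le> j" "int m \<le> f (Suc j) - f j"
    then show "int m \<le> f (Suc i) - f i" using incr_antimono[of i j] by linarith
  qed
  then show ?thesis unfolding layer_def by (rule sym)
qed

lemma layer_antimono:
  assumes "1 \<le> m" "m \<le> m'" shows "layer m' \<le> layer m"
proof (rule ccontr)
  assume "\<not> layer m' \<le> layer m"
  then have "layer m < layer m'" by simp
  then have "int m' \<le> f (Suc (layer m)) - f (layer m)"
    using less_layer_iff[of m' "layer m"] assms by (simp only:)
  then have "int m \<le> f (Suc (layer m)) - f (layer m)" using assms(2) by linarith
  then have "layer m < layer m" using less_layer_iff[OF assms(1)] by blast
  then show False by simp
qed

lemma incr_eq_sum: "f (Suc i) - f i = (\<Sum>m\<in>{1..K}. of_bool (i < layer m))"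
proof -
  define X where "X = f (Suc i) - f i"
  have "m \<in> {1..K} \<and> i < layer m \<longleftrightarrow> m \<in> {1..nat X}" for m
  proof (cases "1 \<le> m")
    case True
    have "i < layer m \<longleftrightarrow> int m \<le> X" unfolding X_def by (rule less_layer_iff[OF True])
    moreover have "X \<le> int K" unfolding X_def by (rule incr)
    ultimately show ?thesis using True by auto
  qed simp
  then have "{1..K} \<inter> {m. i < layer m} = {1..nat X}" by blast
  then have "(\<Sum>m\<in>{1..K}. of_bool (i < layer m)) = int (card {1..nat X})"
    by (simp add: sum_of_bool_eq)
  also have "\<dots> = X" using incr(1)[of i] unfolding X_def by simp
  finally show ?thesis by (simp only: X_def)
qed

lemma eq_sum_layers: "f i = (\<Sum>m\<in>{1..K}. int (min i (layer m)))"
proof (induction i)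
  case (Suc i)
  have "f (Suc i) = (\<Sum>m\<in>{1..K}. int (min i (layer m))) + (\<Sum>m\<in>{1..K}. of_bool (i < layer m))"
    using Suc incr_eq_sum[of i] by linarith
  also have "\<dots> = (\<Sum>m\<in>{1..K}. int (min (Suc i) (layer m)))"
    unfolding sum.distrib[symmetric] by (intro sum.cong) auto
  finally show ?case .
qed (simp add: f0)

text \<open>The Legendre transform of \<open>f\<close>: by \<open>le_tail\<close> and
  \<open>tail_attained\<close> it is the maximum of \<open>f i - m * i\<close>, the quantity that
  the ring with \<open>m\<close> particles computes.\<close>

definition tail :: "nat \<Rightarrow> int" where "tail m = (\<Sum>m'\<in>{Suc m..K}. int (layer m'))"

lemma tail_Suc: "m \<ge> 1 \<Longrightarrow> m \<le> K \<Longrightarrow> tail (m - 1) = int (layer m) + tail m"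
  unfolding tail_def using sum.atLeast_Suc_atMost[of m K "\<lambda>m. int (layer m)"] by simp

lemma le_tail: assumes "m \<le> K" shows "f i \<le> tail m + int m * int i"
proof -
  have "f i = (\<Sum>m'\<in>{1..m}. int (min i (layer m'))) + (\<Sum>m'\<in>{Suc m..K}. int (min i (layer m')))"
    unfolding eq_sum_layers[of i] using assms sum.ub_add_nat[of 1 m "\<lambda>m. int (min i (layer m))" "K - m"] by simp
  also have "\<dots> \<le> (\<Sum>m'\<in>{1..m}. int i) + tail m"
    unfolding tail_def by (intro add_mono sum_mono) auto
  finally show ?thesis by simp
qed

lemma tail_attained: assumes "m \<le> K" shows "\<exists>i. tail m + int m * int i \<le> f i"
proof -
  \<comment> \<open>At \<open>layer m\<close> the layers up to \<open>m\<close> still count fully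
    and the later ones are exhausted. \<open>layer 0\<close> carries no information, hence
    \<open>layer 1\<close> for \<open>m = 0\<close>.\<close>
  define i where "i = (if m = 0 then layer 1 else layer m)"
  have 1: "(\<Sum>m'\<in>{1..m}. int i) = (\<Sum>m'\<in>{1..m}. int (min i (layer m')))"
  proof (intro sum.cong refl)
    fix m' assume "m' \<in> {1..m}"
    then have "i \<le> layer m'" using layer_antimono[of m' m] by (auto simp: i_def)
    then show "int i = int (min i (layer m'))" by simp
  qed
  have 2: "tail m = (\<Sum>m'\<in>{Suc m..K}. int (min i (layer m')))"
    unfolding tail_def
  proof (intro sum.cong refl)
    fix m' assume "m' \<in> {Suc m..K}"
    then have "layer m' \<le> i" using layer_antimono[of m m'] layer_antimono[of 1 m'] by (auto simp: i_def)
    then show "int (layer m') = int (min i (layer m'))" by simp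
  qed
  have "f i = (\<Sum>m'\<in>{1..m}. int (min i (layer m'))) + (\<Sum>m'\<in>{Suc m..K}. int (min i (layer m')))"
    unfolding eq_sum_layers[of i] using assms sum.ub_add_nat[of 1 m "\<lambda>m. int (min i (layer m))" "K - m"] by simp
  then have "tail m + int m * int i = f i" using 1 2 by simp
  then show ?thesis by (metis order_refl)
qed

end

section \<open>Periodic profiles: the dynamics on a ring\<close>

text \<open>A profile is a 0-1 sequence of increments; \<open>True\<close> at a site means that the height goes up
  there. Reading a letter raises the heights by at most one; the carry is the amount by which the
  height left of the current site has been raised.\<close>

fun carry :: "'a \<Rightarrow> 'a list \<Rightarrow> bool list \<Rightarrow> bool \<Rightarrow> bool" where
  "carry a (w # ws) (d # ds) v = carry a ws ds (if w = a then \<not> d else v \<and> \<not> d)"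
| "carry a _ _ v = v"

text \<open>The new increment is the old one plus the carry leaving the site minus the carry
  entering it.\<close>

fun swept :: "'a \<Rightarrow> 'a list \<Rightarrow> bool list \<Rightarrow> bool \<Rightarrow> bool list" where
  "swept a (w # ws) (d # ds) v =
     (if w = a then \<not> v else d \<and> \<not> v) # swept a ws ds (if w = a then \<not> d else v \<and> \<not> d)"
| "swept a _ _ v = []"

text \<open>The carry that closes up around the ring. The map from entering to leaving carry is
  constant or the identity (\<open>carry_cases\<close>), so its value at \<open>False\<close> is its
  least fixed point.\<close>

definition ring_flux :: "'a list \<Rightarrow> 'a \<Rightarrow> bool list \<Rightarrow> bool" where
  "ring_flux W a c = carry a W c False"

definition ring_step :: "'a list \<Rightarrow> 'a \<Rightarrow> bool list \<Rightarrow> bool list" where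
  "ring_step W a c = swept a W c (ring_flux W a c)"

definition particles :: "bool list \<Rightarrow> nat" where
  "particles c = count_list c True"

lemma particles_simps [simp]:
  "particles [] = 0" "particles (d # ds) = of_bool d + particles ds"
  "particles (xs @ ys) = particles xs + particles ys"
  "particles (replicate n d) = (if d then n else 0)"
  by (auto simp: particles_def) (induction n; simp)+

lemma particles_eq_0_iff: "particles c = 0 \<longleftrightarrow> True \<notin> set c"
  by (simp add: particles_def count_list_0_iff)

lemma no_particles_iff: "True \<notin> set c \<longleftrightarrow> c = replicate (length c) False"
  by (induction c) auto

lemma length_swept [simp]: "length ws = length ds \<Longrightarrow> length (swept a ws ds v) = length ds"
  by (induction a ws ds v rule: swept.induct) auto

lemma length_ring_step [simp]: "length c = length W \<Longrightarrow> length (ring_step W a c) = length W"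
  by (simp add: ring_step_def)

lemma carry_append [simp]: "length ws = length ds \<Longrightarrow>
    carry a (ws @ ws') (ds @ ds') v = carry a ws' ds' (carry a ws ds v)"
  by (induction a ws ds v rule: carry.induct) auto

lemma swept_append [simp]: "length ws = length ds \<Longrightarrow>
    swept a (ws @ ws') (ds @ ds') v = swept a ws ds v @ swept a ws' ds' (carry a ws ds v)"
  by (induction a ws ds v rule: swept.induct) auto

lemma particles_swept: "length ws = length ds \<Longrightarrow>
    of_bool v + particles (swept a ws ds v) = particles ds + of_bool (carry a ws ds v)"
  by (induction a ws ds v rule: swept.induct) (auto split: if_splits)

lemma carry_cases: "length ws = length ds \<Longrightarrow>
    (\<forall>v. carry a ws ds v = carry a ws ds False) \<or> (\<forall>v. carry a ws ds v = v)"
proof (induction ws ds rule: list_induct2)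
  case (Cons w ws d ds)
  then show ?case by (cases "w = a"; cases d) auto
qed simp

lemma carry_ring_flux: "length c = length W \<Longrightarrow> carry a W c (ring_flux W a c) = ring_flux W a c"
  unfolding ring_flux_def using carry_cases[of W c a] by metis

lemma carry_called: "length ws = length ds \<Longrightarrow> a \<in> set ws \<Longrightarrow> carry a ws ds v = carry a ws ds False"
proof (induction ws ds arbitrary: v rule: list_induct2)
  case (Cons w ws d ds)
  then show ?case by (cases "w = a") (simp, metis carry.simps(1) set_ConsD)
qed simp

lemma ring_step_eqI:
  assumes "length c = length W" "a \<in> set W" "carry a W c v = v"
  shows "ring_step W a c = swept a W c v" "ring_flux W a c = v"
  using assms carry_called[of W c a v] by (auto simp: ring_step_def ring_flux_def)

lemma particles_ring_step: "length c = length W \<Longrightarrow> particles (ring_step W a c) = particles c"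
  using particles_swept[of W c "ring_flux W a c" a] carry_ring_flux[of c W a]
  by (simp add: ring_step_def)

lemma sweep_uncalled_False:
  "length ws = length ds \<Longrightarrow> a \<notin> set ws \<Longrightarrow> carry a ws ds False = False \<and> swept a ws ds False = ds"
  by (induction ws ds rule: list_induct2) auto

lemma ring_step_uncalled: "length c = length W \<Longrightarrow> a \<notin> set W \<Longrightarrow> ring_step W a c = c"
  and ring_flux_uncalled: "length c = length W \<Longrightarrow> a \<notin> set W \<Longrightarrow> ring_flux W a c = False"
  using sweep_uncalled_False[of W c a] by (auto simp: ring_step_def ring_flux_def)

subsection \<open>Comparison with longest common subsequences\<close>

definition elevation :: "bool list \<Rightarrow> nat \<Rightarrow> int" where
  "elevation c i = int (particles (take i c))"

lemma elevation_Suc: "i < length c \<Longrightarrow> elevation c (Suc i) = elevation c i + of_bool (c ! i)"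
  by (simp add: elevation_def take_Suc_conv_app_nth)

lemma carry_take_Suc:
  assumes "i < length W" "length c = length W"
  shows "carry a (take (Suc i) W) (take (Suc i) c) v =
    (if W ! i = a then \<not> c ! i else carry a (take i W) (take i c) v \<and> \<not> c ! i)"
  using assms by (simp add: take_Suc_conv_app_nth)

lemma take_swept: "length ws = length ds \<Longrightarrow> take i (swept a ws ds v) = swept a (take i ws) (take i ds) v"
proof (induction a ws ds v arbitrary: i rule: swept.induct)
  case (1 a w ws d ds v)
  then show ?case by (cases i) auto
qed auto

lemma elevation_swept:
  assumes "length c = length W"
  shows "of_bool v + elevation (swept a W c v) i = elevation c i + of_bool (carry a (take i W) (take i c) v)"
proof -
  have "of_bool v + particles (take i (swept a W c v)) =
      particles (take i c) + of_bool (carry a (take i W) (take i c) v)"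
    using particles_swept[of "take i W" "take i c" v a] assms by (simp add: take_swept)
  from arg_cong[OF this, of int] show ?thesis by (simp add: elevation_def)
qed

text \<open>The sweep solves the recursion exactly for the heights \<open>G + elevation c\<close>,
  and the recursion is monotone in the heights.\<close>

lemma elevation_swept_upper:
  fixes f f' :: "nat \<Rightarrow> int"
  assumes len: "length c = length W"
    and rec: "\<And>i. i < length W \<Longrightarrow> f' (Suc i) = (if W ! i = a then f i + 1 else max (f (Suc i)) (f' i))"
    and f: "\<And>i. i \<le> length W \<Longrightarrow> f i \<le> G + elevation c i"
    and f': "f' 0 \<le> G + of_bool v"
  shows "i \<le> length W \<Longrightarrow> f' i \<le> G + of_bool v + elevation (swept a W c v) i"
proof -
  let ?u = "\<lambda>i. carry a (take i W) (take i c) v"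
  have "i \<le> length W \<Longrightarrow> f' i \<le> G + elevation c i + of_bool (?u i)"
  proof (induction i)
    case 0 then show ?case using f' by (simp add: elevation_def)
  next
    case (Suc i)
    have "f i \<le> G + elevation c i" "f (Suc i) \<le> G + elevation c i + of_bool (c ! i)"
      using f[of i] f[of "Suc i"] Suc.prems len by (auto simp: elevation_Suc)
    then show ?case using Suc rec[of i] len
      by (auto simp: carry_take_Suc elevation_Suc split: if_splits)
  qed
  moreover assume "i \<le> length W"
  ultimately show ?thesis using elevation_swept[OF len, of v a i] by (simp add: add.assoc)
qed

text \<open>Stated for predicates because the period that witnesses the bound may change from site
  to site; the \<open>max\<close> of the recursion becomes the disjunction in
  \<open>uncalled\<close>.\<close>

lemma elevation_swept_lower:
  fixes Q Q' :: "nat \<Rightarrow> int \<Rightarrow> bool"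
  assumes len: "length c = length W"
    and called: "\<And>i x. i < length W \<Longrightarrow> W ! i = a \<Longrightarrow> Q i x \<Longrightarrow> Q' (Suc i) (x + 1)"
    and uncalled: "\<And>i x. i < length W \<Longrightarrow> W ! i \<noteq> a \<Longrightarrow> Q (Suc i) x \<or> Q' i x \<Longrightarrow> Q' (Suc i) x"
    and Q: "\<And>i. i \<le> length W \<Longrightarrow> Q i (G + elevation c i)"
    and Q': "Q' 0 (G + of_bool v)"
  shows "i \<le> length W \<Longrightarrow> Q' i (G + of_bool v + elevation (swept a W c v) i)"
proof -
  let ?u = "\<lambda>i. carry a (take i W) (take i c) v"
  have "i \<le> length W \<Longrightarrow> Q' i (G + elevation c i + of_bool (?u i))"
  proof (induction i)
    case 0 then show ?case using Q' by (simp add: elevation_def)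
  next
    case (Suc i)
    have q: "Q i (G + elevation c i)" "Q (Suc i) (G + elevation c i + of_bool (c ! i))"
      using Q[of i] Q[of "Suc i"] Suc.prems len by (auto simp: elevation_Suc add.assoc)
    show ?case
    proof (cases "W ! i = a")
      case True
      then have "Q' (Suc i) (G + elevation c i + 1)" using called q(1) Suc.prems by simp
      then show ?thesis using True Suc.prems len by (auto simp: carry_take_Suc elevation_Suc add.assoc)
    next
      case False
      then have "Q' (Suc i) (G + elevation c i + of_bool (c ! i))" "Q' (Suc i) (G + elevation c i + of_bool (?u i))"
        using uncalled q(2) Suc by auto
      then show ?thesis using False Suc.prems len
        by (cases "c ! i"; cases "?u i") (auto simp: carry_take_Suc elevation_Suc add.assoc)
    qed
  qed
  moreover assume "i \<le> length W"
  ultimately show ?thesis using elevation_swept[OF len, of v a i] by (simp add: add.assoc)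
qed

primrec additive :: "('a \<Rightarrow> 's \<Rightarrow> 's) \<Rightarrow> ('a \<Rightarrow> 's \<Rightarrow> 'b::comm_monoid_add) \<Rightarrow> 's \<Rightarrow> 'a list \<Rightarrow> 'b" where
  "additive st \<phi> x [] = 0"
| "additive st \<phi> x (a # R) = \<phi> a x + additive st \<phi> (st a x) R"

lemma additive_append:
  "additive st \<phi> x (R @ R') = additive st \<phi> x R + additive st \<phi> (fold st R x) R'"
  by (induction R arbitrary: x) (auto simp: add.assoc)

definition total_flux :: "'a list \<Rightarrow> bool list \<Rightarrow> 'a list \<Rightarrow> int" where
  "total_flux W = additive (ring_step W) (\<lambda>a c. of_bool (ring_flux W a c))"

lemma total_flux_snoc:
  "total_flux W c (R @ [a]) = total_flux W c R + of_bool (ring_flux W a (fold (ring_step W) R c))"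
  by (simp add: total_flux_def additive_append)

lemma ring_run:
  assumes "length c = length W"
  shows "length (fold (ring_step W) R c) = length W" "particles (fold (ring_step W) R c) = particles c"
  using assms by (induction R arbitrary: c) (auto simp: particles_ring_step)

locale periodic_word =
  fixes W :: "'a list" and s :: "nat \<Rightarrow> 'a"
  assumes s_nth: "\<And>I i. i < length W \<Longrightarrow> s (length W * I + i) = W ! i"
begin

abbreviation "lcs \<equiv> lcs_to s"

text \<open>The periodic heights obey the recursion of the LCS and start above the zero heights of
  the empty word; monotonicity keeps them above.\<close>

lemma lcs_le_flux:
  assumes c: "length c = length W"
  shows "lcs R (length W * I) \<le> total_flux W c R + int (particles c) * int I"
proof -
  have "\<forall>I. \<forall>i\<le>length W. lcs R (length W * I + i) \<le>
      total_flux W c R + int (particles c) * int I + elevation (fold (ring_step W) R c) i"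
  proof (induction R rule: rev_induct)
    case Nil
    then show ?case by (simp add: total_flux_def elevation_def)
  next
    case (snoc a R)
    let ?c = "fold (ring_step W) R c"
    let ?v = "ring_flux W a ?c"
    have len: "length ?c = length W" using ring_run c by auto
    have c': "fold (ring_step W) (R @ [a]) c = swept a W ?c ?v" by (simp add: ring_step_def)
    have step: "\<forall>i\<le>length W. lcs (R @ [a]) (length W * I + i) \<le>
        (total_flux W c R + int (particles c) * int I) + of_bool ?v + elevation (swept a W ?c ?v) i"
      if "lcs (R @ [a]) (length W * I) \<le> (total_flux W c R + int (particles c) * int I) + of_bool ?v" for I
    proof (intro allI impI, rule elevation_swept_upper[where f = "\<lambda>i. lcs R (length W * I + i)"])
      show "length ?c = length W" by (rule len)
      fix i assume "i < length W"
      then show "lcs (R @ [a]) (length W * I + Suc i) = (if W ! i = a then lcs R (length W * I + i) + 1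
          else max (lcs R (length W * I + Suc i)) (lcs (R @ [a]) (length W * I + i)))"
        by (simp add: lcs_to_snoc_Suc s_nth)
    qed (use that snoc in auto)
    \<comment> \<open>Since the carry is a fixed point, the bound at the end of one period is the
      bound needed at the start of the next.\<close>
    have "lcs (R @ [a]) (length W * I) \<le> (total_flux W c R + int (particles c) * int I) + of_bool ?v" for I
    proof (induction I)
      case 0
      have "lcs R (length W * 0 + 0) \<le> total_flux W c R + int (particles c) * int 0 + elevation ?c 0"
        using snoc.IH by blast
      then show ?case by (simp add: elevation_def)
    next
      case (Suc I)
      have "elevation (swept a W ?c ?v) (length W) = int (particles c)"
        using ring_run[OF c, of "R @ [a]"] by (simp add: elevation_def c' flip: ring_step_def)
      then show ?case using step[OF Suc] by (auto simp: algebra_simps)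
    qed
    then show ?case using step unfolding c' total_flux_snoc by (simp only: add_ac) blast
  qed
  from this[rule_format, of 0 I] show ?thesis by (simp add: elevation_def)
qed

text \<open>The reverse bound, for the best period \<open>I\<close>. The LCS vanishes at
  \<open>0\<close> while the periodic heights have no left boundary; lowering them by
  \<open>m\<close> puts them below the zero heights of the empty word at
  \<open>I = 0\<close>.\<close>

lemma flux_le_lcs:
  assumes c: "length c = length W"
  shows "\<exists>I. total_flux W c R + int (particles c) * int I \<le> lcs R (length W * I) + int (particles c)"
proof -
  define m where "m = int (particles c)"
  define Q where "Q R i x \<longleftrightarrow> (\<exists>I. x \<le> lcs R (length W * I + i) - m * int I)" for R i x
  have "\<forall>i\<le>length W. Q R i ((total_flux W c R - m) + elevation (fold (ring_step W) R c) i)"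
  proof (induction R rule: rev_induct)
    case Nil
    have "elevation c i \<le> m" for i
      unfolding elevation_def m_def using particles_simps(3)[of "take i c" "drop i c"] by simp
    then show ?case unfolding Q_def by (intro allI impI exI[of _ 0]) (simp add: total_flux_def)
  next
    case (snoc a R)
    let ?c = "fold (ring_step W) R c"
    let ?v = "ring_flux W a ?c"
    let ?G = "total_flux W c R - m"
    have len: "length ?c = length W" using ring_run c by auto
    have c': "fold (ring_step W) (R @ [a]) c = swept a W ?c ?v" by (simp add: ring_step_def)
    have step: "Q (R @ [a]) i (?G + of_bool v + elevation (swept a W ?c v) i)"
      if "Q (R @ [a]) 0 (?G + of_bool v)" "i \<le> length W" for v i
    proof (rule elevation_swept_lower[where Q = "Q R"])
      show "length ?c = length W" by (rule len)
      show "Q (R @ [a]) (Suc i) (x + 1)" if "i < length W" "W ! i = a" "Q R i x" for i x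
        using that unfolding Q_def by (auto simp: lcs_to_snoc_Suc s_nth)
      show "Q (R @ [a]) (Suc i) x" if "i < length W" "W ! i \<noteq> a" "Q R (Suc i) x \<or> Q (R @ [a]) i x" for i x
      proof -
        have "lcs R (length W * I + Suc i) \<le> lcs (R @ [a]) (length W * I + Suc i)"
          "lcs (R @ [a]) (length W * I + i) \<le> lcs (R @ [a]) (length W * I + Suc i)" for I
          using lcs_to_snoc_ge lcs_to_Suc_ge by auto
        then show ?thesis using that(3) unfolding Q_def by (meson diff_right_mono order_trans)
      qed
    qed (use that snoc in auto)
    \<comment> \<open>At the left end only the carry \<open>False\<close> is justified. A sweep from
      there produces the carry \<open>?v\<close> at the end of period \<open>I\<close>, that is at
      the start of period \<open>Suc I\<close>. As \<open>Q\<close> allows any period, a second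
      sweep may start from \<open>?v\<close>.\<close>
    have "Q R 0 (?G + elevation ?c 0)" using snoc by blast
    then have "Q (R @ [a]) 0 (?G + of_bool False)"
      unfolding Q_def by (simp add: elevation_def) (meson lcs_to_snoc_ge diff_right_mono order_trans)
    from step[OF this, of "length W"]
    have "Q (R @ [a]) (length W) (?G + elevation (swept a W ?c False) (length W))" by simp
    moreover have "elevation (swept a W ?c False) (length W) = m + of_bool ?v"
      using elevation_swept[OF len, of False a "length W"] len ring_run(2)[OF c, of R]
      by (simp add: elevation_def m_def ring_flux_def)
    ultimately obtain I where "?G + m + of_bool ?v \<le> lcs (R @ [a]) (length W * I + length W) - m * int I"
      unfolding Q_def by (auto simp: add.assoc)
    then have "Q (R @ [a]) 0 (?G + of_bool ?v)"
      unfolding Q_def by (intro exI[of _ "Suc I"]) (simp add: algebra_simps)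
    note * = step[OF this]
    have "total_flux W c (R @ [a]) - m = ?G + of_bool ?v"
      by (simp add: total_flux_snoc)
    then show ?case unfolding c' using * by (simp only:) blast
  qed
  from this[rule_format, of 0] show ?thesis
    unfolding Q_def by (auto simp: elevation_def m_def algebra_simps)
qed

end

section \<open>Synchronizing words\<close>

declare upt_Suc [simp del]

lemma sweep_uncalled_particle:
  "length ws = length ds \<Longrightarrow> a \<notin> set ws \<Longrightarrow> True \<in> set ds \<Longrightarrow> carry a ws ds v = False"
  by (induction ws ds arbitrary: v rule: list_induct2) (auto simp: sweep_uncalled_False)

lemma swept_uncalled_carry:
  "length ws = length ds \<Longrightarrow> a \<notin> set ws \<Longrightarrow> carry a ws ds v \<Longrightarrow> True \<notin> set (swept a ws ds v)"
  by (induction ws ds arbitrary: v rule: list_induct2) (auto simp: sweep_uncalled_False)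

text \<open>A call makes a difference only at an empty site with no entering carry. So a carry
  running over holes, and no carry running over particles, leave the sites unchanged whatever letter
  is read.\<close>

lemma sweep_holes: "length ws = n \<Longrightarrow> carry a ws (replicate n False) True = True
    \<and> swept a ws (replicate n False) True = replicate n False"
  by (induction n arbitrary: ws) (auto simp: length_Suc_conv)

lemma sweep_particles: "length ws = n \<Longrightarrow> carry a ws (replicate n True) False = False
    \<and> swept a ws (replicate n True) False = replicate n True"
  by (induction n arbitrary: ws) (auto simp: length_Suc_conv cong: if_cong)

lemma sweep_block:
  assumes "length ws = k" "j < k"
  shows "carry a ws (replicate j False @ replicate (k - j) True) True = False
    \<and> swept a ws (replicate j False @ replicate (k - j) True) True =
        replicate (Suc j) False @ replicate (k - Suc j) True"
proof -
  define w1 where "w1 = take j ws"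
  define w where "w = ws ! j"
  define w2 where "w2 = drop (Suc j) ws"
  have ws: "ws = w1 @ w # w2" and l: "length w1 = j" "length w2 = k - Suc j"
    using assms by (auto simp: w1_def w_def w2_def id_take_nth_drop[symmetric])
  have k: "k - j = Suc (k - Suc j)" using assms by simp
  show ?thesis unfolding ws k
    using sweep_holes[OF l(1)] sweep_particles[OF l(2)] l
    by (simp add: replicate_app_Cons_same cong: if_cong)
qed

lemma upt_split:
  assumes "1 \<le> b" "b \<le> k"
  shows "[1..<Suc k] = [1..<b] @ b # [Suc b..<Suc k]"
proof -
  have "[1..<b + (Suc k - b)] = [1..<b] @ [b..<b + (Suc k - b)]"
    by (rule upt_add_eq_append[OF assms(1)])
  moreover have "b + (Suc k - b) = Suc k" using assms by simp
  moreover have "[b..<Suc k] = b # [Suc b..<Suc k]" using assms by (intro upt_conv_Cons) simp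
  ultimately show ?thesis by (simp only:)
qed

lemma updown_split:
  assumes "1 \<le> b" "b \<le> k"
  shows "updown_word k = [1..<b] @ [b] @ ([Suc b..<Suc k] @ rev [Suc b..<Suc k]) @ [b] @ rev [1..<b]"
  unfolding updown_word_def upt_split[OF assms] by simp

lemma length_updown [simp]: "length (updown_word k) = 2 * k"
  by (simp add: updown_word_def)

lemma set_updown [simp]: "set (updown_word k) = {1..k}"
  by (auto simp: updown_word_def)

abbreviation "ud_step k \<equiv> ring_step (updown_word k)"

definition profiles :: "nat \<Rightarrow> nat \<Rightarrow> bool list set" where
  "profiles k m = {c. length c = 2 * k \<and> particles c = m}"

lemma ud_step_profiles: "c \<in> profiles k m \<Longrightarrow> ud_step k a c \<in> profiles k m"
  by (auto simp: profiles_def particles_ring_step)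

text \<open>Letter \<open>b\<close> occurs exactly twice, and each occurrence resets the carry, to
  \<open>\<not> d\<close> and to \<open>\<not> e\<close>. The sweep thus splits into pieces with
  known starting values; \<open>u\<close> is the carry that passes around the end of the
  ring.\<close>

lemma ud_step_split:
  fixes d e :: bool
  assumes b: "1 \<le> b" "b \<le> k"
    and l: "length L = b - 1" "length X = 2 * (k - b)" "length Y = b - 1"
  defines "u \<equiv> carry b (rev [1..<b]) Y (\<not> e)"
  defines "v0 \<equiv> carry b [1..<b] L u"
  defines "v1 \<equiv> carry b ([Suc b..<Suc k] @ rev [Suc b..<Suc k]) X (\<not> d)"
  shows "ud_step k b (L @ [d] @ X @ [e] @ Y) =
    swept b [1..<b] L u @ [\<not> v0] @ swept b ([Suc b..<Suc k] @ rev [Suc b..<Suc k]) X (\<not> d)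
      @ [\<not> v1] @ swept b (rev [1..<b]) Y (\<not> e)"
proof -
  let ?M = "[Suc b..<Suc k] @ rev [Suc b..<Suc k]"
  have l': "length [1..<b] = length L" "length ?M = length X" "length (rev [1..<b]) = length Y"
    using l b by auto
  have W: "updown_word k = [1..<b] @ [b] @ ?M @ [b] @ rev [1..<b]" by (rule updown_split[OF b])
  have "ud_step k b (L @ [d] @ X @ [e] @ Y) = swept b (updown_word k) (L @ [d] @ X @ [e] @ Y) u"
  proof (rule ring_step_eqI)
    show "length (L @ [d] @ X @ [e] @ Y) = length (updown_word k)" using l b by simp
    show "b \<in> set (updown_word k)" using b by simp
    show "carry b (updown_word k) (L @ [d] @ X @ [e] @ Y) u = u"
      unfolding W using l' by (simp only: carry_append list.size) (simp add: u_def)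
  qed
  also have "\<dots> = swept b [1..<b] L u @ [\<not> v0] @ swept b ?M X (\<not> d)
      @ [\<not> v1] @ swept b (rev [1..<b]) Y (\<not> e)"
    unfolding W using l' by (simp only: swept_append list.size) (simp add: v0_def v1_def)
  finally show ?thesis .
qed

lemma split_ends:
  assumes "length c = 2 * n" "1 \<le> n"
  obtains d X e where "c = [d] @ X @ [e]" "length X = 2 * (n - 1)"
proof -
  obtain d X1 where X1: "c = d # X1" using assms by (cases c) auto
  moreover obtain X e where "X1 = X @ [e]" using assms X1 by (cases X1 rule: rev_cases) auto
  ultimately show ?thesis using that[of d X e] assms(1) by auto
qed

text \<open>The last \<open>b\<close> sites carry the letters \<open>b\<close> down to
  \<open>1\<close>, hence not the next letter \<open>b + 1\<close>. A particle among them absorbs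
  the carry coming from the right and shields the block at the left end.\<close>

definition filled_to :: "nat \<Rightarrow> nat \<Rightarrow> bool list \<Rightarrow> bool" where
  "filled_to k b c \<longleftrightarrow> (\<exists>X Y. c = replicate b True @ X @ Y \<and> length X = 2 * (k - b) \<and> length Y = b
     \<and> (True \<in> set Y \<or> particles c = b))"

lemma filled_to_step:
  assumes "filled_to k b c" "c \<in> profiles k m" "b < k" "b < m"
  shows "filled_to k (Suc b) (ud_step k (Suc b) c)"
proof -
  obtain X0 Y where c: "c = replicate b True @ X0 @ Y" "length X0 = 2 * (k - b)" "length Y = b" "True \<in> set Y"
    using assms by (auto simp: filled_to_def profiles_def)
  obtain d X e where X0: "X0 = [d] @ X @ [e]" by (rule split_ends[OF c(2)]) (use assms(3) in auto)
  let ?M = "[Suc (Suc b)..<Suc k] @ rev [Suc (Suc b)..<Suc k]"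
  have lX: "length X = 2 * (k - Suc b)" using c(2) X0 by simp
  define v1 where "v1 = carry (Suc b) ?M X (\<not> d)"
  define X' where "X' = swept (Suc b) ?M X (\<not> d)"
  define Y' where "Y' = swept (Suc b) (rev [1..<Suc b]) Y (\<not> e)"
  have u: "carry (Suc b) (rev [1..<Suc b]) Y (\<not> e) = False"
    using c by (intro sweep_uncalled_particle) auto
  have L: "carry (Suc b) [1..<Suc b] (replicate b True) False = False"
    "swept (Suc b) [1..<Suc b] (replicate b True) False = replicate b True"
    using sweep_particles[of "[1..<Suc b]" b] by auto
  have c': "ud_step k (Suc b) c = replicate b True @ [True] @ X' @ [\<not> v1] @ Y'"
    using ud_step_split[of "Suc b" k "replicate b True" X Y d e] c X0 lX assms(3) u L
    by (simp add: v1_def X'_def Y'_def)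
  have l': "length X' = 2 * (k - Suc b)" "length Y' = b"
    unfolding X'_def Y'_def using lX c by auto
  have "True \<in> set ([\<not> v1] @ Y') \<or> particles (ud_step k (Suc b) c) = Suc b"
  proof (cases v1)
    case True
    then have "True \<notin> set X'" unfolding X'_def v1_def using lX by (intro swept_uncalled_carry) auto
    then have "particles X' = 0" by (simp add: particles_eq_0_iff)
    then have "particles (ud_step k (Suc b) c) = Suc b + particles Y'"
      unfolding c' using True by simp
    moreover have "particles Y' = 0" if "True \<notin> set Y'" using that by (simp only: particles_eq_0_iff not_False_eq_True)
    ultimately show ?thesis by (cases "True \<in> set Y'") (simp_all only: set_append Un_iff add_0_right simp_thms)
  qed simp
  moreover have "ud_step k (Suc b) c = replicate (Suc b) True @ X' @ ([\<not> v1] @ Y')"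
    unfolding c' by (simp add: replicate_app_Cons_same)
  ultimately show ?thesis unfolding filled_to_def using l'
    by (intro exI[of _ X'] exI[of _ "[\<not> v1] @ Y'"]) simp
qed

text \<open>With at least two particles a call of \<open>1\<close> turns the end sites
  \<open>d\<close>, \<open>e\<close> into \<open>e\<close>, \<open>True\<close>: the carry
  \<open>\<not> d\<close> is \<open>False\<close> or is absorbed by a particle in between. Two calls
  fill both ends.\<close>

lemma filled_to_1:
  assumes "c \<in> profiles k m" "2 \<le> k" "2 \<le> m"
  shows "filled_to k 1 (ud_step k 1 (ud_step k 1 c))"
proof -
  let ?M = "[Suc 1..<Suc k] @ rev [Suc 1..<Suc k]"
  have call: "ud_step k 1 ([d] @ X @ [e]) = [e] @ swept 1 ?M X (\<not> d) @ [True]"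
    if "[d] @ X @ [e] \<in> profiles k m" "length X = 2 * (k - 1)" for d X e
  proof -
    have "carry 1 ?M X (\<not> d) = False"
    proof (cases d)
      case True
      then show ?thesis using sweep_uncalled_False[of ?M X 1] that by auto
    next
      case False
      then have "particles X + of_bool e = m" using that by (simp add: profiles_def)
      then have "particles X \<noteq> 0" using assms(3) by (cases e) simp_all
      then show ?thesis using sweep_uncalled_particle[of ?M X 1] that by (auto simp: particles_eq_0_iff)
    qed
    then show ?thesis using ud_step_split[of 1 k "[]" X "[]" d e] that assms by simp
  qed
  obtain d X e where c: "c = [d] @ X @ [e]" "length X = 2 * (k - 1)"
    by (rule split_ends[of c k]) (use assms in \<open>auto simp: profiles_def\<close>)
  define X' where "X' = swept 1 ?M X (\<not> d)"
  have X': "length X' = 2 * (k - 1)" unfolding X'_def using c by simp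
  have c': "ud_step k 1 c = [e] @ X' @ [True]" using call[of d X e] c assms X'_def by simp
  then have "[e] @ X' @ [True] \<in> profiles k m" using ud_step_profiles[OF assms(1)] by metis
  from call[OF this X'] have "ud_step k 1 (ud_step k 1 c) = [True] @ swept 1 ?M X' (\<not> e) @ [True]"
    unfolding c' .
  then show ?thesis unfolding filled_to_def using X'
    by (intro exI[of _ "swept 1 ?M X' (\<not> e)"] exI[of _ "[True]"]) simp
qed

lemma fold_ud_step_profiles: "c \<in> profiles k m \<Longrightarrow> fold (ud_step k) R c \<in> profiles k m"
  by (induction R arbitrary: c) (auto simp: ud_step_profiles)

lemma filled_to_word:
  assumes "c \<in> profiles k m" "2 \<le> k" "2 \<le> m" "1 \<le> b" "b \<le> k" "b \<le> m"
  shows "filled_to k b (fold (ud_step k) (1 # [1..<Suc b]) c)"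
  using assms(4-)
proof (induction b rule: nat_induct_at_least)
  case base
  then show ?case using filled_to_1[OF assms(1-3)] by (simp add: upt_Suc_append)
next
  case (Suc b)
  then show ?case
    using filled_to_step[OF Suc.IH fold_ud_step_profiles[OF assms(1)]] by (simp add: upt_Suc_append)
qed

text \<open>The shape after calling \<open>k\<close>, ..., \<open>b + 1\<close> from a filled left
  half. Each call ensures that one more site on the right is filled; the particle comes from
  \<open>Y\<close> or, once \<open>Y\<close> has none, from the front of the left half, and
  \<open>j\<close> counts the latter.\<close>

definition filled_from :: "nat \<Rightarrow> nat \<Rightarrow> bool list \<Rightarrow> bool" where
  "filled_from k b c \<longleftrightarrow> (\<exists>j Y. c = (replicate j False @ replicate (k - j) True) @ replicate (k - b) True @ Y
     \<and> length Y = b \<and> j < k \<and> (j = 0 \<or> True \<notin> set Y))"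

lemma filled_from_step:
  assumes "filled_from k b c" "c \<in> profiles k m" "1 \<le> b" "b \<le> k" "k < m" "2 \<le> k"
  shows "filled_from k (b - 1) (ud_step k b c)"
proof -
  obtain j Y0 where c: "c = (replicate j False @ replicate (k - j) True) @ replicate (k - b) True @ Y0"
    "length Y0 = b" "j < k" "j = 0 \<or> True \<notin> set Y0"
    using assms(1) by (auto simp: filled_from_def)
  obtain e Y where Y0: "Y0 = [e] @ Y" using c(2) assms(3) by (cases Y0) auto
  let ?L = "replicate j False @ replicate (k - j) True"
  let ?R1 = "rev [Suc b..<Suc k]"
  let ?R2 = "rev [1..<b]"
  have W: "updown_word k = [1..<Suc k] @ ?R1 @ [b] @ ?R2"
    using upt_split[OF assms(3,4)] by (simp add: updown_word_def)
  have lW: "length [1..<Suc k] = length ?L" "length ?R1 = length (replicate (k - b) True)" "length ?R2 = length Y"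
    using c(2,3) Y0 assms by auto
  define u where "u = carry b ?R2 Y (\<not> e)"
  have L: "(u \<and> j < k \<longrightarrow> carry b [1..<Suc k] ?L u = False \<and>
      swept b [1..<Suc k] ?L u = replicate (Suc j) False @ replicate (k - Suc j) True)"
    using sweep_block[of "[1..<Suc k]" k j b] by auto
  have L0: "\<not> u \<Longrightarrow> j = 0 \<Longrightarrow> carry b [1..<Suc k] ?L u = False \<and>
      swept b [1..<Suc k] ?L u = replicate k True"
    using sweep_particles[of "[1..<Suc k]" k b] by auto
  have uj: "u" if "j > 0"
  proof -
    have "True \<notin> set Y0" using c that by auto
    then have "\<not> e" "Y = replicate (b - 1) False" using Y0 c(2) no_particles_iff[of Y] by auto
    then show ?thesis unfolding u_def using sweep_holes[of ?R2 "b - 1" b] by simp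
  qed
  have R1: "carry b ?R1 (replicate (k - b) True) False = False"
    "swept b ?R1 (replicate (k - b) True) False = replicate (k - b) True"
    using sweep_particles[of ?R1 "k - b" b] by auto
  have carryL: "carry b [1..<Suc k] ?L u = False" using L L0 uj c(3) by blast
  have "ud_step k b c = swept b (updown_word k) c u"
  proof (rule ring_step_eqI)
    show "length c = length (updown_word k)" using assms(2) by (simp add: profiles_def)
    show "b \<in> set (updown_word k)" using assms by simp
    show "carry b (updown_word k) c u = u"
      unfolding W c(1) Y0 using lW by (simp only: carry_append list.size carryL R1) (simp add: u_def)
  qed
  also have "\<dots> = swept b [1..<Suc k] ?L u @ replicate (k - b) True @ [True] @ swept b ?R2 Y (\<not> e)"
    unfolding W c(1) Y0 using lW by (simp only: swept_append list.size carryL R1) simp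
  also have "replicate (k - b) True @ [True] @ swept b ?R2 Y (\<not> e)
      = replicate (k - (b - 1)) True @ swept b ?R2 Y (\<not> e)"
  proof -
    have "k - (b - 1) = Suc (k - b)" using assms(3,4) by simp
    then show ?thesis by (simp add: replicate_app_Cons_same)
  qed
  finally have step: "ud_step k b c = swept b [1..<Suc k] ?L u
      @ replicate (k - (b - 1)) True @ swept b ?R2 Y (\<not> e)" .
  have lY: "length (swept b ?R2 Y (\<not> e)) = b - 1" using lW(3) by simp
  show ?thesis
  proof (cases u)
    case True
    have Yn: "True \<notin> set (swept b ?R2 Y (\<not> e))"
      using True lW(3) unfolding u_def by (intro swept_uncalled_carry) auto
    \<comment> \<open>If \<open>Y0\<close> is empty, all \<open>m > k\<close> particles lie in the
      left half and in the \<open>k - b\<close> filled sites, so at least two remain in the left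
      half.\<close>
    have "Suc j < k"
    proof (cases "j = 0")
      case False
      have "particles c = m" using assms(2) by (simp add: profiles_def)
      moreover have "particles Y0 = 0" using c False by (simp add: particles_eq_0_iff)
      ultimately have "(k - j) + (k - b) = m" using c(1) by simp
      then show ?thesis using assms c(3) by linarith
    qed (use assms in auto)
    then show ?thesis unfolding filled_from_def step using L True c(3) lY Yn by blast
  next
    case False
    then have "j = 0" using uj by blast
    then show ?thesis unfolding filled_from_def step using L0 False c(3) lY
      by (intro exI[of _ 0]) auto
  qed
qed

lemma filled_from_word:
  assumes "c \<in> profiles k m" "filled_from k k c" "b \<le> k" "k < m" "2 \<le> k"
  shows "filled_from k b (fold (ud_step k) (rev [Suc b..<Suc k]) c)"
  using assms(3)
proof (induction "k - b" arbitrary: b)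
  case 0
  then show ?case using assms by simp
next
  case (Suc n)
  then have "n = k - Suc b" "Suc b \<le> k" by auto
  from Suc.hyps(1)[OF this] filled_from_step[of k "Suc b" "fold (ud_step k) (rev [Suc (Suc b)..<Suc k]) c" m]
  show ?case using assms fold_ud_step_profiles \<open>Suc b \<le> k\<close> by (simp add: upt_conv_Cons[of "Suc b"])
qed

lemma profile_with_block:
  assumes "particles c = b" "c = replicate b True @ Z"
  shows "c = replicate b True @ replicate (length Z) False"
  using assms no_particles_iff[of Z] by (simp add: particles_eq_0_iff[symmetric])

text \<open>The word \<open>1 1 2 ... m\<close> builds a block from the left, but only as far as the
  middle of the ring. With more than \<open>k\<close> particles a second pass \<open>k ... 1\<close>
  collects the remaining ones on the right. A single particle leaves none for the shield and is
  treated apart.\<close>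

theorem synchronizing_word:
  assumes "2 \<le> k" "m \<le> 2 * k"
  obtains u t where "set u \<subseteq> {1..k}" "\<And>c. c \<in> profiles k m \<Longrightarrow> fold (ud_step k) u c = t"
proof -
  consider "m = 0" | "m = 1" | "2 \<le> m" "m \<le> k" | "k < m" by linarith
  then show ?thesis
  proof cases
    case 1
    have "c = replicate (2 * k) False" if "c \<in> profiles k m" for c
      using that 1 no_particles_iff[of c] by (auto simp: profiles_def particles_eq_0_iff)
    then show ?thesis by (intro that[of "[]"]) auto
  next
    case 2
    have "fold (ud_step k) [1, 2] c = [False, True] @ replicate (2 * (k - 2)) False @ [False, False]"
      if "c \<in> profiles k m" for c
    proof -
      let ?M = "[Suc 1..<Suc k] @ rev [Suc 1..<Suc k]"
      have "length c = 2 * k" using that by (simp add: profiles_def)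
      then obtain d X e where c: "c = [d] @ X @ [e]" "length X = 2 * (k - 1)"
        by (rule split_ends) (use assms in simp)
      define v where "v = carry 1 ?M X (\<not> d)"
      define X' where "X' = swept 1 ?M X (\<not> d)"
      have lX': "length X' = 2 * (k - 1)" unfolding X'_def using c by simp
      have c': "ud_step k 1 c = [e] @ X' @ [\<not> v]"
        using ud_step_split[of 1 k "[]" X "[]" d e] c assms by (simp add: v_def X'_def)
      then have p: "of_bool e + particles X' + of_bool (\<not> v) = 1"
        using ud_step_profiles[OF that, of 1] 2 by (simp add: profiles_def)
      have X': "True \<notin> set X'"
      proof (cases v)
        case True
        then show ?thesis unfolding X'_def v_def using c by (intro swept_uncalled_carry) auto
      next
        case False
        then show ?thesis using p by (simp add: particles_eq_0_iff[symmetric])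
      qed
      then have "particles X' = 0" by (simp add: particles_eq_0_iff)
      then have ev: "e = v" using p by (cases e; cases v) simp_all
      have "X' = replicate (Suc (2 * (k - 2)) + 1) False"
        using X' lX' assms no_particles_iff[of X'] by (simp add: numeral_2_eq_2 Suc_diff_Suc)
      then have X'eq: "X' = [False] @ replicate (2 * (k - 2)) False @ [False]"
        unfolding replicate_add by simp
      let ?M2 = "[Suc 2..<Suc k] @ rev [Suc 2..<Suc k]"
      have M2: "carry 2 ?M2 (replicate (2 * (k - 2)) False) True = True"
        "swept 2 ?M2 (replicate (2 * (k - 2)) False) True = replicate (2 * (k - 2)) False"
        using sweep_holes[of ?M2 "2 * (k - 2)" 2] by auto
      have one: "[Suc 0..<2] = [Suc 0]" by (simp add: numeral_2_eq_2 upt_Suc_append)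
      have "ud_step k 2 ([e] @ [False] @ replicate (2 * (k - 2)) False @ [False] @ [\<not> v])
          = [False] @ [True] @ replicate (2 * (k - 2)) False @ [False] @ [False]"
        using ud_step_split[of 2 k "[e]" "replicate (2 * (k - 2)) False" "[\<not> v]" False False] assms M2 ev
        by (simp add: one)
      then show ?thesis using c' X'eq by simp
    qed
    then show ?thesis using assms by (intro that[of "[1, 2]"]) auto
  next
    case 3
    have "fold (ud_step k) (1 # [1..<Suc m]) c = replicate m True @ replicate (2 * k - m) False"
      if "c \<in> profiles k m" for c
    proof -
      let ?c = "fold (ud_step k) (1 # [1..<Suc m]) c"
      have *: "filled_to k m ?c" using filled_to_word[OF that assms(1)] 3 by simp
      have p: "?c \<in> profiles k m" using that by (rule fold_ud_step_profiles)
      obtain Z where Z: "?c = replicate m True @ Z" using * by (auto simp: filled_to_def)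
      then have "length ?c = m + length Z" by simp
      then have "length Z = 2 * k - m" using p unfolding profiles_def by auto
      moreover have "particles ?c = m" using p unfolding profiles_def by auto
      ultimately show ?thesis using profile_with_block[OF _ Z] by simp
    qed
    then show ?thesis using 3 by (intro that[of "1 # [1..<Suc m]"]) auto
  next
    case 4
    let ?u = "(1 # [1..<Suc k]) @ rev [Suc 0..<Suc k]"
    have "fold (ud_step k) ?u c = replicate (2 * k - m) False @ replicate m True" if "c \<in> profiles k m" for c
    proof -
      let ?c1 = "fold (ud_step k) (1 # [1..<Suc k]) c"
      let ?c = "fold (ud_step k) ?u c"
      have p1: "?c1 \<in> profiles k m" and p: "?c \<in> profiles k m" using that by (rule fold_ud_step_profiles)+
      have "filled_to k k ?c1" using filled_to_word[OF that assms(1)] 4 assms by simp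
      then obtain Y where "?c1 = replicate k True @ Y" "length Y = k" by (auto simp: filled_to_def)
      then have "filled_from k k ?c1" unfolding filled_from_def using assms
        by (intro exI[of _ 0] exI[of _ Y]) simp
      from filled_from_word[OF p1 this, of 0] 4 assms have "filled_from k 0 ?c" by simp
      then obtain j where j: "?c = replicate j False @ replicate (k - j) True @ replicate k True" "j < k"
        by (auto simp: filled_from_def)
      then have "(k - j) + k = m" using p unfolding profiles_def by simp
      then show ?thesis using j 4 by (auto simp: replicate_add[symmetric])
    qed
    then show ?thesis using 4 assms by (intro that[of ?u]) auto
  qed
qed

section \<open>The stationary weights\<close>

text \<open>Letter \<open>b\<close> labels the sites \<open>b - 1\<close> and \<open>2 * k - b\<close> of the ring. A profile is read as the
  list of these \<open>k\<close> columns, so that the up-down word becomes nested.\<close>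

type_synonym columns = "(bool \<times> bool) list"

definition unroll :: "columns \<Rightarrow> bool list" where
  "unroll c = map fst c @ rev (map snd c)"

lemma unroll_simps [simp]: "unroll [] = []" "unroll ((l, r) # c) = l # unroll c @ [r]"
  by (auto simp: unroll_def)

lemma length_unroll [simp]: "length (unroll c) = 2 * length c"
  by (simp add: unroll_def)

definition carry_at :: "bool \<Rightarrow> bool \<Rightarrow> bool \<Rightarrow> bool" where
  "carry_at called d v = (if called then \<not> d else v \<and> \<not> d)"

definition site_at :: "bool \<Rightarrow> bool \<Rightarrow> bool \<Rightarrow> bool" where
  "site_at called d v = (if called then \<not> v else d \<and> \<not> v)"

text \<open>The called column is counted from the outermost remaining one; \<open>None\<close> says
  that no remaining column is called.\<close>

fun inward :: "nat option \<Rightarrow> nat option" where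
  "inward (Some (Suc j)) = Some j"
| "inward _ = None"

fun col_carry :: "nat option \<Rightarrow> columns \<Rightarrow> bool \<Rightarrow> bool" where
  "col_carry q [] v = v"
| "col_carry q ((l, r) # c) v =
     carry_at (q = Some 0) r (col_carry (inward q) c (carry_at (q = Some 0) l v))"

fun col_swept :: "nat option \<Rightarrow> columns \<Rightarrow> bool \<Rightarrow> columns" where
  "col_swept q [] v = []"
| "col_swept q ((l, r) # c) v = (let v1 = carry_at (q = Some 0) l v in
     (site_at (q = Some 0) l v, site_at (q = Some 0) r (col_carry (inward q) c v1)) # col_swept (inward q) c v1)"

lemma length_col_swept [simp]: "length (col_swept q c v) = length c"
  by (induction q c v rule: col_swept.induct) (auto simp: Let_def)

lemma unroll_sweep:
  fixes b :: nat
  assumes "n = length c" "q = (if b \<le> a \<and> a < b + n then Some (a - b) else None)"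
  shows "carry a ([b..<b + n] @ rev [b..<b + n]) (unroll c) v = col_carry q c v"
    and "swept a ([b..<b + n] @ rev [b..<b + n]) (unroll c) v = unroll (col_swept q c v)"
proof -
  have "carry a ([b..<b + n] @ rev [b..<b + n]) (unroll c) v = col_carry q c v \<and>
    swept a ([b..<b + n] @ rev [b..<b + n]) (unroll c) v = unroll (col_swept q c v)"
    using assms
  proof (induction c arbitrary: b n q v)
    case (Cons x c)
    obtain l r where x: "x = (l, r)" by (cases x)
    let ?M = "[Suc b..<Suc b + length c] @ rev [Suc b..<Suc b + length c]"
    have W: "[b..<b + n] @ rev [b..<b + n] = b # ?M @ [b]"
      using Cons.prems upt_conv_Cons[of b "b + n"] by simp
    define v1 where "v1 = carry_at (q = Some 0) l v"
    have q0: "q = Some 0 \<longleftrightarrow> b = a" using Cons.prems by auto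
    have iq: "inward q = (if Suc b \<le> a \<and> a < Suc b + length c then Some (a - Suc b) else None)"
    proof (cases "Suc b \<le> a \<and> a < Suc b + length c")
      case True
      then have "q = Some (Suc (a - Suc b))" using Cons.prems by auto
      then show ?thesis using True by simp
    next
      case False
      then have "q = None \<or> q = Some 0" using Cons.prems by auto
      then show ?thesis using False by (auto simp del: not_less)
    qed
    have IH: "carry a ?M (unroll c) v1 = col_carry (inward q) c v1"
      "swept a ?M (unroll c) v1 = unroll (col_swept (inward q) c v1)"
      using Cons.IH[OF refl iq] by auto
    have len: "length ?M = length (unroll c)" by simp
    have v1: "(if b = a then \<not> l else v \<and> \<not> l) = v1" using q0 by (auto simp: v1_def carry_at_def)
    have "col_carry q ((l, r) # c) v = carry_at (q = Some 0) r (col_carry (inward q) c v1)"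
      "col_swept q ((l, r) # c) v = (site_at (q = Some 0) l v,
         site_at (q = Some 0) r (col_carry (inward q) c v1)) # col_swept (inward q) c v1"
      by (simp_all add: v1_def Let_def)
    then show ?case unfolding W x unroll_simps carry.simps swept.simps v1
        carry_append[OF len] swept_append[OF len] IH
      using q0 by (auto simp: carry_at_def site_at_def)
  qed simp
  then show "carry a ([b..<b + n] @ rev [b..<b + n]) (unroll c) v = col_carry q c v"
    "swept a ([b..<b + n] @ rev [b..<b + n]) (unroll c) v = unroll (col_swept q c v)" by auto
qed

definition col_flux :: "nat \<Rightarrow> columns \<Rightarrow> bool" where
  "col_flux j c = col_carry (Some j) c False"

definition col_step :: "nat \<Rightarrow> columns \<Rightarrow> columns" where
  "col_step j c = col_swept (Some j) c (col_flux j c)"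

lemma unroll_ring:
  assumes "length c = k" "j < k"
  shows "ring_flux (updown_word k) (Suc j) (unroll c) = col_flux j c"
    and "ud_step k (Suc j) (unroll c) = unroll (col_step j c)"
proof -
  have W: "updown_word k = [1..<1 + k] @ rev [1..<1 + k]" by (simp add: updown_word_def)
  have q: "Some j = (if 1 \<le> Suc j \<and> Suc j < 1 + k then Some (Suc j - 1) else None)" using assms by simp
  note fs = unroll_sweep[OF assms(1)[symmetric] q]
  show "ring_flux (updown_word k) (Suc j) (unroll c) = col_flux j c"
    unfolding ring_flux_def col_flux_def W fs ..
  then show "ud_step k (Suc j) (unroll c) = unroll (col_step j c)"
    unfolding ring_step_def col_step_def using fs(2) by (simp only: W)
qed

lemma col_carry_called: "j < length c \<Longrightarrow> col_carry (Some j) c v = col_carry (Some j) c False"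
  using unroll_sweep(1)[of "length c" c "Some j" 0 j] carry_called[of "[0..<length c] @ rev [0..<length c]" "unroll c" j v]
  by simp

text \<open>The weight is the continuant with diagonal entries \<open>1 + p\<^sub>b\<close> and off-diagonal products \<open>q\<^sub>b\<close>,
  where \<open>p\<^sub>b\<close> says that both sites of column \<open>b\<close> are empty and \<open>q\<^sub>b\<close> that the right site of
  column \<open>b\<close> and the left site of column \<open>b + 1\<close> are empty.\<close>

fun wt :: "columns \<Rightarrow> real" and wtu :: "columns \<Rightarrow> real" where
  "wt [] = 1"
| "wt ((l, r) # c) = (1 + of_bool (\<not> l \<and> \<not> r)) * wt c - of_bool (\<not> r) * wtu c"
| "wtu [] = 0"
| "wtu ((l, r) # c) = of_bool (\<not> l) * wt c"

definition cols :: "nat \<Rightarrow> columns set" where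
  "cols n = {c. length c = n}"

lemma cols_0 [simp]: "cols 0 = {[]}"
  by (auto simp: cols_def)

lemma finite_cols [simp]: "finite (cols n)"
  using finite_lists_length_eq[of "UNIV :: (bool \<times> bool) set" n] by (simp add: cols_def)

lemma sum_bool: "(\<Sum>b\<in>UNIV. f b) = f False + f True" for f :: "bool \<Rightarrow> 'a::comm_monoid_add"
  by (simp add: UNIV_bool)

lemma sum_cols_Suc:
  "(\<Sum>c\<in>cols (Suc n). F c) = (\<Sum>l\<in>UNIV. \<Sum>r\<in>UNIV. \<Sum>c\<in>cols n. F ((l, r) # c))"
proof -
  have "(\<Sum>l\<in>UNIV. \<Sum>r\<in>UNIV. \<Sum>c\<in>cols n. F ((l, r) # c)) =
      (\<Sum>(l, r, c)\<in>UNIV \<times> UNIV \<times> cols n. F ((l, r) # c))"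
    by (simp add: sum.cartesian_product)
  also have "\<dots> = (\<Sum>c\<in>cols (Suc n). F c)"
    by (rule sum.reindex_bij_witness[of _ "\<lambda>c. (fst (hd c), snd (hd c), tl c)" "\<lambda>(l, r, c). (l, r) # c"])
      (auto simp: cols_def length_Suc_conv)
  finally show ?thesis by simp
qed

text \<open>Keeping both carries as indices makes stationarity local: the values at
  \<open>(l', r') # c'\<close> are linear in those at \<open>c'\<close>.\<close>

definition pre :: "(columns \<Rightarrow> real) \<Rightarrow> nat option \<Rightarrow> columns \<Rightarrow> bool \<Rightarrow> bool \<Rightarrow> real" where
  "pre f q c' vi vo = (\<Sum>c\<in>cols (length c'). of_bool (col_carry q c vi = vo \<and> col_swept q c vi = c') * f c)"

lemma pre_Nil [simp]: "pre f q [] vi vo = of_bool (vi = vo) * f []"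
  by (simp add: pre_def)

lemma pre_Cons:
  assumes f: "\<And>l r c. f ((l, r) # c) = A l r * g c - B l r * h c"
  shows "pre f q ((l', r') # c') vi vo =
    (\<Sum>l\<in>UNIV. \<Sum>r\<in>UNIV. \<Sum>v\<in>UNIV. of_bool (site_at (q = Some 0) l vi = l'
        \<and> carry_at (q = Some 0) r v = vo \<and> site_at (q = Some 0) r v = r') *
      (A l r * pre g (inward q) c' (carry_at (q = Some 0) l vi) v
        - B l r * pre h (inward q) c' (carry_at (q = Some 0) l vi) v))"
proof -
  let ?q = "q = Some 0"
  have "(\<Sum>c\<in>cols (length c'). of_bool (col_carry q ((l, r) # c) vi = vo \<and>
        col_swept q ((l, r) # c) vi = (l', r') # c') * f ((l, r) # c)) =
      (\<Sum>v\<in>UNIV. of_bool (site_at ?q l vi = l' \<and> carry_at ?q r v = vo \<and> site_at ?q r v = r') *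
      (A l r * pre g (inward q) c' (carry_at ?q l vi) v - B l r * pre h (inward q) c' (carry_at ?q l vi) v))"
    for l r
  proof -
    let ?u = "carry_at ?q l vi"
    have "of_bool (col_carry q ((l, r) # c) vi = vo \<and> col_swept q ((l, r) # c) vi = (l', r') # c') * f ((l, r) # c)
      = (\<Sum>v\<in>UNIV. of_bool (site_at ?q l vi = l' \<and> carry_at ?q r v = vo \<and> site_at ?q r v = r') *
        (A l r * (of_bool (col_carry (inward q) c ?u = v \<and> col_swept (inward q) c ?u = c') * g c)
         - B l r * (of_bool (col_carry (inward q) c ?u = v \<and> col_swept (inward q) c ?u = c') * h c)))" for c
      by (cases "col_carry (inward q) c ?u") (auto simp: sum_bool Let_def f)
    then show ?thesis
      unfolding pre_def sum_distrib_left sum_subtractf[symmetric] by (subst sum.swap) simp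
  qed
  then show ?thesis unfolding pre_def[of f] length_Cons sum_cols_Suc by (simp only:)
qed

definition push_wt ::
  "bool \<Rightarrow> (bool \<Rightarrow> bool \<Rightarrow> real) \<Rightarrow> (bool \<Rightarrow> bool \<Rightarrow> real) \<Rightarrow> bool \<Rightarrow> bool \<Rightarrow> bool \<Rightarrow> bool \<Rightarrow> real" where
  "push_wt called F G l' r' vi vo = (\<Sum>l\<in>UNIV. \<Sum>r\<in>UNIV. \<Sum>v\<in>UNIV. of_bool (site_at called l vi = l'
        \<and> carry_at called r v = vo \<and> site_at called r v = r') *
      ((1 + of_bool (\<not> l \<and> \<not> r)) * F (carry_at called l vi) v - of_bool (\<not> r) * G (carry_at called l vi) v))"

text \<open>The vanishing term with \<open>G\<close> keeps the shape of \<open>pre_Cons\<close>,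
  here with \<open>B = 0\<close>.\<close>

definition push_wtu ::
  "bool \<Rightarrow> (bool \<Rightarrow> bool \<Rightarrow> real) \<Rightarrow> (bool \<Rightarrow> bool \<Rightarrow> real) \<Rightarrow> bool \<Rightarrow> bool \<Rightarrow> bool \<Rightarrow> bool \<Rightarrow> real" where
  "push_wtu called F G l' r' vi vo = (\<Sum>l\<in>UNIV. \<Sum>r\<in>UNIV. \<Sum>v\<in>UNIV. of_bool (site_at called l vi = l'
        \<and> carry_at called r v = vo \<and> site_at called r v = r') *
      (of_bool (\<not> l) * F (carry_at called l vi) v - 0 * G (carry_at called l vi) v))"

lemma pre_push:
  "pre wt q ((l', r') # c') = push_wt (q = Some 0) (pre wt (inward q) c') (pre wtu (inward q) c') l' r'"
  "pre wtu q ((l', r') # c') = push_wtu (q = Some 0) (pre wt (inward q) c') (pre wtu (inward q) c') l' r'"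
  unfolding fun_eq_iff push_wt_def push_wtu_def by (intro allI pre_Cons, simp)+

definition pre_all :: "(columns \<Rightarrow> real) \<Rightarrow> columns \<Rightarrow> bool \<Rightarrow> bool \<Rightarrow> real" where
  "pre_all f c' vi vo = (\<Sum>j<length c'. pre f (Some j) c' vi vo)"

lemma pre_all_push:
  "pre_all wt ((l', r') # c') vi vo = pre wt (Some 0) ((l', r') # c') vi vo
    + push_wt False (pre_all wt c') (pre_all wtu c') l' r' vi vo"
  "pre_all wtu ((l', r') # c') vi vo = pre wtu (Some 0) ((l', r') # c') vi vo
    + push_wtu False (pre_all wt c') (pre_all wtu c') l' r' vi vo"
proof -
  have 1: "pre_all f ((l', r') # c') vi vo = pre f (Some 0) ((l', r') # c') vi vo
      + (\<Sum>j<length c'. pre f (Some (Suc j)) ((l', r') # c') vi vo)" for f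
    unfolding pre_all_def length_Cons by (rule sum.lessThan_Suc_shift)
  have 2: "(Some (Suc j) = Some 0) = False" "inward (Some (Suc j)) = Some j" for j by simp_all
  show "pre_all wt ((l', r') # c') vi vo = pre wt (Some 0) ((l', r') # c') vi vo
      + push_wt False (pre_all wt c') (pre_all wtu c') l' r' vi vo"
    and "pre_all wtu ((l', r') # c') vi vo = pre wtu (Some 0) ((l', r') # c') vi vo
      + push_wtu False (pre_all wt c') (pre_all wtu c') l' r' vi vo"
    unfolding 1 unfolding pre_push 2 push_wt_def push_wtu_def unfolding pre_all_def
    by (simp_all only: sum_bool sum.distrib sum_subtractf sum_distrib_left[symmetric])
qed

text \<open>Stationarity is the value of \<open>SW c False False + SW c True True\<close>. The other
  linear relations are those that make the induction close when a column is added. \<open>X\<close>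
  stands for no called column, \<open>S\<close> for the sum over the called column.\<close>

lemma pre_relations:
  defines "XW \<equiv> pre wt None" and "XU \<equiv> pre wtu None" and "SW \<equiv> pre_all wt" and "SU \<equiv> pre_all wtu"
  shows "XW c False True = 0 \<and> XU c False True = 0
    \<and> XU c True False = XW c True False - XU c False False
    \<and> SW c True True = XW c True False
    \<and> SU c False True = - XW c False False + XW c True True + XU c False False - XU c True True + SW c False True
    \<and> SU c True False = - XW c False False + XW c True True + SW c False True + SW c True False - SU c False False
    \<and> SU c True True = XW c True False - XU c False False
    \<and> wt c = XW c False False \<and> wtu c = XU c False False
    \<and> real (length c) * wt c = XW c True False + SW c False False
    \<and> real (length c) * wtu c = XW c False False + XW c True False - XW c True True
        - XU c False False - SW c False True + SU c False False"
proof (induction c)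
  case Nil
  then show ?case unfolding assms by (simp add: pre_all_def)
next
  case (Cons x c)
  obtain l r where x: "x = (l, r)" by (cases x)
  have len: "real (length (x # c)) * y = real (length c) * y + y" for y :: real
    by (simp add: algebra_simps)
  show ?case using Cons unfolding assms x
    by (cases l; cases r) (simp only: len[unfolded x], simp add: pre_push pre_all_push push_wt_def push_wtu_def
        sum_bool site_at_def carry_at_def algebra_simps)+
qed

text \<open>The carry of a called letter forgets its starting value, so each \<open>c\<close> closes
  up for exactly one carry, and the two diagonal entries of \<open>pre_all\<close> count each
  preimage once.\<close>

lemma stationary_at:
  "(\<Sum>j<length c'. \<Sum>c\<in>cols (length c'). of_bool (col_step j c = c') * wt c) = real (length c') * wt c'"
proof -
  have "of_bool (col_step j c = c') = (of_bool (col_carry (Some j) c False = False \<and> col_swept (Some j) c False = c')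
      + of_bool (col_carry (Some j) c True = True \<and> col_swept (Some j) c True = c') :: real)"
    if "j < length c'" "c \<in> cols (length c')" for j c
    using col_carry_called[of j c True] that
    by (cases "col_carry (Some j) c False") (auto simp: col_step_def col_flux_def cols_def)
  then have "(\<Sum>j<length c'. \<Sum>c\<in>cols (length c'). of_bool (col_step j c = c') * wt c) =
      pre_all wt c' False False + pre_all wt c' True True"
    unfolding pre_all_def pre_def sum.distrib[symmetric]
    by (intro sum.cong refl) (simp add: distrib_right)
  then show ?thesis using pre_relations[of c'] by linarith
qed

definition mcols :: "nat \<Rightarrow> nat \<Rightarrow> columns set" where
  "mcols k m = {c \<in> cols k. particles (unroll c) = m}"

lemma finite_mcols [simp]: "finite (mcols k m)"
  by (simp add: mcols_def)

lemma unroll_mcols: "c \<in> mcols k m \<Longrightarrow> unroll c \<in> profiles k m"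
  by (simp add: mcols_def cols_def profiles_def)

text \<open>The weak form, ready for pairing with the Poisson equation. A step preserves the
  particle number, which allows the restriction to \<open>mcols k m\<close>.\<close>

theorem stationary:
  fixes g :: "bool list \<Rightarrow> real"
  shows "(\<Sum>a\<in>{1..k}. \<Sum>c\<in>mcols k m. wt c * g (ud_step k a (unroll c))) =
    real k * (\<Sum>c\<in>mcols k m. wt c * g (unroll c))"
proof -
  define g' where "g' c = of_bool (particles (unroll c) = m) * g (unroll c)" for c
  have restrict: "(\<Sum>c\<in>mcols k m. F c) = (\<Sum>c\<in>cols k. of_bool (particles (unroll c) = m) * F c)" for F :: "_ \<Rightarrow> real"
    unfolding mcols_def by (rule sum.mono_neutral_cong_left) auto
  have "(\<Sum>a\<in>{1..k}. \<Sum>c\<in>mcols k m. wt c * g (ud_step k a (unroll c))) =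
      (\<Sum>j<k. \<Sum>c\<in>mcols k m. wt c * g (ud_step k (Suc j) (unroll c)))"
    by (rule sum.reindex_bij_witness[of _ Suc "\<lambda>a. a - 1"]) auto
  also have "\<dots> = (\<Sum>j<k. \<Sum>c\<in>cols k. wt c * g' (col_step j c))"
  proof (rule sum.cong[OF refl])
    fix j assume "j \<in> {..<k}"
    then have "ud_step k (Suc j) (unroll c) = unroll (col_step j c)"
      "particles (unroll (col_step j c)) = particles (unroll c)" if "c \<in> cols k" for c
      using unroll_ring(2)[of c k j] particles_ring_step[of "unroll c" "updown_word k" "Suc j"] that
      by (auto simp: cols_def)
    then show "(\<Sum>c\<in>mcols k m. wt c * g (ud_step k (Suc j) (unroll c))) = (\<Sum>c\<in>cols k. wt c * g' (col_step j c))"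
      unfolding restrict by (intro sum.cong) (auto simp: g'_def)
  qed
  also have "\<dots> = (\<Sum>j<k. \<Sum>c\<in>cols k. \<Sum>c'\<in>cols k. g' c' * (of_bool (col_step j c = c') * wt c))"
  proof (intro sum.cong refl)
    fix j c assume "c \<in> cols k"
    then have "col_step j c \<in> cols k" by (simp add: cols_def col_step_def)
    then have "(\<Sum>c'\<in>cols k. g' c' * (of_bool (col_step j c = c') * wt c)) = g' (col_step j c) * wt c"
      by (subst sum.remove[of _ "col_step j c"]) (auto intro!: sum.neutral)
    then show "wt c * g' (col_step j c) = (\<Sum>c'\<in>cols k. g' c' * (of_bool (col_step j c = c') * wt c))" by simp
  qed
  also have "\<dots> = (\<Sum>j<k. \<Sum>c'\<in>cols k. \<Sum>c\<in>cols k. g' c' * (of_bool (col_step j c = c') * wt c))"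
    by (rule sum.cong[OF refl], rule sum.swap)
  also have "\<dots> = (\<Sum>c'\<in>cols k. g' c' * (\<Sum>j<k. \<Sum>c\<in>cols k. of_bool (col_step j c = c') * wt c))"
    unfolding sum_distrib_left by (rule sum.swap)
  also have "\<dots> = (\<Sum>c'\<in>cols k. g' c' * (real k * wt c'))"
    using stationary_at by (intro sum.cong) (auto simp: cols_def)
  also have "\<dots> = real k * (\<Sum>c\<in>mcols k m. wt c * g (unroll c))"
    unfolding restrict sum_distrib_left by (intro sum.cong) (auto simp: g'_def)
  finally show ?thesis .
qed

subsection \<open>Total weight and total flux\<close>

definition empties :: "columns \<Rightarrow> nat" where
  "empties c = particles (map Not (unroll c))"

lemma particles_map_Not: "particles (map Not c) + particles c = length c"
  by (induction c) auto

lemma empties_simps [simp]: "empties [] = 0"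
  "empties ((l, r) # c) = of_bool (\<not> l) + of_bool (\<not> r) + empties c"
  by (auto simp: empties_def)

lemma mcols_empties: "m \<le> 2 * k \<Longrightarrow> mcols k m = {c \<in> cols k. empties c = 2 * k - m}"
  using particles_map_Not[of "unroll c" for c]
  by (auto simp: mcols_def cols_def empties_def) (metis diff_add_inverse2 length_unroll diff_diff_cancel le_add2 add_diff_cancel_left')+

text \<open>The variable marks empty sites, in terms of which weights and fluxes are expressed;
  hence the coefficient \<open>2 * k - m\<close> for \<open>m\<close> particles.\<close>

definition genpoly :: "(columns \<Rightarrow> real) \<Rightarrow> nat \<Rightarrow> real poly" where
  "genpoly f n = (\<Sum>c\<in>cols n. smult (f c) ([:0, 1:] ^ empties c))"

lemma coeff_genpoly: "m \<le> 2 * k \<Longrightarrow> coeff (genpoly f k) (2 * k - m) = (\<Sum>c\<in>mcols k m. f c)"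
  unfolding genpoly_def mcols_empties
  by (simp add: coeff_sum monom_altdef[symmetric, of 1, simplified] if_distrib sum.If_cases
      eq_commute[of "2 * k - m"] Int_def cong: if_cong)

lemma genpoly_Suc: "genpoly f (Suc n) =
   [:0, 1:] ^ 2 * genpoly (\<lambda>c. f ((False, False) # c)) n + [:0, 1:] * genpoly (\<lambda>c. f ((False, True) # c)) n
   + [:0, 1:] * genpoly (\<lambda>c. f ((True, False) # c)) n + genpoly (\<lambda>c. f ((True, True) # c)) n"
  unfolding genpoly_def sum_cols_Suc sum_bool sum_distrib_left
  by (simp add: power2_eq_square mult.assoc add.assoc)

lemma genpoly_add: "genpoly (\<lambda>c. f c + g c) n = genpoly f n + genpoly g n"
  and genpoly_diff: "genpoly (\<lambda>c. f c - g c) n = genpoly f n - genpoly g n"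
  and genpoly_0: "genpoly (\<lambda>c. 0) n = 0"
  unfolding genpoly_def
  by (simp_all add: smult_add_left smult_diff_left sum.distrib sum_subtractf)

lemma genpoly_cmult: "genpoly (\<lambda>c. a * f c) n = smult a (genpoly f n)"
proof -
  have "smult a (\<Sum>c\<in>A. h c) = (\<Sum>c\<in>A. smult a (h c))" for A and h :: "columns \<Rightarrow> real poly"
    by (induction A rule: infinite_finite_induct) (auto simp: smult_add_right)
  then show ?thesis by (simp add: genpoly_def)
qed

definition fluxes :: "columns \<Rightarrow> real" where
  "fluxes c = (\<Sum>j<length c. of_bool (col_flux j c))"

text \<open>After the called right site the carry survives only over empty right sites, so column
  \<open>j\<close> gives flux exactly if the right sites of columns \<open>0\<close> to
  \<open>j\<close> are all empty.\<close>

lemma fluxes_simps [simp]: "fluxes [] = 0" "fluxes ((l, r) # c) = of_bool (\<not> r) * (1 + fluxes c)"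
proof -
  show "fluxes [] = 0" by (simp add: fluxes_def)
  have "col_flux 0 ((l, r) # c) = (\<not> r)" "col_flux (Suc j) ((l, r) # c) = (\<not> r \<and> col_flux j c)" for j
    by (auto simp: col_flux_def carry_at_def)
  then show "fluxes ((l, r) # c) = of_bool (\<not> r) * (1 + fluxes c)"
    unfolding fluxes_def length_Cons sum.lessThan_Suc_shift by (cases r) simp_all
qed

lemma genpoly_recursions:
  defines "X \<equiv> [:0, 1 :: real:]"
  shows "genpoly wt (Suc n) = (1 + 2 * X + 2 * X^2) * genpoly wt n - (X + X^2) * genpoly wtu n"
    and "genpoly wtu (Suc n) = (X + X^2) * genpoly wt n"
    and "genpoly (\<lambda>c. wt c * fluxes c) (Suc n) =
      (2 * X^2 + X) * (genpoly wt n + genpoly (\<lambda>c. wt c * fluxes c) n)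
      - (X^2 + X) * (genpoly wtu n + genpoly (\<lambda>c. wtu c * fluxes c) n)"
    and "genpoly (\<lambda>c. wtu c * fluxes c) (Suc n) = X^2 * (genpoly wt n + genpoly (\<lambda>c. wt c * fluxes c) n)"
proof -
  have 2: "smult 2 p = 2 * p" for p :: "real poly" by (simp add: numeral_poly)
  show "genpoly wt (Suc n) = (1 + 2 * X + 2 * X^2) * genpoly wt n - (X + X^2) * genpoly wtu n"
    unfolding genpoly_Suc X_def[symmetric]
    by (simp add: genpoly_diff genpoly_cmult 2) (simp add: algebra_simps)
  show "genpoly wtu (Suc n) = (X + X^2) * genpoly wt n"
    unfolding genpoly_Suc X_def[symmetric] by (simp add: genpoly_0 algebra_simps)
  show "genpoly (\<lambda>c. wt c * fluxes c) (Suc n) =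
      (2 * X^2 + X) * (genpoly wt n + genpoly (\<lambda>c. wt c * fluxes c) n)
      - (X^2 + X) * (genpoly wtu n + genpoly (\<lambda>c. wtu c * fluxes c) n)"
    unfolding genpoly_Suc X_def[symmetric]
    by (simp add: genpoly_0 distrib_left left_diff_distrib genpoly_diff genpoly_add genpoly_cmult mult.assoc 2)
      (simp add: algebra_simps)
  show "genpoly (\<lambda>c. wtu c * fluxes c) (Suc n) = X^2 * (genpoly wt n + genpoly (\<lambda>c. wt c * fluxes c) n)"
    unfolding genpoly_Suc X_def[symmetric]
    by (simp add: genpoly_0 distrib_left genpoly_add)
qed

text \<open>By the second identity the flux is the weight shifted by one empty site, up to a term of
  degree \<open>2 * k + 1\<close>, which lies beyond every coefficient that belongs to a
  profile.\<close>

lemma genpoly_closed: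
  defines "X \<equiv> [:0, 1 :: real:]"
  shows "genpoly wt k = (\<Sum>j\<le>k. (1 + X) ^ (2 * k - 2 * j) * X ^ (2 * j))"
    and "genpoly (\<lambda>c. wt c * fluxes c) k = X * genpoly wt k - of_nat (Suc k) * X ^ (2 * k + 1)"
proof -
  define P where "P = genpoly wt"
  define U where "U = genpoly wtu"
  define F where "F = genpoly (\<lambda>c. wt c * fluxes c)"
  define G where "G = genpoly (\<lambda>c. wtu c * fluxes c)"
  note rec = genpoly_recursions[folded X_def P_def U_def F_def G_def]
  have init: "P 0 = 1" "U 0 = 0" "F 0 = 0" "G 0 = 0"
    by (simp_all add: P_def U_def F_def G_def genpoly_def)
  \<comment> \<open>A relation preserved by the pair of recursions up to the factor
    \<open>X^2\<close>. It eliminates \<open>U\<close> and leaves a first-order recursion for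
    \<open>P\<close>, solved by the sum.\<close>
  have PU: "X * P n = (1 + X) * U n + X ^ (2 * n + 1)" for n
  proof (induction n)
    case (Suc n)
    have "X * P (Suc n) - (1 + X) * U (Suc n) = X^2 * (X * P n - (1 + X) * U n)"
      unfolding rec by algebra
    also have "\<dots> = X^2 * X ^ (2 * n + 1)" using Suc by simp
    also have "\<dots> = X ^ (2 * Suc n + 1)" by (simp add: power_add power2_eq_square)
    finally show ?case by (simp add: algebra_simps)
  qed (simp add: init)
  have Pstep: "P (Suc n) = (1 + X)^2 * P n + X ^ (2 * n + 2)" for n
  proof -
    have "P (Suc n) = (1 + X)^2 * P n + X * (X * P n - (1 + X) * U n)"
      unfolding rec by algebra
    then show ?thesis using PU[of n] by simp
  qed
  have FG: "F n = X * P n - of_nat (Suc n) * X ^ (2 * n + 1) \<and> G n = X * U n - of_nat n * X ^ (2 * n + 1)" for n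
  proof (induction n)
    case (Suc n)
    let ?N = "of_nat n :: real poly"
    let ?Z = "X ^ (2 * n + 1)"
    have Z: "X ^ (2 * Suc n + 1) = X^2 * ?Z" by (simp add: power2_eq_square)
    have F: "F n = X * P n - (?N + 1) * ?Z" and G: "G n = X * U n - ?N * ?Z" using Suc by simp_all
    have PUn: "X * P n = (1 + X) * U n + ?Z" by (rule PU)
    \<comment> \<open>The last summand of the first identity vanishes by \<open>PU\<close>.\<close>
    have aux1: "(2 * X^2 + X) * (p + (X * p - (N + 1) * z)) - (X^2 + X) * (u + (X * u - N * z)) =
        X * ((1 + 2 * X + 2 * X^2) * p - (X + X^2) * u) - (N + 2) * (X^2 * z) + X * (X * p - ((1 + X) * u + z))"
      and aux2: "X^2 * (p + (X * p - (N + 1) * z)) = X * ((X + X^2) * p) - (N + 1) * (X^2 * z)"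
      for p u z N :: "real poly" by (simp_all add: algebra_simps power2_eq_square)
    have "F (Suc n) = X * P (Suc n) - (?N + 2) * (X^2 * ?Z)"
      unfolding rec F G aux1 using PUn by simp
    moreover have "G (Suc n) = X * U (Suc n) - (?N + 1) * (X^2 * ?Z)"
      unfolding rec F aux2 ..
    ultimately show ?case unfolding Z by simp
  qed (simp add: init)
  show "genpoly (\<lambda>c. wt c * fluxes c) k = X * genpoly wt k - of_nat (Suc k) * X ^ (2 * k + 1)"
    using FG[of k] by (simp add: F_def P_def)
  have "P k = (\<Sum>j\<le>k. (1 + X) ^ (2 * k - 2 * j) * X ^ (2 * j))"
  proof (induction k)
    case (Suc k)
    have "(1 + X)^2 * (\<Sum>j\<le>k. (1 + X) ^ (2 * k - 2 * j) * X ^ (2 * j)) =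
        (\<Sum>j\<le>k. (1 + X) ^ (2 * Suc k - 2 * j) * X ^ (2 * j))"
      unfolding sum_distrib_left
    proof (intro sum.cong refl)
      fix j assume "j \<in> {..k}"
      then have "2 * Suc k - 2 * j = 2 + (2 * k - 2 * j)" by auto
      then show "(1 + X)^2 * ((1 + X) ^ (2 * k - 2 * j) * X ^ (2 * j)) = (1 + X) ^ (2 * Suc k - 2 * j) * X ^ (2 * j)"
        by (simp only: power_add mult.assoc)
    qed
    then show ?case unfolding Pstep Suc by simp
  qed (simp add: init)
  then show "genpoly wt k = (\<Sum>j\<le>k. (1 + X) ^ (2 * k - 2 * j) * X ^ (2 * j))" by (simp add: P_def)
qed

lemma binom_sum_finite:
  "i \<le> 2 * int k \<Longrightarrow> binom_sum k i = (\<Sum>j\<le>k. binom (2 * int k - 2 * int j) (i - 2 * int j))"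
  unfolding binom_sum_def by (intro suminf_finite) (auto simp: binom_def)

lemma coeff_genpoly_wt: assumes "i \<le> 2 * k" shows "coeff (genpoly wt k) i = binom_sum k (int i)"
proof -
  let ?f = "\<lambda>j. binom (2 * int k - 2 * int j) (int i - 2 * int j)"
  have tm: "coeff ((1 + [:0, 1:]) ^ (2 * k - 2 * j) * [:0, 1:] ^ (2 * j)) i = ?f j" if "j \<le> k" for j
  proof -
    have one: "1 + [:0, 1 :: real:] = [:1, 1:]" by (simp add: one_pCons)
    have X: "[:0, 1 :: real:] ^ (2 * j) = monom 1 (2 * j)" by (simp add: monom_altdef)
    have "coeff ([:1, 1 :: real:] ^ (2 * k - 2 * j) * [:0, 1:] ^ (2 * j)) i =
        (if i < 2 * j then 0 else 1 * coeff ([:1, 1:] ^ (2 * k - 2 * j)) (i - 2 * j))"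
      unfolding X mult.commute[of _ "monom 1 (2 * j)"] by (rule coeff_monom_mult)
    also have "\<dots> = ?f j"
    proof (cases "i < 2 * j")
      case False
      have "\<not> int i - 2 * int j < 0" "nat (int i - 2 * int j) = i - 2 * j" using False by simp_all
      moreover have "real_of_int (2 * int k - 2 * int j) = real (2 * k - 2 * j)" using that by simp
      ultimately have "?f j = real (2 * k - 2 * j) gchoose (i - 2 * j)"
        unfolding binom_def by (simp only: if_False)
      also have "\<dots> = real ((2 * k - 2 * j) choose (i - 2 * j))" by (rule binomial_gbinomial[symmetric])
      also have "\<dots> = coeff ([:1, 1:] ^ (2 * k - 2 * j)) (i - 2 * j)"
      proof (cases "i - 2 * j \<le> 2 * k - 2 * j")
        case True
        show ?thesis using coeff_linear_poly_power[OF True, of "1::real" 1]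
          by (simp only: power_one mult_1_right)
      next
        case False
        then have "degree ([:1, 1 :: real:] ^ (2 * k - 2 * j)) < i - 2 * j"
          using degree_power_le[of "[:1, 1 :: real:]" "2 * k - 2 * j"] by (simp only: degree_pCons_eq_if) simp
        then show ?thesis using False by (simp only: coeff_eq_0 binomial_eq_0 not_le of_nat_0)
      qed
      finally show ?thesis using False by (simp only: if_False mult_1_left)
    qed (simp add: binom_def)
    finally show ?thesis unfolding one .
  qed
  then show ?thesis unfolding genpoly_closed coeff_sum using assms by (simp add: binom_sum_finite)
qed

theorem total_weight:
  "m \<le> 2 * k \<Longrightarrow> (\<Sum>c\<in>mcols k m. wt c) = binom_sum k (2 * int k - int m)"
  using coeff_genpoly[of m k wt] coeff_genpoly_wt[of "2 * k - m" k] by (simp add: of_nat_diff)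

lemma binom_sum_neg: "i < 0 \<Longrightarrow> binom_sum k i = 0"
  by (simp add: binom_sum_def binom_def)

theorem mean_flux:
  assumes "m \<le> 2 * k"
  shows "(\<Sum>a\<in>{1..k}. \<Sum>c\<in>mcols k m. wt c * of_bool (ring_flux (updown_word k) a (unroll c)))
    = binom_sum k (2 * int k - int m - 1)"
proof -
  have "(\<Sum>a\<in>{1..k}. \<Sum>c\<in>mcols k m. wt c * of_bool (ring_flux (updown_word k) a (unroll c))) =
      (\<Sum>j<k. \<Sum>c\<in>mcols k m. wt c * of_bool (ring_flux (updown_word k) (Suc j) (unroll c)))"
    by (rule sum.reindex_bij_witness[of _ Suc "\<lambda>a. a - 1"]) auto
  also have "\<dots> = (\<Sum>j<k. \<Sum>c\<in>mcols k m. wt c * of_bool (col_flux j c))"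
    using unroll_ring(1) by (intro sum.cong) (auto simp: mcols_def cols_def)
  also have "\<dots> = (\<Sum>c\<in>mcols k m. wt c * fluxes c)"
    by (subst sum.swap) (auto simp: fluxes_def sum_distrib_left mcols_def cols_def intro!: sum.cong)
  also have "\<dots> = coeff ([:0, 1:] * genpoly wt k - of_nat (Suc k) * [:0, 1:] ^ (2 * k + 1)) (2 * k - m)"
    unfolding coeff_genpoly[OF assms, symmetric] genpoly_closed(2) ..
  also have "\<dots> = coeff ([:0, 1:] * genpoly wt k) (2 * k - m)"
  proof -
    have "coeff (of_nat (Suc k) * [:0, 1:] ^ (2 * k + 1)) (2 * k - m) = (0 :: real)"
      using coeff_monom_mult[of 1 "2 * k + 1" "of_nat (Suc k) :: real poly" "2 * k - m"]
      by (simp add: monom_altdef mult.commute)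
    then show ?thesis by (simp only: coeff_diff diff_zero)
  qed
  also have "\<dots> = binom_sum k (2 * int k - int m - 1)"
  proof (cases "2 * k - m")
    case 0
    then show ?thesis using assms by (simp add: binom_sum_neg)
  next
    case (Suc i)
    then have "int i = 2 * int k - int m - 1" by linarith
    then show ?thesis using coeff_genpoly_wt[of i k] Suc by simp
  qed
  finally show ?thesis .
qed

section \<open>Averages over words and the Poisson equation\<close>

text \<open>Values in a normed space, because the same averages serve real functionals and complex
  exponentials.\<close>

definition avg :: "'a set \<Rightarrow> ('a \<Rightarrow> 'b::real_normed_vector) \<Rightarrow> 'b" where
  "avg A f = (\<Sum>a\<in>A. f a) /\<^sub>R real (card A)"

definition words :: "'a set \<Rightarrow> nat \<Rightarrow> 'a list set" where
  "words A n = {w. set w \<subseteq> A \<and> length w = n}"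

lemma avg_cong: "(\<And>a. a \<in> A \<Longrightarrow> f a = g a) \<Longrightarrow> avg A f = avg A g"
  by (simp add: avg_def)

lemma avg_add: "avg A (\<lambda>a. f a + g a) = avg A f + avg A g"
  and avg_diff: "avg A (\<lambda>a. f a - g a) = avg A f - avg A g"
  by (simp_all add: avg_def sum.distrib sum_subtractf scaleR_add_right scaleR_diff_right)

lemma avg_cmult: "avg A (\<lambda>a. c * f a) = c * avg A f" for f :: "_ \<Rightarrow> 'b::real_normed_field"
  by (simp add: avg_def sum_distrib_left)

lemma avg_sum: "avg A (\<lambda>a. \<Sum>i\<in>I. f i a) = (\<Sum>i\<in>I. avg A (f i))"
  unfolding avg_def by (subst sum.swap) (simp add: scaleR_sum_right)

lemma avg_const: "finite A \<Longrightarrow> A \<noteq> {} \<Longrightarrow> avg A (\<lambda>a. c) = c"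
  by (simp add: avg_def sum_constant_scaleR)

lemma norm_avg_le:
  assumes "finite A" "A \<noteq> {}" "\<And>a. a \<in> A \<Longrightarrow> norm (f a) \<le> B"
  shows "norm (avg A f) \<le> B"
proof -
  have "norm (\<Sum>a\<in>A. f a) \<le> real (card A) * B"
    using sum_norm_bound[of A f B] assms(3) by auto
  moreover have "real (card A) > 0" using assms by (simp add: card_gt_0_iff)
  ultimately show ?thesis by (simp add: avg_def field_simps)
qed

lemma avg_mono: "(\<And>a. a \<in> A \<Longrightarrow> f a \<le> g a) \<Longrightarrow> avg A f \<le> avg A g" for f :: "_ \<Rightarrow> real"
  by (simp add: avg_def sum_mono mult_left_mono)

lemma avg_bij: "bij_betw h B C \<Longrightarrow> avg C f = avg B (\<lambda>b. f (h b))"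
  unfolding avg_def using sum.reindex_bij_betw[of h B C f] bij_betw_same_card[of h B C] by simp

lemma avg_product: "avg (A \<times> B) (\<lambda>(a, b). f a b) = avg A (\<lambda>a. avg B (f a))"
  unfolding avg_def
  by (simp add: sum.cartesian_product[symmetric] card_cartesian_product scaleR_sum_right)

lemma avg_of_real: "avg A (\<lambda>a. of_real (f a)) = (of_real (avg A f) :: 'b::real_normed_field)"
  by (simp add: avg_def scaleR_conv_of_real)

lemma Re_avg: "Re (avg A f) = avg A (\<lambda>a. Re (f a))"
  by (simp add: avg_def)

lemma finite_words [simp]: "finite A \<Longrightarrow> finite (words A n)"
  unfolding words_def by (rule finite_lists_length_eq)

lemma words_nonempty: "A \<noteq> {} \<Longrightarrow> words A n \<noteq> {}"
proof -
  assume "A \<noteq> {}"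
  then obtain a where "a \<in> A" by blast
  then have "replicate n a \<in> words A n" by (auto simp: words_def)
  then show ?thesis by blast
qed

lemma words_0 [simp]: "words A 0 = {[]}"
  by (auto simp: words_def)

lemma avg_singleton [simp]: "avg {x} f = f x"
  by (simp add: avg_def)

lemma avg_words_add: "avg (words A (m + n)) f = avg (words A m) (\<lambda>u. avg (words A n) (\<lambda>v. f (u @ v)))"
proof -
  have "bij_betw (\<lambda>(u, v). u @ v) (words A m \<times> words A n) (words A (m + n))"
    by (rule bij_betw_byWitness[where f' = "\<lambda>w. (take m w, drop m w)"])
      (auto simp: words_def dest: in_set_takeD in_set_dropD)
  from avg_bij[OF this, of f] show ?thesis
    using avg_product[of "words A m" "words A n" "\<lambda>u v. f (u @ v)"] by (simp add: case_prod_unfold)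
qed

lemma avg_words_1: "avg (words A 1) f = avg A (\<lambda>a. f [a])"
proof -
  have "bij_betw (\<lambda>a. [a]) A (words A 1)"
    by (rule bij_betw_byWitness[where f' = hd]) (auto simp: words_def length_Suc_conv)
  then show ?thesis by (rule avg_bij)
qed

lemma avg_words_snoc: "avg (words A (Suc n)) f = avg (words A n) (\<lambda>u. avg A (\<lambda>a. f (u @ [a])))"
  using avg_words_add[of A n 1 f] by (simp add: avg_words_1[simplified])

lemma avg_words_Cons: "avg (words A (Suc n)) f = avg A (\<lambda>a. avg (words A n) (\<lambda>u. f (a # u)))"
  using avg_words_add[of A 1 n f] by (simp add: avg_words_1[simplified])

section \<open>Chains driven by uniform random letters: contraction and the Poisson equation\<close>

locale chain =
  fixes A :: "'a set" and st :: "'a \<Rightarrow> 's \<Rightarrow> 's" and X :: "'s set" and L :: nat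
  assumes finite_A: "finite A" and A_nonempty: "A \<noteq> {}" and X_nonempty: "X \<noteq> {}"
    and closed: "\<And>a x. a \<in> A \<Longrightarrow> x \<in> X \<Longrightarrow> st a x \<in> X"
    and L_pos: "0 < L"
    and merge: "\<And>x y. x \<in> X \<Longrightarrow> y \<in> X \<Longrightarrow> \<exists>u\<in>words A L. fold st u x = fold st u y"
begin

lemma run_closed: "x \<in> X \<Longrightarrow> set w \<subseteq> A \<Longrightarrow> fold st w x \<in> X"
  by (induction w arbitrary: x) (auto simp: closed)

lemma word_run_closed: "x \<in> X \<Longrightarrow> w \<in> words A n \<Longrightarrow> fold st w x \<in> X"
  by (rule run_closed) (auto simp: words_def)

lemmas fin_words = finite_words[OF finite_A] words_nonempty[OF A_nonempty]
lemmas avg_A_const = avg_const[OF finite_A A_nonempty]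
lemmas avg_words_const = avg_const[OF fin_words]

definition P :: "nat \<Rightarrow> ('s \<Rightarrow> real) \<Rightarrow> 's \<Rightarrow> real" where
  "P n f x = avg (words A n) (\<lambda>w. f (fold st w x))"

abbreviation "mean n \<equiv> avg (words A n)"

lemma P_0 [simp]: "P 0 f x = f x"
  by (simp add: P_def)

lemma P_Suc: "P (Suc n) f x = avg A (\<lambda>a. P n f (st a x))"
  by (simp add: P_def avg_words_Cons)

lemma P_add: "P (m + n) f x = mean m (\<lambda>w. P n f (fold st w x))"
  by (simp add: P_def avg_words_add)

lemma P_bound: "(\<And>x. x \<in> X \<Longrightarrow> \<bar>f x\<bar> \<le> B) \<Longrightarrow> x \<in> X \<Longrightarrow> \<bar>P n f x\<bar> \<le> B"
  unfolding P_def real_norm_def[symmetric]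
  by (rule norm_avg_le[OF fin_words]) (simp add: word_run_closed)

text \<open>The term of the merging word cancels, and each of the remaining ones is at most
  \<open>D\<close>.\<close>

lemma contraction_once:
  assumes D: "\<And>x y. x \<in> X \<Longrightarrow> y \<in> X \<Longrightarrow> \<bar>g x - g y\<bar> \<le> D" and "x \<in> X" "y \<in> X"
  shows "\<bar>mean L (\<lambda>w. g (fold st w x)) - mean L (\<lambda>w. g (fold st w y))\<bar>
    \<le> (1 - 1 / real (card (words A L))) * D"
proof -
  let ?N = "real (card (words A L))"
  let ?h = "\<lambda>w. g (fold st w x) - g (fold st w y)"
  obtain u where u: "u \<in> words A L" "fold st u x = fold st u y" using merge assms by blast
  have N: "?N > 0" "card (words A L) \<ge> 1"
    using fin_words by (auto simp: card_gt_0_iff Suc_le_eq)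
  have "\<bar>\<Sum>w\<in>words A L. ?h w\<bar> = \<bar>\<Sum>w\<in>words A L - {u}. ?h w\<bar>"
    using u by (subst sum.remove[OF fin_words(1) u(1)]) simp
  also have "\<dots> \<le> real (card (words A L - {u})) * D"
  proof -
    have "norm (?h w) \<le> D" if "w \<in> words A L - {u}" for w
      using D[OF word_run_closed[OF assms(2)] word_run_closed[OF assms(3)]] that by auto
    then show ?thesis using sum_norm_bound[of "words A L - {u}" ?h D] by simp
  qed
  also have "\<dots> = (?N - 1) * D"
    using u(1) N(2) by (simp add: card_Diff_singleton of_nat_diff)
  finally have "\<bar>\<Sum>w\<in>words A L. ?h w\<bar> / ?N \<le> (?N - 1) * D / ?N"
    using N by (intro divide_right_mono) auto
  also have "\<dots> = (1 - 1 / ?N) * D" using N by (simp add: field_simps)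
  finally show ?thesis
    unfolding avg_diff[symmetric] unfolding avg_def using N by (simp add: abs_mult divide_inverse mult.commute)
qed

lemma geometric_contraction:
  obtains r C where "0 < r" "r < 1" "0 \<le> C"
    "\<And>f B x y n. (\<And>x. x \<in> X \<Longrightarrow> \<bar>f x\<bar> \<le> B) \<Longrightarrow> x \<in> X \<Longrightarrow> y \<in> X \<Longrightarrow> \<bar>P n f x - P n f y\<bar> \<le> C * B * r ^ n"
proof -
  define N where "N = real (card (words A L))"
  have "0 < card (words A L)" using fin_words[of L] by (simp add: card_gt_0_iff)
  then have N: "N \<ge> 1" by (simp add: N_def)
  \<comment> \<open>The lower bound \<open>1 / 2\<close> keeps \<open>q\<close> positive even if
    there is only one word, so that its real powers behave well.\<close>
  define q where "q = max (1 / 2) (1 - 1 / N)"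
  have q: "0 < q" "q < 1" using N by (auto simp: q_def)
  define r where "r = q powr (1 / real L)"
  have r: "0 < r" "r < 1" using q L_pos powr_less_mono2[of "1 / real L" q 1] by (auto simp: r_def)
  have main: "\<bar>P n f x - P n f y\<bar> \<le> 2 * B * q ^ (n div L)"
    if B: "\<And>x. x \<in> X \<Longrightarrow> \<bar>f x\<bar> \<le> B" and "x \<in> X" "y \<in> X" for f B x y n
    using that(2,3)
  proof (induction n arbitrary: x y rule: less_induct)
    case (less n)
    show ?case
    proof (cases "n < L")
      case True
      have "\<bar>P n f x\<bar> \<le> B" "\<bar>P n f y\<bar> \<le> B" by (rule P_bound[of f], fact B, fact)+
      then have "\<bar>P n f x - P n f y\<bar> \<le> 2 * B" by linarith
      then show ?thesis using True by simp
    next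
      case False
      then have n: "n = L + (n - L)" "n div L = Suc ((n - L) div L)"
        using L_pos by (auto simp: le_div_geq)
      have B0: "0 \<le> B" using B[OF less.prems(1)] by linarith
      have "\<bar>P n f x - P n f y\<bar> \<le> (1 - 1 / N) * (2 * B * q ^ ((n - L) div L))"
        using contraction_once[of "P (n - L) f" "2 * B * q ^ ((n - L) div L)" x y] less False L_pos
          P_add[of L "n - L" f] n(1) by (simp add: N_def)
      also have "\<dots> \<le> q * (2 * B * q ^ ((n - L) div L))"
        using B0 q by (intro mult_right_mono) (auto simp: q_def)
      finally show ?thesis unfolding n(2) by (simp add: mult_ac)
    qed
  qed
  \<comment> \<open>Rounding \<open>n / L\<close> down costs at most one factor
    \<open>1 / q\<close>.\<close>
  have pow: "q ^ (n div L) \<le> (1 / q) * r ^ n" for n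
  proof -
    have "real n / real L < real (n div L) + 1"
    proof -
      have "n < L * (n div L) + L" using L_pos by (metis mult_div_mod_eq mod_less_divisor nat_add_left_cancel_less)
      then have "real n < (real (n div L) + 1) * real L" by (metis (mono_tags) add.commute mult.commute mult_Suc_right of_nat_Suc of_nat_less_iff of_nat_mult)
      then show ?thesis using L_pos by (simp add: field_simps)
    qed
    then have "q powr (real (n div L)) \<le> q powr (real n / real L - 1)"
      using q by (intro powr_mono') auto
    also have "\<dots> = (1 / q) * (q powr (1 / real L)) powr real n"
      using q by (simp add: powr_diff powr_powr)
    finally show ?thesis using q r by (simp add: r_def powr_realpow)
  qed
  have "\<bar>P n f x - P n f y\<bar> \<le> (2 / q) * B * r ^ n"
    if B: "\<And>x. x \<in> X \<Longrightarrow> \<bar>f x\<bar> \<le> B" and "x \<in> X" "y \<in> X" for f B x y n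
  proof -
    have B0: "0 \<le> B" using B[OF that(2)] by linarith
    have "2 * B * q ^ (n div L) \<le> 2 * B * ((1 / q) * r ^ n)"
      using pow B0 by (intro mult_left_mono) auto
    moreover have "\<bar>P n f x - P n f y\<bar> \<le> 2 * B * q ^ (n div L)"
      by (rule main[of f]) (use that in auto)
    ultimately show ?thesis by (simp add: mult_ac)
  qed
  then show ?thesis using that[of r "2 / q"] r q by auto
qed

theorem poisson:
  fixes f :: "'s \<Rightarrow> real"
  assumes B: "\<And>x. x \<in> X \<Longrightarrow> \<bar>f x\<bar> \<le> B"
  obtains c g K where "\<And>x. x \<in> X \<Longrightarrow> \<bar>g x\<bar> \<le> K"
    "\<And>x. x \<in> X \<Longrightarrow> g x - avg A (\<lambda>a. g (st a x)) = f x - c"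
proof -
  obtain r C where r: "0 < r" "r < 1" "0 \<le> C" and contr:
    "\<And>f B x y n. (\<And>x. x \<in> X \<Longrightarrow> \<bar>f x\<bar> \<le> B) \<Longrightarrow> x \<in> X \<Longrightarrow> y \<in> X \<Longrightarrow> \<bar>P n f x - P n f y\<bar> \<le> C * B * r ^ n"
    using geometric_contraction by metis
  have osc: "\<bar>P n f x - P n f y\<bar> \<le> C * B * r ^ n" if "x \<in> X" "y \<in> X" for n x y
    using contr[of f B x y n] B that by blast
  obtain x0 where x0: "x0 \<in> X" using X_nonempty by blast
  have geo: "summable (\<lambda>n. C * B * r ^ n)"
    using r by (intro summable_mult summable_geometric) auto
  have sm: "summable (\<lambda>n. P n f x - P n f x0)" if "x \<in> X" for x
    by (rule summable_comparison_test'[OF geo, of 0]) (use osc that x0 in auto)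
  define g where "g x = (\<Sum>n. P n f x - P n f x0)" for x
  have g_bound: "\<bar>g x\<bar> \<le> (\<Sum>n. C * B * r ^ n)" if "x \<in> X" for x
    unfolding g_def real_norm_def[symmetric]
    by (rule norm_suminf_le[OF _ geo]) (use osc that x0 in auto)
  have avg_g: "(\<lambda>n. P (Suc n) f x - P n f x0) sums avg A (\<lambda>a. g (st a x))" if "x \<in> X" for x
  proof -
    have "(\<lambda>n. \<Sum>a\<in>A. (P n f (st a x) - P n f x0)) sums (\<Sum>a\<in>A. g (st a x))"
      unfolding g_def using sm closed that by (intro sums_sum summable_sums) auto
    then have "(\<lambda>n. (\<Sum>a\<in>A. (P n f (st a x) - P n f x0)) /\<^sub>R real (card A)) sums ((\<Sum>a\<in>A. g (st a x)) /\<^sub>R real (card A))"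
      by (rule sums_scaleR_right)
    then show ?thesis
      unfolding avg_def[symmetric] avg_diff by (simp add: P_Suc avg_A_const)
  qed
  have lim: "(\<lambda>N. P N f x) \<longlonglongrightarrow> f x - (g x - avg A (\<lambda>a. g (st a x)))" if "x \<in> X" for x
  proof -
    have "(\<lambda>n. (P n f x - P n f x0) - (P (Suc n) f x - P n f x0)) sums (g x - avg A (\<lambda>a. g (st a x)))"
      by (intro sums_diff avg_g that) (use sm[OF that] in \<open>auto simp: g_def intro: summable_sums\<close>)
    then have "(\<lambda>N. \<Sum>n<N. P n f x - P (Suc n) f x) \<longlonglongrightarrow> (g x - avg A (\<lambda>a. g (st a x)))"
      by (simp add: sums_def)
    moreover have "(\<Sum>n<N. P n f x - P (Suc n) f x) = f x - P N f x" for N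
      using sum_lessThan_telescope'[of "\<lambda>n. P n f x" N] by simp
    ultimately have "(\<lambda>N. f x - P N f x) \<longlonglongrightarrow> (g x - avg A (\<lambda>a. g (st a x)))"
      by simp
    from tendsto_diff[OF tendsto_const[of "f x"] this] show ?thesis by simp
  qed
  define c where "c = f x0 - (g x0 - avg A (\<lambda>a. g (st a x0)))"
  have "f x - (g x - avg A (\<lambda>a. g (st a x))) = c" if "x \<in> X" for x
  proof -
    have "(\<lambda>n. P n f x - P n f x0) \<longlonglongrightarrow> 0"
      by (rule summable_LIMSEQ_zero[OF sm[OF that]])
    moreover have "(\<lambda>n. P n f x - P n f x0) \<longlonglongrightarrow> (f x - (g x - avg A (\<lambda>a. g (st a x)))) - c"
      unfolding c_def by (intro tendsto_diff lim that x0)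
    ultimately show ?thesis using LIMSEQ_unique by fastforce
  qed
  then have "\<And>x. x \<in> X \<Longrightarrow> g x - avg A (\<lambda>a. g (st a x)) = f x - c" by (simp add: algebra_simps)
  then show ?thesis using that[of g] g_bound by blast
qed

end

section \<open>Additive functionals of the chain\<close>

locale martingale_chain = chain A st X L
  for A :: "'a set" and st :: "'a \<Rightarrow> 's \<Rightarrow> 's" and X L +
  fixes \<xi> :: "'a \<Rightarrow> 's \<Rightarrow> real" and B :: real
  assumes \<xi>_bound: "\<And>a x. a \<in> A \<Longrightarrow> x \<in> X \<Longrightarrow> \<bar>\<xi> a x\<bar> \<le> B"
    and \<xi>_centered: "\<And>x. x \<in> X \<Longrightarrow> avg A (\<lambda>a. \<xi> a x) = 0"
begin

abbreviation "M \<equiv> additive st \<xi>"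

definition q :: "'s \<Rightarrow> real" where "q x = avg A (\<lambda>a. (\<xi> a x)^2)"

lemma B_nonneg: "0 \<le> B"
  using \<xi>_bound A_nonempty X_nonempty by (metis abs_ge_zero all_not_in_conv order_trans)

lemma q_bound: "x \<in> X \<Longrightarrow> \<bar>q x\<bar> \<le> B^2"
  unfolding q_def real_norm_def[symmetric]
  by (rule norm_avg_le[OF finite_A A_nonempty]) (simp, metis \<xi>_bound abs_le_square_iff abs_of_nonneg B_nonneg)

lemma mean_M: "x \<in> X \<Longrightarrow> mean n (M x) = 0"
proof (induction n)
  case (Suc n)
  have "mean (Suc n) (M x) = mean n (\<lambda>w. M x w + avg A (\<lambda>a. \<xi> a (fold st w x)))"
    by (simp add: avg_words_snoc additive_append avg_add avg_A_const)
  also have "\<dots> = mean n (M x)"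
    by (rule avg_cong) (simp add: \<xi>_centered word_run_closed Suc.prems)
  finally show ?case using Suc by simp
qed simp

lemma variance_Suc:
  assumes "x \<in> X"
  shows "mean (Suc n) (\<lambda>w. (M x w)^2) = mean n (\<lambda>w. (M x w)^2) + P n q x"
proof -
  have "mean (Suc n) (\<lambda>w. (M x w)^2) =
      mean n (\<lambda>w. (M x w)^2 + (2 * M x w * avg A (\<lambda>a. \<xi> a (fold st w x)) + q (fold st w x)))"
    by (simp add: avg_words_snoc additive_append power2_sum avg_add avg_A_const avg_cmult q_def add_ac mult_ac)
  also have "\<dots> = mean n (\<lambda>w. (M x w)^2 + q (fold st w x))"
    by (rule avg_cong) (simp add: \<xi>_centered word_run_closed assms)
  finally show ?thesis by (simp add: avg_add P_def)
qed

lemma variance_le: "x \<in> X \<Longrightarrow> mean n (\<lambda>w. (M x w)^2) \<le> real n * B^2"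
proof (induction n)
  case (Suc n)
  have "\<bar>P n q x\<bar> \<le> B^2" by (rule P_bound[of q], rule q_bound, assumption, rule Suc.prems)
  then have "P n q x \<le> B^2" by linarith
  then show ?case using Suc variance_Suc[OF Suc.prems, of n] by (simp add: algebra_simps)
qed simp

lemma variance_poisson:
  assumes "x \<in> X" and p: "\<And>x. x \<in> X \<Longrightarrow> \<psi> x - avg A (\<lambda>a. \<psi> (st a x)) = q x - v"
  shows "mean n (\<lambda>w. (M x w)^2) = v * real n + \<psi> x - P n \<psi> x"
proof (induction n)
  case 0 then show ?case by (simp add: P_def)
next
  case (Suc n)
  have "P (Suc n) \<psi> x = mean n (\<lambda>w. avg A (\<lambda>a. \<psi> (st a (fold st w x))))"
    by (simp add: P_def avg_words_snoc)
  also have "\<dots> = mean n (\<lambda>w. \<psi> (fold st w x) - (q (fold st w x) - v))"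
    by (rule avg_cong) (use p word_run_closed assms(1) in \<open>fastforce simp: algebra_simps\<close>)
  also have "\<dots> = P n \<psi> x - (P n q x - v)"
    by (simp add: avg_diff P_def avg_words_const)
  finally show ?case using Suc variance_Suc[OF assms(1), of n] by (simp add: algebra_simps)
qed

text \<open>Where the bounded solution of the Poisson equation for \<open>q\<close> is nearly minimal, it cannot
  absorb the variance accumulated over a block on which the martingale is not constant.\<close>

lemma variance_pos:
  assumes p: "\<And>x. x \<in> X \<Longrightarrow> \<psi> x - avg A (\<lambda>a. \<psi> (st a x)) = q x - v"
    and bd: "\<And>x. x \<in> X \<Longrightarrow> \<bar>\<psi> x\<bar> \<le> K"
    and u: "u \<in> words A n" "w \<in> words A n" "\<And>x. x \<in> X \<Longrightarrow> 1 \<le> \<bar>M x u - M x w\<bar>"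
  shows "0 < v"
proof -
  define N where "N = real (card (words A n))"
  have N: "N > 0" using fin_words[of n] by (simp add: N_def card_gt_0_iff)
  define I where "I = (INF x\<in>X. \<psi> x)"
  have bdd: "bdd_below (\<psi> ` X)" using bd by (intro bdd_belowI[of _ "- K"]) fastforce
  have I: "I \<le> \<psi> x" if "x \<in> X" for x unfolding I_def by (rule cINF_lower[OF bdd that])
  have "\<exists>x\<in>X. \<psi> x < I + 1 / (4 * N)"
    using cInf_lessD[of "\<psi> ` X" "I + 1 / (4 * N)"] X_nonempty N unfolding I_def by auto
  then obtain x where x: "x \<in> X" "\<psi> x < I + 1 / (4 * N)" by blast
  have PI: "I \<le> P n \<psi> x"
  proof -
    have "mean n (\<lambda>w. I) \<le> P n \<psi> x"
      unfolding P_def by (rule avg_mono) (simp add: I word_run_closed x)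
    then show ?thesis by (simp add: avg_words_const)
  qed
  have "1 \<le> (M x u - M x w)^2" using u(3)[OF x(1)] by (simp add: abs_le_square_iff[of 1, simplified])
  also have "\<dots> \<le> 2 * ((M x u)^2 + (M x w)^2)"
    using zero_le_power2[of "M x u + M x w"] by (simp add: power2_sum power2_diff)
  finally have "1 / 2 \<le> (M x u)^2 + (M x w)^2" by simp
  also have "\<dots> = (\<Sum>w'\<in>{u, w}. (M x w')^2)"
    using u(3)[OF x(1)] by (cases "u = w") auto
  also have "\<dots> \<le> (\<Sum>w'\<in>words A n. (M x w')^2)"
    using u by (intro sum_mono2 fin_words) auto
  finally have "1 / (2 * N) \<le> mean n (\<lambda>w. (M x w)^2)"
    using N by (simp add: avg_def N_def[symmetric] field_simps)
  then have *: "1 / (2 * N) \<le> v * real n + \<psi> x - P n \<psi> x"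
    using variance_poisson[of x \<psi> v n] x(1) p by simp
  have "1 / (4 * N) < 1 / (2 * N)" using N by (simp add: field_simps)
  then have "0 < v * real n" using * x(2) PI by linarith
  then show ?thesis by (simp add: zero_less_mult_iff)
qed

subsection \<open>The characteristic function\<close>

lemma corrector_bound:
  assumes "\<bar>a\<bar> \<le> K" "\<bar>b\<bar> \<le> K" "\<bar>l\<bar> \<le> 1"
  shows "norm (of_real (l^2 * a) + \<i> * of_real (l^3 * b) :: complex) \<le> 2 * K * l^2"
proof -
  have "norm (of_real (l^2 * a) + \<i> * of_real (l^3 * b) :: complex)
      \<le> norm (of_real (l^2 * a) :: complex) + norm (of_real (l^3 * b) :: complex)"
    by (metis norm_triangle_ineq norm_mult norm_ii mult_1_left)
  also have "\<dots> = l^2 * \<bar>a\<bar> + l^2 * (\<bar>l\<bar> * \<bar>b\<bar>)"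
    unfolding norm_of_real by (simp add: abs_mult power_abs power3_eq_cube power2_eq_square)
  also have "\<dots> \<le> l^2 * K + l^2 * (1 * K)"
    using assms by (intro add_mono mult_left_mono mult_mono) auto
  finally show ?thesis by (simp add: algebra_simps)
qed

text \<open>After a third-order expansion of \<open>cis\<close>, the exponential collects the
  constant parts, while \<open>h2\<close> and \<open>h3\<close> absorb the dependence on the state
  in orders \<open>l^2\<close> and \<open>l^3\<close>. The product of \<open>\<xi>\<close> with
  \<open>h2\<close> is itself of third order and therefore enters the equation for
  \<open>h3\<close>.\<close>

lemma char_step:
  fixes h2 h3 :: "'s \<Rightarrow> real"
  assumes p2: "\<And>x. x \<in> X \<Longrightarrow> h2 x - avg A (\<lambda>a. h2 (st a x)) = - (q x - v) / 2"
    and p3: "\<And>x. x \<in> X \<Longrightarrow> h3 x - avg A (\<lambda>a. h3 (st a x)) =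
        avg A (\<lambda>a. \<xi> a x * h2 (st a x) - (\<xi> a x)^3 / 6) - \<kappa>"
    and bd: "\<And>x. x \<in> X \<Longrightarrow> \<bar>h2 x\<bar> \<le> K" "\<And>x. x \<in> X \<Longrightarrow> \<bar>h3 x\<bar> \<le> K"
  shows "\<exists>C. \<forall>x\<in>X. \<forall>l. \<bar>l\<bar> \<le> 1 \<longrightarrow>
    norm (avg A (\<lambda>a. cis (l * \<xi> a x) * (1 + of_real (l^2 * h2 (st a x)) + \<i> * of_real (l^3 * h3 (st a x))))
      - exp (of_real (- (v * l^2 / 2)) + \<i> * of_real (\<kappa> * l^3))
        * (1 + of_real (l^2 * h2 x) + \<i> * of_real (l^3 * h3 x))) \<le> C * l^4"
proof -
  define H :: "real \<Rightarrow> 's \<Rightarrow> complex" where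
    "H l x = 1 + of_real (l^2 * h2 x) + \<i> * of_real (l^3 * h3 x)" for l x
  define z :: "real \<Rightarrow> complex" where
    "z l = of_real (- (v * l^2 / 2)) + \<i> * of_real (\<kappa> * l^3)" for l
  define cor :: "real \<Rightarrow> real \<Rightarrow> real \<Rightarrow> complex" where "cor l a b = of_real (l^2 * a) + \<i> * of_real (l^3 * b)" for l a b
  \<comment> \<open>The terms of order at least four in the product of the cubic Taylor polynomial
    of \<open>cis\<close> with the corrected factor \<open>H\<close>.\<close>
  define R where "R l t a b = cor l (- (t^2) / 2) (- (t^3) / 6) * cor l a b - of_real (l^4 * (t * b))" for l t a b
  obtain x0 where x0: "x0 \<in> X" using X_nonempty by blast
  have K0: "0 \<le> K" using bd(1)[OF x0] by linarith
  have B0: "0 \<le> B" by (rule B_nonneg)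
  have H_bound: "norm (H l x) \<le> 1 + 2 * K" if "x \<in> X" "\<bar>l\<bar> \<le> 1" for l x
  proof -
    have "H l x = 1 + (of_real (l^2 * h2 x) + \<i> * of_real (l^3 * h3 x))" by (simp add: H_def)
    then have "norm (H l x) \<le> 1 + 2 * K * l^2"
      using corrector_bound[OF bd(1)[OF that(1)] bd(2)[OF that(1)] that(2)]
      by (metis add_left_mono norm_one norm_triangle_ineq order_trans)
    also have "\<dots> \<le> 1 + 2 * K * 1"
      using that(2) K0 by (intro add_mono mult_left_mono) (auto simp: abs_square_le_1)
    finally show ?thesis by simp
  qed
  define CR where "CR = 2 * (B^2 + B^3) * (2 * K) + B * K"
  have R_bound: "norm (R l t a b) \<le> l^4 * CR" if "\<bar>l\<bar> \<le> 1" "\<bar>t\<bar> \<le> B" "\<bar>a\<bar> \<le> K" "\<bar>b\<bar> \<le> K" for l t a b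
  proof -
    have "\<bar>t\<bar>^2 \<le> B^2" "\<bar>t\<bar>^3 \<le> B^3" by (rule power_mono[OF that(2) abs_ge_zero])+
    moreover have "0 \<le> B^2" "0 \<le> B^3" using B0 by simp_all
    ultimately have t: "\<bar>t\<bar>^2 \<le> B^2" "\<bar>t\<bar>^3 \<le> B^3" "0 \<le> B^2" "0 \<le> B^3" by blast+
    have "\<bar>- (t^2) / 2\<bar> \<le> B^2 + B^3" "\<bar>- (t^3) / 6\<bar> \<le> B^2 + B^3"
    proof -
      have "\<bar>- (t^2) / 2\<bar> = \<bar>t\<bar>^2 / 2" "\<bar>- (t^3) / 6\<bar> = \<bar>t\<bar>^3 / 6" by (simp_all add: power_abs)
      then show "\<bar>- (t^2) / 2\<bar> \<le> B^2 + B^3" "\<bar>- (t^3) / 6\<bar> \<le> B^2 + B^3" using t zero_le_power[of "\<bar>t\<bar>"] by linarith+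
    qed
    from corrector_bound[OF this that(1)] corrector_bound[OF that(3,4,1)]
    have "norm (cor l (- (t^2) / 2) (- (t^3) / 6) * cor l a b) \<le> (2 * (B^2 + B^3) * l^2) * (2 * K * l^2)"
      unfolding norm_mult cor_def[symmetric] using t by (intro mult_mono) auto
    moreover have "norm (of_real (l^4 * (t * b)) :: complex) \<le> l^4 * (B * K)"
      unfolding norm_of_real abs_mult using that B0 by (simp add: mult_left_mono mult_mono)
    ultimately have "norm (R l t a b) \<le> (2 * (B^2 + B^3) * l^2) * (2 * K * l^2) + l^4 * (B * K)"
      unfolding R_def by (intro order_trans[OF norm_triangle_ineq4] add_mono)
    also have "\<dots> = l^4 * CR" by (simp add: CR_def algebra_simps power4_eq_xxxx power2_eq_square)
    finally show ?thesis .
  qed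
  define cz where "cz = \<bar>v\<bar> + \<bar>\<kappa>\<bar>"
  have z_bound: "norm (z l) \<le> cz * l^2" if "\<bar>l\<bar> \<le> 1" for l
  proof -
    have "z l = of_real (- v * l^2 / 2) + \<i> * of_real (\<kappa> * l^3)" by (simp add: z_def)
    then have "norm (z l) \<le> norm (of_real (- v * l^2 / 2) :: complex) + norm (of_real (\<kappa> * l^3) :: complex)"
      by (metis norm_triangle_ineq norm_mult norm_ii mult_1_left)
    also have "\<dots> = \<bar>v\<bar> * l^2 / 2 + \<bar>\<kappa>\<bar> * (\<bar>l\<bar> * l^2)"
      unfolding norm_of_real by (simp add: abs_mult power_abs power3_eq_cube power2_eq_square)
    also have "\<dots> \<le> \<bar>v\<bar> * l^2 + \<bar>\<kappa>\<bar> * (1 * l^2)"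
      using that by (intro add_mono mult_left_mono mult_right_mono) auto
    finally show ?thesis by (simp add: cz_def distrib_right)
  qed
  define Ce where "Ce = exp cz * cz^2"
  have e_bound: "norm (exp (z l) - 1 - z l) \<le> Ce * l^4" if "\<bar>l\<bar> \<le> 1" for l
  proof -
    have l1: "l^2 \<le> 1" using that by (metis abs_le_square_iff abs_one one_power2)
    have nz: "norm (z l) \<le> cz" using z_bound[OF that] l1 mult_left_le[of "l^2" cz] by (simp add: cz_def)
    have "norm (exp (z l) - (\<Sum>k\<le>1. z l ^ k / fact k)) \<le> exp \<bar>Re (z l)\<bar> * norm (z l) ^ Suc 1 / fact 1"
      by (rule Taylor_exp)
    then have "norm (exp (z l) - 1 - z l) \<le> exp \<bar>Re (z l)\<bar> * norm (z l)^2"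
      by (simp add: power2_eq_square algebra_simps)
    also have "\<dots> \<le> exp cz * (cz * l^2)^2"
      using nz abs_Re_le_cmod[of "z l"] z_bound[OF that]
      by (intro mult_mono power_mono) auto
    finally show ?thesis by (simp add: Ce_def power_mult_distrib mult_ac power4_eq_xxxx power2_eq_square)
  qed
  define C where "C = B^4 * (1 + 2 * K) + CR + cz * (2 * K) + Ce * (1 + 2 * K)"
  have "norm (avg A (\<lambda>a. cis (l * \<xi> a x) * H l (st a x)) - exp (z l) * H l x) \<le> C * l^4"
    if x: "x \<in> X" and l: "\<bar>l\<bar> \<le> 1" for x l
  proof -
    let ?R = "avg A (\<lambda>a. R l (\<xi> a x) (h2 (st a x)) (h3 (st a x)))"
    define T :: "'a \<Rightarrow> complex" where "T a = (\<Sum>k\<le>3. (\<i> * of_real (l * \<xi> a x))^k / fact k)" for a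
    define \<rho> where "\<rho> a = cis (l * \<xi> a x) - T a" for a
    have \<rho>: "norm (\<rho> a) \<le> B^4 * l^4" if "a \<in> A" for a
    proof -
      have "norm (\<rho> a) \<le> \<bar>l * \<xi> a x\<bar> ^ 4 / fact (Suc 3)"
        using iexp_approx1[of "l * \<xi> a x" 3] by (simp add: \<rho>_def T_def cis_conv_exp)
      also have "\<dots> \<le> \<bar>l * \<xi> a x\<bar> ^ 4 / 1" by (intro frac_le) (auto simp: fact_ge_1)
      also have "\<dots> = \<bar>l * \<xi> a x\<bar> ^ 4" by simp
      also have "\<dots> \<le> (\<bar>l\<bar> * B) ^ 4"
        unfolding abs_mult using \<xi>_bound[OF that x] by (intro power_mono mult_left_mono) auto
      finally show ?thesis by (simp add: power_mult_distrib mult.commute)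
    qed
    have T: "T a = 1 + \<i> * l * \<xi> a x - l^2 * (\<xi> a x)^2 / 2 - \<i> * l^3 * (\<xi> a x)^3 / 6" for a
    proof -
      have "{..3::nat} = {0, 1, 2, 3}" by auto
      then show ?thesis
        by (simp add: T_def fact_numeral power_mult_distrib power3_eq_cube power2_eq_square field_simps)
    qed
    have TH: "T a * H l (st a x) = of_real 1 + \<i> * of_real (l * \<xi> a x)
        + of_real (l^2) * of_real (h2 (st a x) - (\<xi> a x)^2 / 2)
        + \<i> * of_real (l^3) * of_real (h3 (st a x) + (\<xi> a x * h2 (st a x) - (\<xi> a x)^3 / 6))
        + R l (\<xi> a x) (h2 (st a x)) (h3 (st a x))" for a
    proof -
      have i2: "\<i> * (\<i> * y) = - y" for y by (simp flip: mult.assoc)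
      show ?thesis unfolding T H_def R_def cor_def
        by (simp add: field_simps power2_eq_square power3_eq_cube power4_eq_xxxx i2)
    qed
    have "avg A (\<lambda>a. cis (l * \<xi> a x) * H l (st a x)) = avg A (\<lambda>a. T a * H l (st a x) + \<rho> a * H l (st a x))"
      by (rule avg_cong) (simp add: \<rho>_def algebra_simps)
    also have "\<dots> = (1 + \<i> * of_real (l * avg A (\<lambda>a. \<xi> a x))
        + of_real (l^2) * of_real (avg A (\<lambda>a. h2 (st a x)) - q x / 2)
        + \<i> * of_real (l^3) * of_real (avg A (\<lambda>a. h3 (st a x)) + avg A (\<lambda>a. \<xi> a x * h2 (st a x) - (\<xi> a x)^3 / 6)))
        + ?R + avg A (\<lambda>a. \<rho> a * H l (st a x))"
    proof -
      have q': "avg A (\<lambda>a. (\<xi> a x)^2 / 2) = q x / 2"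
        using avg_cmult[of A "1/2" "\<lambda>a. (\<xi> a x)^2"] by (simp add: q_def)
      show ?thesis unfolding TH avg_add avg_cmult avg_of_real avg_const[OF finite_A A_nonempty] avg_diff q'
        by (simp add: avg_of_real)
    qed
    also have "\<dots> = (1 + z l + (of_real (l^2 * h2 x) + \<i> * of_real (l^3 * h3 x)))
        + ?R + avg A (\<lambda>a. \<rho> a * H l (st a x))"
    proof -
      have "avg A (\<lambda>a. h2 (st a x)) - q x / 2 = h2 x - v / 2" using p2[OF x] by (simp add: field_simps)
      moreover have "avg A (\<lambda>a. h3 (st a x)) + avg A (\<lambda>a. \<xi> a x * h2 (st a x) - (\<xi> a x)^3 / 6) = h3 x + \<kappa>"
        using p3[OF x] by simp
      ultimately show ?thesis by (simp only: \<xi>_centered[OF x]) (simp add: z_def algebra_simps)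
    qed
    finally have eq: "avg A (\<lambda>a. cis (l * \<xi> a x) * H l (st a x)) - exp (z l) * H l x =
        avg A (\<lambda>a. \<rho> a * H l (st a x)) + ?R
        - z l * (H l x - 1) - (exp (z l) - 1 - z l) * H l x"
      by (simp add: H_def algebra_simps)
    have n1: "norm (avg A (\<lambda>a. \<rho> a * H l (st a x))) \<le> B^4 * l^4 * (1 + 2 * K)"
      using \<rho> H_bound[OF closed[OF _ x] l] K0
      by (intro norm_avg_le[OF finite_A A_nonempty]) (auto simp: norm_mult intro!: mult_mono)
    have n2: "norm ?R \<le> l^4 * CR"
      using R_bound[OF l \<xi>_bound[OF _ x] bd(1)[OF closed[OF _ x]] bd(2)[OF closed[OF _ x]]]
      by (intro norm_avg_le[OF finite_A A_nonempty]) auto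
    have H1: "norm (H l x - 1) \<le> l^2 * (2 * K)"
      using corrector_bound[OF bd(1)[OF x] bd(2)[OF x] l] by (simp add: H_def mult_ac)
    have n3: "norm (z l * (H l x - 1)) \<le> cz * l^2 * (l^2 * (2 * K))"
      unfolding norm_mult using z_bound[OF l] H1 by (intro mult_mono) (auto simp: cz_def)
    have n4: "norm ((exp (z l) - 1 - z l) * H l x) \<le> Ce * l^4 * (1 + 2 * K)"
      unfolding norm_mult using e_bound[OF l] H_bound[OF x l]
      by (intro mult_mono) (auto simp: Ce_def)
    have "norm (avg A (\<lambda>a. cis (l * \<xi> a x) * H l (st a x)) - exp (z l) * H l x) \<le>
        B^4 * l^4 * (1 + 2 * K) + l^4 * CR + cz * l^2 * (l^2 * (2 * K)) + Ce * l^4 * (1 + 2 * K)"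
      unfolding eq using n1 n2 n3 n4
      by (intro order_trans[OF norm_triangle_ineq4] add_mono order_trans[OF norm_triangle_ineq])
    also have "\<dots> = C * l^4" by (simp add: C_def algebra_simps power4_eq_xxxx power2_eq_square)
    finally show ?thesis .
  qed
  then show ?thesis unfolding H_def z_def by (intro exI[of _ C] ballI allI impI)
qed

end

lemma one_minus_cos_le: "\<bar>1 - cos t\<bar> \<le> t^2 / 2" for t :: real
proof -
  have "cos t = 1 - 2 * (sin (t / 2))^2" using cos_double_sin[of "t / 2"] by simp
  moreover have "(sin (t / 2))^2 \<le> (t / 2)^2"
    using abs_sin_x_le_abs_x[of "t / 2"] unfolding abs_le_square_iff .
  ultimately show ?thesis by (simp add: power_divide)
qed

context martingale_chain
begin

text \<open>The errors of order \<open>l^4\<close> are damped in every step by \<open>th l\<close>,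
  of norm at most \<open>1 / (1 + y)\<close> with \<open>y\<close> proportional to
  \<open>l^2\<close>, so they sum to order \<open>l^2\<close> uniformly in \<open>n\<close>.\<close>

lemma char_gauss:
  assumes x: "x \<in> X" and v: "0 < v"
    and p: "\<And>x. x \<in> X \<Longrightarrow> \<psi> x - avg A (\<lambda>a. \<psi> (st a x)) = q x - v"
    and bd: "\<And>x. x \<in> X \<Longrightarrow> \<bar>\<psi> x\<bar> \<le> K0"
  shows "\<exists>C\<ge>0. \<forall>n l. \<bar>l\<bar> \<le> 1 \<longrightarrow>
    \<bar>mean n (\<lambda>w. cos (l * M x w)) - exp (- (real n * v * l^2 / 2))\<bar> \<le> C * l^2"
proof -
  define h2 where "h2 y = - \<psi> y / 2" for y
  define f3 where "f3 y = avg A (\<lambda>a. \<xi> a y * h2 (st a y) - (\<xi> a y)^3 / 6)" for y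
  have K00: "0 \<le> K0" using bd[OF x] by linarith
  have h2: "h2 y - avg A (\<lambda>a. h2 (st a y)) = - (q y - v) / 2" if "y \<in> X" for y
    using p[OF that] avg_cmult[of A "-1/2" "\<lambda>a. \<psi> (st a y)"] unfolding h2_def by (simp add: field_simps)
  have f3_bound: "\<bar>f3 y\<bar> \<le> B * K0 + B^3" if "y \<in> X" for y
    unfolding f3_def real_norm_def[symmetric]
  proof (rule norm_avg_le[OF finite_A A_nonempty])
    fix a assume a: "a \<in> A"
    have 1: "\<bar>\<xi> a y\<bar> \<le> B" "\<bar>h2 (st a y)\<bar> \<le> K0"
      using \<xi>_bound[OF a that] bd[OF closed[OF a that]] K00 by (auto simp: h2_def)
    have "\<bar>\<xi> a y * h2 (st a y)\<bar> \<le> B * K0" unfolding abs_mult using 1 B_nonneg by (intro mult_mono) auto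
    moreover have "\<bar>\<xi> a y\<bar>^3 \<le> B^3" using 1 by (intro power_mono) auto
    then have "\<bar>(\<xi> a y)^3 / 6\<bar> \<le> B^3" using B_nonneg by (simp add: power_abs[symmetric] field_simps)
    ultimately show "norm (\<xi> a y * h2 (st a y) - (\<xi> a y)^3 / 6) \<le> B * K0 + B^3"
      unfolding real_norm_def by linarith
  qed
  obtain \<kappa> h3 K3 where bd3: "\<And>y. y \<in> X \<Longrightarrow> \<bar>h3 y\<bar> \<le> K3"
    and h3: "\<And>y. y \<in> X \<Longrightarrow> h3 y - avg A (\<lambda>a. h3 (st a y)) = f3 y - \<kappa>"
    by (rule poisson[of f3 "B * K0 + B^3"]) (rule f3_bound, assumption, rule that)
  define K where "K = max K0 K3"
  have bdK: "\<And>y. y \<in> X \<Longrightarrow> \<bar>h2 y\<bar> \<le> K" "\<And>y. y \<in> X \<Longrightarrow> \<bar>h3 y\<bar> \<le> K"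
  proof -
    fix y assume "y \<in> X"
    from bd[OF this] bd3[OF this] show "\<bar>h2 y\<bar> \<le> K" "\<bar>h3 y\<bar> \<le> K"
      using K00 unfolding K_def h2_def by auto
  qed
  have K: "0 \<le> K" using bdK(1)[OF x] by linarith
  define H :: "real \<Rightarrow> 's \<Rightarrow> complex" where
    "H l y = 1 + of_real (l^2 * h2 y) + \<i> * of_real (l^3 * h3 y)" for l y
  define th :: "real \<Rightarrow> complex" where
    "th l = exp (of_real (- (v * l^2 / 2)) + \<i> * of_real (\<kappa> * l^3))" for l
  obtain C0 where "\<forall>y\<in>X. \<forall>l. \<bar>l\<bar> \<le> 1 \<longrightarrow>
      norm (avg A (\<lambda>a. cis (l * \<xi> a y) * H l (st a y)) - th l * H l y) \<le> C0 * l^4"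
    using char_step[OF h2 h3[unfolded f3_def] bdK] unfolding H_def th_def by blast
  then have step: "norm (avg A (\<lambda>a. cis (l * \<xi> a y) * H l (st a y)) - th l * H l y) \<le> \<bar>C0\<bar> * l^4"
    if "y \<in> X" "\<bar>l\<bar> \<le> 1" for y l
    using that by (meson abs_ge_self mult_right_mono order_trans zero_le_even_power' even_numeral zero_le_even_power)
  have H1: "norm (H l y - 1) \<le> 2 * K * l^2" if "y \<in> X" "\<bar>l\<bar> \<le> 1" for l y
    using corrector_bound[OF bdK(1)[OF that(1)] bdK(2)[OF that(1)] that(2)] by (simp add: H_def)
  have norm_th: "norm (th l) = exp (- (v * l^2 / 2))" for l
    unfolding th_def norm_exp_eq_Re by (simp add: power2_eq_square power3_eq_cube)
  define C1 where "C1 = \<bar>C0\<bar> * (1 + v / 2) * (2 / v)"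
  define C where "C = C1 + 4 * K + 4 * \<kappa>^2 / v^2"
  have main: "\<bar>mean n (\<lambda>w. cos (l * M x w)) - exp (- (real n * v * l^2 / 2))\<bar> \<le> C * l^2"
    if l: "\<bar>l\<bar> \<le> 1" "l \<noteq> 0" for n l
  proof -
    define y where "y = v * l^2 / 2"
    have y: "0 < y" using v l by (simp add: y_def)
    have l2: "l^2 \<le> 1" using l by (metis abs_le_square_iff abs_one one_power2)
    define \<Psi> where "\<Psi> n = mean n (\<lambda>w. cis (l * M x w) * H l (fold st w x))" for n
    have \<Psi>_step: "norm (\<Psi> (Suc n) - th l * \<Psi> n) \<le> \<bar>C0\<bar> * l^4" for n
    proof -
      have "\<Psi> (Suc n) - th l * \<Psi> n = mean n (\<lambda>w. cis (l * M x w) *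
          (avg A (\<lambda>a. cis (l * \<xi> a (fold st w x)) * H l (st a (fold st w x))) - th l * H l (fold st w x)))"
        unfolding \<Psi>_def avg_words_snoc right_diff_distrib avg_diff avg_cmult[symmetric]
        by (simp add: additive_append distrib_left cis_mult[symmetric] mult_ac)
      also have "norm \<dots> \<le> \<bar>C0\<bar> * l^4"
        by (rule norm_avg_le[OF fin_words]) (simp add: norm_mult step word_run_closed x l)
      finally show ?thesis .
    qed
    \<comment> \<open>The bound is the fixed point of
      \<open>r = \<bar>C0\<bar> * l^4 + r / (1 + y)\<close>.\<close>
    have err: "norm (\<Psi> n - th l ^ n * \<Psi> 0) \<le> \<bar>C0\<bar> * l^4 * ((1 + y) / y)" for n
    proof (induction n)
      case 0 then show ?case using y by simp
    next
      case (Suc n)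
      have "norm (\<Psi> (Suc n) - th l ^ Suc n * \<Psi> 0) =
          norm ((\<Psi> (Suc n) - th l * \<Psi> n) + th l * (\<Psi> n - th l ^ n * \<Psi> 0))"
        by (simp add: algebra_simps)
      also have "\<dots> \<le> \<bar>C0\<bar> * l^4 + norm (th l) * norm (\<Psi> n - th l ^ n * \<Psi> 0)"
        by (rule order_trans[OF norm_triangle_ineq]) (simp add: \<Psi>_step norm_mult)
      also have "\<dots> \<le> \<bar>C0\<bar> * l^4 + (1 / (1 + y)) * (\<bar>C0\<bar> * l^4 * ((1 + y) / y))"
      proof (intro add_left_mono mult_mono Suc)
        have "exp (- y) \<le> 1 / (1 + y)"
          using exp_ge_add_one_self[of y] y by (simp add: exp_minus field_simps)
        then show "norm (th l) \<le> 1 / (1 + y)" unfolding norm_th y_def .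
      qed (use y in auto)
      also have "\<dots> = \<bar>C0\<bar> * l^4 * ((1 + y) / y)"
      proof -
        have "y + y * y \<noteq> 0" using y by (simp add: add_pos_pos less_imp_neq[symmetric])
        then show ?thesis using y by (simp add: field_simps)
      qed
      finally show ?case .
    qed
    have "\<bar>C0\<bar> * l^4 * ((1 + y) / y) = \<bar>C0\<bar> * (1 + y) * (2 / v) * l^2"
      using v l by (simp add: y_def field_simps power4_eq_xxxx power2_eq_square)
    also have "\<dots> \<le> C1 * l^2"
      unfolding C1_def using v l2 by (intro mult_right_mono mult_left_mono) (auto simp: y_def)
    finally have e1: "norm (\<Psi> n - th l ^ n * H l x) \<le> C1 * l^2"
      using err[of n] by (simp add: \<Psi>_def)
    let ?c = "mean n (\<lambda>w. cis (l * M x w))"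
    have e2: "norm (\<Psi> n - ?c) \<le> 2 * K * l^2"
    proof -
      have "\<Psi> n - ?c = mean n (\<lambda>w. cis (l * M x w) * (H l (fold st w x) - 1))"
        unfolding \<Psi>_def by (simp add: right_diff_distrib avg_diff)
      also have "norm \<dots> \<le> 2 * K * l^2"
        by (rule norm_avg_le[OF fin_words]) (simp add: norm_mult H1 word_run_closed x l)
      finally show ?thesis .
    qed
    have "norm (th l) \<le> 1" unfolding norm_th using v by simp
    then have "norm (th l ^ n) * norm (H l x - 1) \<le> 1 * (2 * K * l^2)"
      using H1[OF x l(1)] by (intro mult_mono) (auto simp: norm_power power_le_one)
    then have e3: "norm (th l ^ n * H l x - th l ^ n) \<le> 2 * K * l^2"
      by (simp add: norm_mult[symmetric] algebra_simps)
    have "norm (?c - th l ^ n) \<le> (C1 + 4 * K) * l^2"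
    proof -
      have "?c - th l ^ n =
         - (\<Psi> n - ?c) + (\<Psi> n - th l ^ n * H l x) + (th l ^ n * H l x - th l ^ n)" by simp
      then have "norm (?c - th l ^ n) \<le> 2 * K * l^2 + C1 * l^2 + 2 * K * l^2"
        using e1 e2 e3 by (smt (verit) norm_triangle_ineq norm_minus_cancel)
      then show ?thesis by (simp add: algebra_simps)
    qed
    then have r1: "\<bar>mean n (\<lambda>w. cos (l * M x w)) - Re (th l ^ n)\<bar> \<le> (C1 + 4 * K) * l^2"
      using abs_Re_le_cmod[of "?c - th l ^ n"] by (simp add: Re_avg)
    \<comment> \<open>The cubic phase after \<open>n\<close> steps. In the real part it enters
      quadratically, and \<open>t^2\<close> is a constant times \<open>(n * y)^2 * l^2\<close>,
      which the Gaussian factor bounds by order \<open>l^2\<close>. A bound linear in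
      \<open>t\<close> would give order \<open>\<bar>l\<bar>\<close> only, which is not integrable
      after division by \<open>l^2\<close>.\<close>
    define t where "t = real n * (\<kappa> * l^3)"
    have "th l ^ n = exp (of_nat n * (of_real (- (v * l^2 / 2)) + \<i> * of_real (\<kappa> * l^3)))"
      by (simp only: th_def exp_of_nat_mult)
    then have Reth: "Re (th l ^ n) = exp (- (real n * y)) * cos t"
      by (simp add: Re_exp y_def t_def power2_eq_square power3_eq_cube)
    have "\<bar>cos t - 1\<bar> \<le> t^2 / 2" using one_minus_cos_le[of t] by (simp add: abs_minus_commute)
    then have "exp (- (real n * y)) * \<bar>cos t - 1\<bar> \<le> exp (- (real n * y)) * (t^2 / 2)"
      by (intro mult_left_mono) auto
    moreover have "Re (th l ^ n) - exp (- (real n * y)) = exp (- (real n * y)) * (cos t - 1)"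
      unfolding Reth by (simp only: right_diff_distrib mult_1_right)
    ultimately have "\<bar>Re (th l ^ n) - exp (- (real n * y))\<bar> \<le> exp (- (real n * y)) * (t^2 / 2)"
      by (simp only: abs_mult abs_exp_cancel)
    also have "\<dots> = (exp (- (real n * y)) * (real n * y)^2) * (2 * \<kappa>^2 / v^2 * l^2)"
      using v l by (simp add: t_def y_def field_simps power2_eq_square power3_eq_cube)
    also have "\<dots> \<le> 2 * (2 * \<kappa>^2 / v^2 * l^2)"
    proof (rule mult_right_mono)
      have "0 \<le> real n * y" using y by simp
      then have "(real n * y)^2 / 2 \<le> exp (real n * y)"
        using exp_lower_Taylor_quadratic[of "real n * y"] by linarith
      then show "exp (- (real n * y)) * (real n * y)^2 \<le> 2"
        by (simp add: exp_minus field_simps)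
    qed simp
    finally have "\<bar>Re (th l ^ n) - exp (- (real n * y))\<bar> \<le> 4 * \<kappa>^2 / v^2 * l^2" by simp
    then have "\<bar>mean n (\<lambda>w. cos (l * M x w)) - exp (- (real n * y))\<bar> \<le> (C1 + 4 * K) * l^2 + 4 * \<kappa>^2 / v^2 * l^2"
      using r1 by linarith
    then show ?thesis by (simp add: C_def y_def algebra_simps)
  qed
  have "0 \<le> C" unfolding C_def C1_def using K v by simp
  moreover have "\<bar>mean n (\<lambda>w. cos (l * M x w)) - exp (- (real n * v * l^2 / 2))\<bar> \<le> C * l^2"
    if "\<bar>l\<bar> \<le> 1" for n l
  proof (cases "l = 0")
    case True
    then show ?thesis by (simp add: avg_words_const)
  qed (use main that in blast)
  ultimately show ?thesis by blast
qed

end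

subsection \<open>From characteristic functions to absolute moments\<close>

lemma integrable_cauchy: "integrable lborel (\<lambda>x::real. C / (1 + x^2))"
proof -
  have "set_integrable lborel (einterval (-\<infinity>) \<infinity>) (\<lambda>x::real. inverse (1 + x^2))"
    by (rule integrable_inverse_1_plus_square)
  then have "integrable lborel (\<lambda>x::real. inverse (1 + x^2))" by (simp add: set_integrable_def)
  then show ?thesis using integrable_mult_right[of C lborel "\<lambda>x::real. inverse (1 + x^2)"]
    by (simp add: divide_inverse)
qed

text \<open>The value at \<open>0\<close> is \<open>f 0 / 0 = 0\<close>; it does not matter for the integral.\<close>

lemma quotient_bound:
  fixes f x a b :: real
  assumes "\<bar>x\<bar> \<le> 1 \<Longrightarrow> \<bar>f\<bar> \<le> a * x^2" "\<bar>f\<bar> \<le> b" "0 \<le> a" "0 \<le> b"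
  shows "\<bar>f / x^2\<bar> \<le> (2 * a + 2 * b) / (1 + x^2)"
proof (cases "\<bar>x\<bar> \<le> 1")
  case True
  have "\<bar>f / x^2\<bar> \<le> a"
    using assms(1)[OF True] assms(3) by (cases "x = 0") (auto simp: field_simps)
  moreover have "x^2 \<le> 1" using True by (metis abs_le_square_iff abs_one one_power2)
  then have "a * (1 + x^2) \<le> 2 * a + 2 * b" using assms(3,4) mult_left_mono[of "x^2" 1 a] by (simp add: algebra_simps)
  then have "a \<le> (2 * a + 2 * b) / (1 + x^2)" by (simp add: pos_le_divide_eq add_pos_nonneg)
  ultimately show ?thesis by linarith
next
  case False
  then have x: "1 < x^2" by (metis abs_le_square_iff abs_one not_le one_power2)
  have "\<bar>f / x^2\<bar> \<le> b / x^2" using assms(2) x by (simp add: divide_right_mono)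
  also have "\<dots> = (2 * b) / (2 * x^2)" by simp
  also have "\<dots> \<le> (2 * b) / (1 + x^2)"
    using x assms(4) by (intro divide_left_mono mult_pos_pos) (auto simp: add_pos_nonneg)
  also have "\<dots> \<le> (2 * a + 2 * b) / (1 + x^2)"
    using assms(3) by (intro divide_right_mono) (auto simp: add_nonneg_nonneg)
  finally show ?thesis .
qed

lemma integrable_cos_kernel: "integrable lborel (\<lambda>x::real. (1 - cos (m * x)) / x^2)"
proof (rule Bochner_Integration.integrable_bound[OF integrable_cauchy[of "2 * (m^2 / 2) + 2 * 2"]])
  have "\<bar>(1 - cos (m * x)) / x^2\<bar> \<le> (2 * (m^2 / 2) + 2 * 2) / (1 + x^2)" for x
    using one_minus_cos_le[of "m * x"] cos_le_one[of "m * x"] cos_ge_minus_one[of "m * x"]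
    by (intro quotient_bound) (auto simp: power_mult_distrib abs_le_iff)
  then show "AE x in lborel. norm ((1 - cos (m * x)) / x^2) \<le> norm ((2 * (m^2 / 2) + 2 * 2) / (1 + x^2))"
    by (intro AE_I2) (simp add: abs_of_nonneg[of "_ / _"])
qed measurable

lemma integrable_exp_kernel: "integrable lborel (\<lambda>x::real. (1 - exp (- ((s * x)^2 / 2))) / x^2)"
proof (rule Bochner_Integration.integrable_bound[OF integrable_cauchy[of "2 * (s^2 / 2) + 2 * 1"]])
  have "\<bar>(1 - exp (- ((s * x)^2 / 2))) / x^2\<bar> \<le> (2 * (s^2 / 2) + 2 * 1) / (1 + x^2)" for x
  proof (rule quotient_bound)
    have "1 - exp (- ((s * x)^2 / 2)) \<le> (s * x)^2 / 2" "0 \<le> 1 - exp (- ((s * x)^2 / 2))"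
      using exp_ge_add_one_self[of "- ((s * x)^2 / 2)"] by auto
    then show "\<bar>1 - exp (- ((s * x)^2 / 2))\<bar> \<le> s^2 / 2 * x^2" by (simp add: power_mult_distrib)
  qed auto
  then show "AE x in lborel. norm ((1 - exp (- ((s * x)^2 / 2))) / x^2) \<le> norm ((2 * (s^2 / 2) + 2 * 1) / (1 + x^2))"
    by (intro AE_I2) (simp add: abs_of_nonneg[of "_ / _"])
qed measurable

lemma kernel_scaling:
  fixes f :: "real \<Rightarrow> real"
  assumes "f 0 = 0"
  shows "(LINT x|lborel. f (m * x) / x^2) = \<bar>m\<bar> * (LINT x|lborel. f x / x^2)"
proof (cases "m = 0")
  case False
  have "(LINT x|lborel. f x / x^2) = \<bar>m\<bar> * (LINT x|lborel. f (0 + m * x) / (0 + m * x)^2)"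
    using lborel_integral_real_affine[OF False, of "\<lambda>x. f x / x^2" 0] by simp
  also have "\<dots> = \<bar>m\<bar> * (LINT x|lborel. (f (m * x) / x^2) / m^2)"
    by (simp add: power_mult_distrib mult.commute)
  also have "\<dots> = \<bar>m\<bar> / m^2 * (LINT x|lborel. f (m * x) / x^2)"
    by (subst Bochner_Integration.integral_divide_zero) simp
  finally have "m^2 * (LINT x|lborel. f x / x^2) = \<bar>m\<bar> * (LINT x|lborel. f (m * x) / x^2)"
    using False by simp
  moreover have "m^2 = \<bar>m\<bar> * \<bar>m\<bar>" by (simp add: power2_eq_square)
  ultimately have "\<bar>m\<bar> * (LINT x|lborel. f (m * x) / x^2) = \<bar>m\<bar> * (\<bar>m\<bar> * (LINT x|lborel. f x / x^2))"
    by (simp only: mult.assoc)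
  then show ?thesis using False by (simp only: mult_cancel_left abs_eq_0 simp_thms)
qed (simp add: assms)

lemma kernel_pos:
  fixes f :: "real \<Rightarrow> real"
  assumes int: "integrable lborel (\<lambda>x. f x / x^2)" and nonneg: "\<And>x. 0 \<le> f x"
    and "0 < c" "\<And>x. 1 \<le> x \<Longrightarrow> x \<le> 2 \<Longrightarrow> c \<le> f x"
  shows "0 < (LINT x|lborel. f x / x^2)"
proof -
  have "(LINT x|lborel. indicator {1..2::real} x * (c / 4)) \<le> (LINT x|lborel. f x / x^2)"
  proof (rule integral_mono[OF _ int])
    show "integrable lborel (\<lambda>x::real. indicator {1..2} x * (c / 4))" by simp
    fix x :: real
    show "indicator {1..2} x * (c / 4) \<le> f x / x^2"
    proof (cases "x \<in> {1..2}")
      case True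
      then have "x^2 \<le> 2^2" by (intro power_mono) auto
      then have "c / 4 \<le> f x / x^2" using True assms(3) assms(4)[of x] by (intro frac_le) auto
      then show ?thesis using True by simp
    qed (simp add: nonneg)
  qed
  moreover have "(LINT x|lborel. indicator {1..2::real} x * (c / 4)) = c / 4" by simp
  ultimately show ?thesis using assms(3) by linarith
qed

text \<open>The two values are pi and \<open>sqrt (2 * pi)\<close>; the ratio
  \<open>exp_const / cos_const\<close> is the mean absolute value of a standard normal
  variable.\<close>

definition cos_const :: real where "cos_const = (LINT x|lborel. (1 - cos x) / x^2)"
definition exp_const :: real where "exp_const = (LINT x|lborel. (1 - exp (- (x^2 / 2))) / x^2)"

lemma cos_const_pos: "0 < cos_const"
  unfolding cos_const_def
proof (rule kernel_pos[where c = "1 - cos 1"])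
  show "integrable lborel (\<lambda>x::real. (1 - cos x) / x^2)" using integrable_cos_kernel[of 1] by simp
  show "0 < 1 - cos (1::real)" using cos_monotone_0_pi[of 0 1] pi_gt3 by simp
  show "1 - cos 1 \<le> 1 - cos x" if "1 \<le> x" "x \<le> 2" for x :: real
    using cos_monotone_0_pi_le[of 1 x] that pi_gt3 by simp
qed simp

lemma exp_const_pos: "0 < exp_const"
  unfolding exp_const_def
proof (rule kernel_pos[where c = "1 - exp (- 1 / 2)"])
  show "integrable lborel (\<lambda>x::real. (1 - exp (- (x^2 / 2))) / x^2)" using integrable_exp_kernel[of 1] by simp
  show "1 - exp (- 1 / 2) \<le> 1 - exp (- (x^2 / 2))" if "1 \<le> x" "x \<le> 2" for x :: real
    using one_le_power[OF that(1), of 2] by simp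
qed auto

lemma abs_eq_integral: "(LINT x|lborel. (1 - cos (m * x)) / x^2) = \<bar>m\<bar> * cos_const"
  unfolding cos_const_def using kernel_scaling[of "\<lambda>x. 1 - cos x" m] by simp

lemma sqrt_eq_integral: "(LINT x|lborel. (1 - exp (- ((s * x)^2 / 2))) / x^2) = \<bar>s\<bar> * exp_const"
  unfolding exp_const_def using kernel_scaling[of "\<lambda>x. 1 - exp (- (x^2 / 2))" s] by simp

context martingale_chain
begin

text \<open>Both \<open>\<bar>M x w\<bar>\<close> and \<open>sqrt n\<close> are integrals over the
  same kernel. Their difference integrates the error of \<open>char_gauss\<close> divided by
  \<open>y^2\<close>, at most \<open>C\<close> near 0 and at most \<open>2 / y^2\<close>
  elsewhere.\<close>

lemma abs_moment:
  assumes x: "x \<in> X" and v: "0 < v"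
    and p: "\<And>x. x \<in> X \<Longrightarrow> \<psi> x - avg A (\<lambda>a. \<psi> (st a x)) = q x - v"
    and bd: "\<And>x. x \<in> X \<Longrightarrow> \<bar>\<psi> x\<bar> \<le> K0"
  shows "\<exists>\<tau>>0. \<exists>K. \<forall>n. \<bar>mean n (\<lambda>w. \<bar>M x w\<bar>) - \<tau> * sqrt (real n)\<bar> \<le> K"
proof -
  obtain C where C: "0 \<le> C" "\<And>n l. \<bar>l\<bar> \<le> 1 \<Longrightarrow>
      \<bar>mean n (\<lambda>w. cos (l * M x w)) - exp (- (real n * v * l^2 / 2))\<bar> \<le> C * l^2"
    using char_gauss[OF x v p bd] by blast
  define K where "K = (LINT y|lborel. (2 * C + 2 * 2) / (1 + (y::real)^2))"
  have main: "\<bar>mean n (\<lambda>w. \<bar>M x w\<bar>) * cos_const - sqrt (real n) * (sqrt v * exp_const)\<bar> \<le> K" for n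
  proof -
    define F where "F y = mean n (\<lambda>w. (1 - cos (M x w * y)) / y^2)" for y :: real
    define E where "E y = (1 - exp (- ((sqrt (real n * v) * y)^2 / 2))) / y^2" for y :: real
    have intF: "integrable lborel F" "(LINT y|lborel. F y) = mean n (\<lambda>w. \<bar>M x w\<bar>) * cos_const"
    proof -
      have F: "F = (\<lambda>y. (\<Sum>w\<in>words A n. (1 - cos (M x w * y)) / y^2) / real (card (words A n)))"
        by (simp add: F_def avg_def fun_eq_iff divide_inverse mult.commute)
      show "integrable lborel F"
        unfolding F by (intro integrable_divide_zero Bochner_Integration.integrable_sum integrable_cos_kernel impI)
      show "(LINT y|lborel. F y) = mean n (\<lambda>w. \<bar>M x w\<bar>) * cos_const"
        unfolding F Bochner_Integration.integral_divide_zero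
        by (subst Bochner_Integration.integral_sum[OF integrable_cos_kernel])
          (simp only: abs_eq_integral sum_distrib_right[symmetric], simp add: avg_def divide_inverse mult_ac)
    qed
    have intE: "integrable lborel E" "(LINT y|lborel. E y) = sqrt (real n) * (sqrt v * exp_const)"
      unfolding E_def using integrable_exp_kernel sqrt_eq_integral[of "sqrt (real n * v)"] v
      by (auto simp: real_sqrt_mult)
    have "\<bar>F y - E y\<bar> \<le> (2 * C + 2 * 2) / (1 + y^2)" for y
    proof -
      define a where "a = mean n (\<lambda>w. cos (y * M x w))"
      have exp_eq: "(sqrt (real n * v) * y)^2 / 2 = real n * v * y^2 / 2"
        using v by (simp add: power_mult_distrib)
      have Fy: "F y = (1 - a) / y^2"
        unfolding F_def a_def using avg_cmult[of "words A n" "1 / y^2" "\<lambda>w. 1 - cos (y * M x w)"]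
        by (simp add: avg_diff avg_words_const mult.commute)
      have "F y - E y = (exp (- (real n * v * y^2 / 2)) - a) / y^2"
        unfolding Fy E_def exp_eq by (simp add: diff_divide_distrib[symmetric])
      also have "\<bar>\<dots>\<bar> \<le> (2 * C + 2 * 2) / (1 + y^2)"
      proof (rule quotient_bound)
        show "\<bar>exp (- (real n * v * y^2 / 2)) - a\<bar> \<le> C * y^2" if "\<bar>y\<bar> \<le> 1"
          using C(2)[OF that, of n] by (simp add: a_def abs_minus_commute)
        have "\<bar>a\<bar> \<le> 1" unfolding a_def real_norm_def[symmetric]
          by (rule norm_avg_le[OF fin_words]) simp
        moreover have "\<bar>exp (- (real n * v * y^2 / 2))\<bar> \<le> 1" using v by simp
        ultimately show "\<bar>exp (- (real n * v * y^2 / 2)) - a\<bar> \<le> 2" by linarith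
      qed (use C in auto)
      finally show ?thesis .
    qed
    then have "\<bar>LINT y|lborel. F y - E y\<bar> \<le> K"
      unfolding K_def by (intro order_trans[OF integral_abs_bound] integral_mono integrable_abs
          Bochner_Integration.integrable_diff intF intE integrable_cauchy)
    then show ?thesis by (simp add: intF intE)
  qed
  define \<tau> where "\<tau> = sqrt v * exp_const / cos_const"
  have "\<bar>mean n (\<lambda>w. \<bar>M x w\<bar>) - \<tau> * sqrt (real n)\<bar> \<le> K / cos_const" for n
  proof -
    have "mean n (\<lambda>w. \<bar>M x w\<bar>) - \<tau> * sqrt (real n) =
        (mean n (\<lambda>w. \<bar>M x w\<bar>) * cos_const - sqrt (real n) * (sqrt v * exp_const)) / cos_const"
      using cos_const_pos by (simp add: \<tau>_def field_simps)
    then show ?thesis using main[of n] cos_const_pos by (simp add: divide_right_mono)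
  qed
  moreover have "0 < \<tau>" using v cos_const_pos exp_const_pos by (simp add: \<tau>_def)
  ultimately show ?thesis by blast
qed

end

section \<open>Positive parts of additive functionals with drift\<close>

locale additive_chain = chain A st X L
  for A :: "'a set" and st :: "'a \<Rightarrow> 's \<Rightarrow> 's" and X L +
  fixes \<phi> :: "'a \<Rightarrow> 's \<Rightarrow> real" and g :: "'s \<Rightarrow> real" and \<mu> B Kg :: real
  assumes \<phi>_bound: "\<And>a x. a \<in> A \<Longrightarrow> x \<in> X \<Longrightarrow> \<bar>\<phi> a x\<bar> \<le> B"
    and g_bound: "\<And>x. x \<in> X \<Longrightarrow> \<bar>g x\<bar> \<le> Kg"
    and g_poisson: "\<And>x. x \<in> X \<Longrightarrow> g x - avg A (\<lambda>a. g (st a x)) = avg A (\<lambda>a. \<phi> a x) - \<mu>"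
begin

abbreviation "S \<equiv> additive st \<phi>"

definition \<xi> :: "'a \<Rightarrow> 's \<Rightarrow> real" where "\<xi> a x = \<phi> a x - \<mu> + g (st a x) - g x"

definition b :: real where "b = B + \<bar>\<mu>\<bar> + 2 * Kg"

sublocale martingale_chain A st X L \<xi> b
proof
  fix a x assume "a \<in> A" "x \<in> X"
  then show "\<bar>\<xi> a x\<bar> \<le> b"
    using \<phi>_bound[of a x] g_bound[of x] g_bound[of "st a x"] closed[of a x]
    unfolding \<xi>_def b_def by linarith
next
  fix x assume "x \<in> X"
  then show "avg A (\<lambda>a. \<xi> a x) = 0"
    using g_poisson[of x] unfolding \<xi>_def by (simp add: avg_add avg_diff avg_A_const)
qed

lemma S_eq: "S x w = M x w + \<mu> * real (length w) + (g x - g (fold st w x))"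
  by (induction w arbitrary: x) (auto simp: \<xi>_def algebra_simps)

lemma S_approx:
  assumes "x \<in> X" "w \<in> words A n"
  shows "\<bar>S x w - (M x w + \<mu> * real n)\<bar> \<le> 2 * Kg"
proof -
  have "length w = n" using assms by (simp add: words_def)
  then show ?thesis using g_bound[OF assms(1)] g_bound[OF word_run_closed[OF assms]] S_eq[of x w] by simp
qed

lemma avg_close:
  fixes f h :: "'a list \<Rightarrow> real"
  assumes "\<And>w. w \<in> words A n \<Longrightarrow> \<bar>f w - h w\<bar> \<le> C"
  shows "\<bar>mean n f - mean n h\<bar> \<le> C"
  unfolding avg_diff[symmetric] real_norm_def[symmetric]
  by (rule norm_avg_le[OF fin_words]) (simp add: assms)

lemma mean_S: assumes "x \<in> X" shows "\<bar>mean n (S x) - \<mu> * real n\<bar> \<le> 2 * Kg"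
proof -
  have "mean n (\<lambda>w. M x w + \<mu> * real n) = \<mu> * real n"
    by (simp add: avg_add mean_M[OF assms] avg_words_const)
  then show ?thesis using avg_close[of n "S x" "\<lambda>w. M x w + \<mu> * real n" "2 * Kg"] S_approx[OF assms] by simp
qed

lemma pos_part_le: "0 < t \<Longrightarrow> max 0 (y - t) \<le> y^2 / (4 * t)" for y t :: real
proof -
  assume t: "0 < t"
  have "0 \<le> (y - 2 * t)^2" by simp
  then have "(y - t) * (4 * t) \<le> y^2" by (simp add: power2_eq_square algebra_simps)
  then show ?thesis using t by (auto simp: pos_le_divide_eq max_def)
qed

text \<open>The excess over the drift is at most \<open>M^2 / (4 * \<bar>\<mu>\<bar> * n)\<close>,
  and the second moment of \<open>M\<close> is at most \<open>n * b^2\<close>.\<close>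

lemma wrong_side:
  assumes "x \<in> X" "\<mu> \<noteq> 0" "\<bar>c\<bar> = 1"
  shows "mean n (\<lambda>w. max 0 (c * M x w - \<bar>\<mu>\<bar> * real n)) \<le> b^2 / (4 * \<bar>\<mu>\<bar>)"
proof (cases "n = 0")
  case False
  have "c^2 = 1" using assms(3) by (metis one_power2 power2_abs)
  then have "max 0 (c * M x w - \<bar>\<mu>\<bar> * real n) \<le> 1 / (4 * (\<bar>\<mu>\<bar> * real n)) * (M x w)^2" for w
    using pos_part_le[of "\<bar>\<mu>\<bar> * real n" "c * M x w"] False assms(2) by (simp add: power_mult_distrib)
  then have "mean n (\<lambda>w. max 0 (c * M x w - \<bar>\<mu>\<bar> * real n)) \<le>
      mean n (\<lambda>w. 1 / (4 * (\<bar>\<mu>\<bar> * real n)) * (M x w)^2)"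
    by (intro avg_mono)
  also have "\<dots> \<le> 1 / (4 * (\<bar>\<mu>\<bar> * real n)) * (real n * b^2)"
    unfolding avg_cmult using variance_le[OF assms(1), of n] by (intro mult_left_mono) auto
  also have "\<dots> = b^2 / (4 * \<bar>\<mu>\<bar>)" using False assms(2) by (simp add: field_simps)
  finally show ?thesis .
qed simp

lemma wrong_side_S:
  assumes x: "x \<in> X" and \<mu>: "\<mu> \<noteq> 0" "c = 1 \<and> \<mu> < 0 \<or> c = - 1 \<and> \<mu> > 0"
  shows "0 \<le> mean n (\<lambda>w. max 0 (c * S x w))"
    and "mean n (\<lambda>w. max 0 (c * S x w)) \<le> b^2 / (4 * \<bar>\<mu>\<bar>) + 2 * Kg"
proof -
  show "0 \<le> mean n (\<lambda>w. max 0 (c * S x w))"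
    using avg_mono[of "words A n" "\<lambda>w. 0" "\<lambda>w. max 0 (c * S x w)"] by (simp add: avg_words_const)
  have "mean n (\<lambda>w. max 0 (c * S x w)) \<le> mean n (\<lambda>w. max 0 (c * M x w - \<bar>\<mu>\<bar> * real n) + 2 * Kg)"
  proof (rule avg_mono)
    fix w assume "w \<in> words A n"
    from S_approx[OF x this] show "max 0 (c * S x w) \<le> max 0 (c * M x w - \<bar>\<mu>\<bar> * real n) + 2 * Kg"
      using \<mu> g_bound[OF x] by (auto simp: max_def)
  qed
  also have "\<dots> \<le> b^2 / (4 * \<bar>\<mu>\<bar>) + 2 * Kg"
    using wrong_side[OF x \<mu>(1), of c n] \<mu>(2) by (auto simp: avg_add avg_words_const)
  finally show "mean n (\<lambda>w. max 0 (c * S x w)) \<le> b^2 / (4 * \<bar>\<mu>\<bar>) + 2 * Kg" .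
qed

text \<open>Arbitrary separation is demanded in \<open>nondeg\<close> because \<open>S\<close> and
  \<open>M\<close> differ by a bounded term: beyond that term, two words of equal length separate
  \<open>M\<close> from every state, which makes \<open>v\<close> positive when
  \<open>\<mu> = 0\<close>.\<close>

theorem pos_part_asymptotics:
  assumes x: "x \<in> X"
    and nondeg: "\<And>C. \<exists>n. \<exists>u\<in>words A n. \<exists>w\<in>words A n. \<forall>x\<in>X. C \<le> \<bar>S x u - S x w\<bar>"
  shows "\<exists>\<tau> K. 0 \<le> \<tau> \<and> (0 < \<tau> \<longleftrightarrow> \<mu> = 0) \<and>
    (\<forall>n. \<bar>mean n (\<lambda>w. max 0 (S x w)) - (max 0 \<mu> * real n + \<tau> * sqrt (real n))\<bar> \<le> K)"
proof -
  have Kg: "0 \<le> Kg" using g_bound[OF x] by linarith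
  consider "\<mu> = 0" | "\<mu> < 0" | "\<mu> > 0" by linarith
  then show ?thesis
  proof cases
    case 1
    obtain n u w where uw: "u \<in> words A n" "w \<in> words A n" "\<And>x. x \<in> X \<Longrightarrow> 1 + 4 * Kg \<le> \<bar>S x u - S x w\<bar>"
      using nondeg[of "1 + 4 * Kg"] by blast
    have sep: "1 \<le> \<bar>M x u - M x w\<bar>" if "x \<in> X" for x
      using uw(3)[OF that] S_approx[OF that uw(1)] S_approx[OF that uw(2)] by linarith
    obtain v \<psi> K0 where K0: "\<And>x. x \<in> X \<Longrightarrow> \<bar>\<psi> x\<bar> \<le> K0"
      and \<psi>: "\<And>x. x \<in> X \<Longrightarrow> \<psi> x - avg A (\<lambda>a. \<psi> (st a x)) = q x - v"
      by (rule poisson[of q "b^2"]) (rule q_bound, assumption, rule that)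
    have "0 < v" by (rule variance_pos[of \<psi> v K0, OF \<psi> K0 uw(1,2) sep])
    from abs_moment[OF x this \<psi> K0] obtain \<tau> K where \<tau>: "0 < \<tau>"
      "\<And>n. \<bar>mean n (\<lambda>w. \<bar>M x w\<bar>) - \<tau> * sqrt (real n)\<bar> \<le> K" by blast
    have "\<bar>mean n (\<lambda>w. max 0 (S x w)) - (max 0 \<mu> * real n + \<tau> / 2 * sqrt (real n))\<bar> \<le> K / 2 + 2 * Kg" for n
    proof -
      have "\<bar>mean n (\<lambda>w. max 0 (S x w)) - mean n (\<lambda>w. (1 / 2) * (\<bar>M x w\<bar> + M x w))\<bar> \<le> 2 * Kg"
      proof (rule avg_close)
        fix w assume "w \<in> words A n"
        from S_approx[OF x this] have "\<bar>S x w - M x w\<bar> \<le> 2 * Kg" using 1 by simp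
        then show "\<bar>max 0 (S x w) - (1 / 2) * (\<bar>M x w\<bar> + M x w)\<bar> \<le> 2 * Kg"
          using Kg by (auto simp: max_def abs_if)
      qed
      moreover have "mean n (\<lambda>w. (1 / 2) * (\<bar>M x w\<bar> + M x w)) = mean n (\<lambda>w. \<bar>M x w\<bar>) / 2"
        unfolding avg_cmult avg_add by (simp add: mean_M[OF x])
      ultimately show ?thesis using \<tau>(2)[of n] 1 by (simp add: abs_le_iff field_simps)
    qed
    then show ?thesis using \<tau>(1) 1 by (intro exI[of _ "\<tau> / 2"] exI[of _ "K / 2 + 2 * Kg"]) auto
  next
    case 2
    then show ?thesis using wrong_side_S[OF x, of 1]
      by (intro exI[of _ 0] exI[of _ "b^2 / (4 * \<bar>\<mu>\<bar>) + 2 * Kg"]) auto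
  next
    case 3
    have side: "\<mu> \<noteq> 0" "- 1 = (1 :: real) \<and> \<mu> < 0 \<or> - 1 = (- 1 :: real) \<and> \<mu> > 0" using 3 by auto
    \<comment> \<open>The positive part is the functional plus its negative part, and the latter
      lies on the wrong side of the drift.\<close>
    have "mean n (\<lambda>w. max 0 (S x w)) = mean n (S x) + mean n (\<lambda>w. max 0 (- 1 * S x w))" for n
      unfolding avg_add[symmetric] by (rule avg_cong) (simp add: max_def)
    then have "\<bar>mean n (\<lambda>w. max 0 (S x w)) - \<mu> * real n\<bar> \<le> b^2 / (4 * \<bar>\<mu>\<bar>) + 4 * Kg" for n
      using mean_S[OF x, of n] wrong_side_S[OF x side, of n] by (simp only:)
    then show ?thesis using 3 by (intro exI[of _ 0] exI[of _ "b^2 / (4 * \<bar>\<mu>\<bar>) + 4 * Kg"]) auto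
  qed
qed

end

section \<open>The up-down word\<close>

lemma binom_sum_pos: "0 \<le> i \<Longrightarrow> i \<le> 2 * int k \<Longrightarrow> 0 < binom_sum k i"
proof -
  assume i: "0 \<le> i" "i \<le> 2 * int k"
  let ?f = "\<lambda>j. binom (2 * int k - 2 * int j) (i - 2 * int j)"
  have "binom_sum k i = (\<Sum>j\<le>k. ?f j)" by (rule binom_sum_finite[OF i(2)])
  moreover have nonneg: "0 \<le> ?f j" and pos: "i - 2 * int j \<ge> 0 \<Longrightarrow> 0 < ?f j" if "j \<le> k" for j
  proof -
    have e: "real_of_int (2 * int k - 2 * int j) = real (2 * k - 2 * j)" using that by simp
    show "i - 2 * int j \<ge> 0 \<Longrightarrow> 0 < ?f j"
      unfolding binom_def e using i that by (simp only: binomial_gbinomial[symmetric]) auto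
    then show "0 \<le> ?f j" by (cases "i - 2 * int j \<ge> 0") (auto simp: binom_def)
  qed
  have "0 < ?f 0" using pos[of 0] i by simp
  moreover have "?f 0 \<le> (\<Sum>j\<le>k. ?f j)" by (rule member_le_sum) (use nonneg in auto)
  ultimately show ?thesis by linarith
qed

locale updown =
  fixes k s :: nat
  assumes k: "2 \<le> k" and s: "k \<le> s"
begin

abbreviation "letters \<equiv> {1..s}"
abbreviation "W \<equiv> updown_word k"
abbreviation "site i \<equiv> W ! (i mod (2 * k))"

text \<open>\<open>mean_flux\<close> divided by \<open>total_weight\<close> and by the size
  \<open>s\<close> of the alphabet, whose letters above \<open>k\<close> are idle.\<close>

definition speed :: "nat \<Rightarrow> real" where
  "speed m = binom_sum k (2 * int k - int m - 1) / (real s * binom_sum k (2 * int k - int m))"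

sublocale periodic_word W site
  by unfold_locales simp

lemma ring_chain:
  assumes "m \<le> 2 * k"
  obtains L where "chain letters (ud_step k) (profiles k m) L"
proof -
  obtain u t where u: "set u \<subseteq> {1..k}" "\<And>c. c \<in> profiles k m \<Longrightarrow> fold (ud_step k) u c = t"
    using synchronizing_word[OF k assms] by blast
  \<comment> \<open>The appended letter makes the length positive, as \<open>u\<close> may be
    empty.\<close>
  have "chain letters (ud_step k) (profiles k m) (length (u @ [1]))"
  proof
    have "replicate m True @ replicate (2 * k - m) False \<in> profiles k m"
      using assms by (simp add: profiles_def)
    then show "profiles k m \<noteq> {}" by blast
    show "\<exists>w\<in>words letters (length (u @ [1])). fold (ud_step k) w x = fold (ud_step k) w y"
      if "x \<in> profiles k m" "y \<in> profiles k m" for x y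
    proof (rule bexI[of _ "u @ [1]"])
      show "u @ [1] \<in> words letters (length (u @ [1]))" using u(1) k s by (force simp: words_def)
    qed (use u(2) that in simp)
  qed (use k s ud_step_profiles in auto)
  then show ?thesis using that by blast
qed

text \<open>Summing the Poisson equation against the weights kills its left side by stationarity.
  The total weight is positive, so the unknown constant must be \<open>speed m\<close>; this
  argument tolerates signed weights.\<close>

lemma flux_poisson:
  assumes m: "m \<le> 2 * k"
  obtains g K where "\<And>c. c \<in> profiles k m \<Longrightarrow> \<bar>g c\<bar> \<le> K"
    "\<And>c. c \<in> profiles k m \<Longrightarrow>
      g c - avg letters (\<lambda>a. g (ud_step k a c)) = avg letters (\<lambda>a. of_bool (ring_flux W a c)) - speed m"
proof -
  obtain L where "chain letters (ud_step k) (profiles k m) L" using ring_chain[OF m] .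
  then interpret chain letters "ud_step k" "profiles k m" L .
  define f :: "bool list \<Rightarrow> real" where "f c = avg letters (\<lambda>a. of_bool (ring_flux W a c))" for c
  have "\<bar>f c\<bar> \<le> 1" for c
    unfolding f_def real_norm_def[symmetric] by (rule norm_avg_le[OF finite_A A_nonempty]) simp
  then obtain v g K where g: "\<And>c. c \<in> profiles k m \<Longrightarrow> \<bar>g c\<bar> \<le> K"
    "\<And>c. c \<in> profiles k m \<Longrightarrow> g c - avg letters (\<lambda>a. g (ud_step k a c)) = f c - v"
    using poisson[of f 1] by metis
  have s0: "0 < real s" using k s by simp
  have split: "(\<Sum>a\<in>letters. F a) = (\<Sum>a\<in>{1..k}. F a) + (\<Sum>a\<in>{Suc k..s}. F a)" for F :: "nat \<Rightarrow> real"
    using sum.ub_add_nat[of 1 k F "s - k"] s by simp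
  have idle: "ud_step k a c = c" "ring_flux W a c = False" if "c \<in> profiles k m" "a \<in> {Suc k..s}" for a c
    using that ring_step_uncalled[of c W a] ring_flux_uncalled[of c W a] by (auto simp: profiles_def)
  have f: "f c = (\<Sum>a\<in>{1..k}. of_bool (ring_flux W a c)) / real s" if "c \<in> profiles k m" for c
    unfolding f_def avg_def split using idle(2)[OF that] by (simp add: divide_inverse mult.commute)
  have Pg: "avg letters (\<lambda>a. g (ud_step k a c)) = ((\<Sum>a\<in>{1..k}. g (ud_step k a c)) + real (s - k) * g c) / real s"
    if "c \<in> profiles k m" for c
    unfolding avg_def split using idle(1)[OF that] by (simp add: divide_inverse mult.commute)
  let ?sum = "\<lambda>F. \<Sum>c\<in>mcols k m. wt c * F (unroll c)"
  have sf: "?sum f = binom_sum k (2 * int k - int m - 1) / real s"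
  proof -
    have "?sum f = (\<Sum>c\<in>mcols k m. \<Sum>a\<in>{1..k}. wt c * of_bool (ring_flux W a (unroll c))) / real s"
      unfolding sum_divide_distrib
      by (intro sum.cong refl) (simp only: f[OF unroll_mcols] sum_distrib_left times_divide_eq_right sum_divide_distrib)
    also have "(\<Sum>c\<in>mcols k m. \<Sum>a\<in>{1..k}. wt c * of_bool (ring_flux W a (unroll c))) =
        (\<Sum>a\<in>{1..k}. \<Sum>c\<in>mcols k m. wt c * of_bool (ring_flux W a (unroll c)))"
      by (rule sum.swap)
    finally show ?thesis unfolding mean_flux[OF m] .
  qed
  have "?sum (\<lambda>c. avg letters (\<lambda>a. g (ud_step k a c))) = ?sum g"
  proof -
    have "?sum (\<lambda>c. avg letters (\<lambda>a. g (ud_step k a c))) =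
        (\<Sum>c\<in>mcols k m. (\<Sum>a\<in>{1..k}. wt c * g (ud_step k a (unroll c))) + real (s - k) * (wt c * g (unroll c))) / real s"
      unfolding sum_divide_distrib using Pg[OF unroll_mcols]
      by (intro sum.cong refl) (simp add: sum_distrib_left distrib_left mult_ac)
    also have "\<dots> = (real k * ?sum g + real (s - k) * ?sum g) / real s"
    proof -
      have "(\<Sum>c\<in>mcols k m. \<Sum>a\<in>{1..k}. wt c * g (ud_step k a (unroll c))) = real k * ?sum g"
        unfolding stationary[symmetric] by (rule sum.swap)
      then show ?thesis unfolding sum.distrib sum_distrib_left[symmetric] by (simp only:)
    qed
    also have "\<dots> = ?sum g" using s s0 by (simp add: of_nat_diff field_simps)
    finally show ?thesis .
  qed
  moreover have "?sum (\<lambda>c. g c - avg letters (\<lambda>a. g (ud_step k a c))) = ?sum (\<lambda>c. f c - v)"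
    using g(2)[OF unroll_mcols] by (intro sum.cong) auto
  ultimately have "?sum f = v * (\<Sum>c\<in>mcols k m. wt c)"
    by (simp add: right_diff_distrib sum_subtractf sum_distrib_left mult.commute)
  then have "v * binom_sum k (2 * int k - int m) = binom_sum k (2 * int k - int m - 1) / real s"
    unfolding sf total_weight[OF m] by simp
  moreover have "0 < binom_sum k (2 * int k - int m)" using m by (intro binom_sum_pos) auto
  ultimately have "v = speed m" using s0 by (simp add: speed_def field_simps)
  then show ?thesis using that[of g K] g unfolding f_def by blast
qed

text \<open>A depth is a difference of fluxes of two rings that read the same letters, so its
  fluctuations are those of the joint chain.\<close>

definition pair_step :: "nat \<Rightarrow> bool list \<times> bool list \<Rightarrow> bool list \<times> bool list" where
  "pair_step a x = (ud_step k a (fst x), ud_step k a (snd x))"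

lemma fold_pair_step: "fold pair_step R x = (fold (ud_step k) R (fst x), fold (ud_step k) R (snd x))"
  by (induction R arbitrary: x) (auto simp: pair_step_def)

text \<open>The word \<open>u1\<close> merges the first components, which stay merged while
  \<open>u2\<close> merges the second ones.\<close>

lemma pair_chain:
  assumes "1 \<le> m" "m \<le> 2 * k"
  obtains L where "chain letters pair_step (profiles k (m - 1) \<times> profiles k m) L"
proof -
  have le: "m - 1 \<le> 2 * k" using assms(2) by simp
  obtain u1 t1 where u1: "set u1 \<subseteq> {1..k}" "\<And>c. c \<in> profiles k (m - 1) \<Longrightarrow> fold (ud_step k) u1 c = t1"
    using synchronizing_word[OF k, of "m - 1"] le by blast
  obtain u2 t2 where u2: "set u2 \<subseteq> {1..k}" "\<And>c. c \<in> profiles k m \<Longrightarrow> fold (ud_step k) u2 c = t2"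
    using synchronizing_word[OF k assms(2)] by blast
  have "chain letters pair_step (profiles k (m - 1) \<times> profiles k m) (length (u1 @ u2 @ [1]))"
  proof
    have "replicate j True @ replicate (2 * k - j) False \<in> profiles k j" if "j \<le> 2 * k" for j
      using that by (simp add: profiles_def)
    from this[OF le] this[OF assms(2)] show "profiles k (m - 1) \<times> profiles k m \<noteq> {}" using assms by auto
    show "\<exists>w\<in>words letters (length (u1 @ u2 @ [1])). fold pair_step w x = fold pair_step w y"
      if "x \<in> profiles k (m - 1) \<times> profiles k m" "y \<in> profiles k (m - 1) \<times> profiles k m" for x y
    proof (rule bexI[of _ "u1 @ u2 @ [1]"])
      show "u1 @ u2 @ [1] \<in> words letters (length (u1 @ u2 @ [1]))"
        using u1(1) u2(1) k s by (force simp: words_def)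
      have "fold (ud_step k) u1 (fst x) = fold (ud_step k) u1 (fst y)"
        using u1(2) that by auto
      moreover have "fold (ud_step k) u2 (fold (ud_step k) u1 (snd x)) = fold (ud_step k) u2 (fold (ud_step k) u1 (snd y))"
        using u2(2) fold_ud_step_profiles that by (auto simp: mem_Times_iff)
      ultimately show "fold pair_step (u1 @ u2 @ [1]) x = fold pair_step (u1 @ u2 @ [1]) y"
        by (simp add: fold_pair_step pair_step_def)
    qed
  qed (use k s ud_step_profiles in \<open>auto simp: pair_step_def\<close>)
  then show ?thesis using that by blast
qed

section \<open>Depths of the layers as flux differences\<close>

definition profile_lcs :: "nat list \<Rightarrow> nat \<Rightarrow> int" where
  "profile_lcs R I = lcs R (2 * k * I)"

sublocale layers: concave_layers "profile_lcs R" "2 * k" "int (length R)" for R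
proof
  have step: "profile_lcs R (Suc i) - profile_lcs R i = lcs R (2 * k * i + 2 * k) - lcs R (2 * k * i)" for i
    by (simp add: profile_lcs_def algebra_simps)
  show "0 \<le> profile_lcs R (Suc i) - profile_lcs R i" for i
    unfolding step using lcs_to_mono[of "2 * k * i" "2 * k * i + 2 * k" site R] by simp
  show "profile_lcs R (Suc i) - profile_lcs R i \<le> int (2 * k)" for i
    unfolding step using lcs_to_add_le[of site R "2 * k * i" "2 * k"] by simp
  have "lcs R (N + d + 2 * k) - lcs R (N + d) \<le> lcs R (N + 2 * k) - lcs R N" for N d
  proof (induction d)
    case (Suc d)
    then show ?case using lcs_to_shift(1)[of site "2 * k" R "N + d"] by simp
  qed simp
  from this[of "2 * k * i" "2 * k" for i]
  show "profile_lcs R (Suc (Suc i)) - profile_lcs R (Suc i) \<le> profile_lcs R (Suc i) - profile_lcs R i" for i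
    unfolding step by (simp add: algebra_simps)
qed (auto simp: profile_lcs_def lcs_to_le_length)

abbreviation "depth m R \<equiv> real (layers.layer R m)"

text \<open>The upper height comparison at the maximizing period and the lower one at some period
  together locate the maximum of \<open>profile_lcs R i - m * i\<close>.\<close>

lemma tail_flux:
  assumes "c \<in> profiles k m" "m \<le> 2 * k"
  shows "layers.tail R m \<le> total_flux W c R" "total_flux W c R \<le> layers.tail R m + int m"
proof -
  have c: "length c = length W" "particles c = m" using assms by (auto simp: profiles_def)
  obtain i where "layers.tail R m + int m * int i \<le> profile_lcs R i"
    using layers.tail_attained[OF assms(2)] by blast
  also have "\<dots> \<le> total_flux W c R + int m * int i"
    using lcs_le_flux[OF c(1), of R i] c(2) by (simp add: profile_lcs_def)
  finally show "layers.tail R m \<le> total_flux W c R" by simp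
  obtain I where "total_flux W c R + int m * int I \<le> profile_lcs R I + int m"
    using flux_le_lcs[OF c(1), of R] c(2) by (auto simp: profile_lcs_def)
  also have "\<dots> \<le> layers.tail R m + int m * int I + int m"
    using layers.le_tail[OF assms(2), of R I] by simp
  finally show "total_flux W c R \<le> layers.tail R m + int m" by simp
qed

lemma depth_flux:
  assumes "1 \<le> m" "m \<le> 2 * k" "c \<in> profiles k (m - 1)" "c' \<in> profiles k m"
  shows "\<bar>depth m R - real_of_int (total_flux W c R - total_flux W c' R)\<bar> \<le> 2 * real k"
proof -
  have "layers.tail R (m - 1) = int (layers.layer R m) + layers.tail R m"
    using layers.tail_Suc[of m R] assms by simp
  moreover have le: "m - 1 \<le> 2 * k" using assms(2) by simp
  moreover have "int (m - 1) \<le> int (2 * k)" "int m \<le> int (2 * k)" using assms(2) by simp_all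
  ultimately have "\<bar>int (layers.layer R m) - (total_flux W c R - total_flux W c' R)\<bar> \<le> int (2 * k)"
    using tail_flux[OF assms(3) le, of R] tail_flux[OF assms(4,2), of R] by linarith
  then show ?thesis by linarith
qed

text \<open>Rounding costs at most \<open>2\<close> in each of the \<open>2 * k\<close> layers, and
  the incomplete last period at most \<open>2 * k\<close>.\<close>

lemma lcs_layers:
  assumes "0 \<le> \<rho>"
  shows "\<bar>real_of_int (lcs R (nat \<lfloor>\<rho> * real n\<rfloor>)) - (\<Sum>m\<in>{1..2 * k}. min (\<rho> / (2 * real k) * real n) (depth m R))\<bar> \<le> 6 * real k"
proof -
  define N where "N = nat \<lfloor>\<rho> * real n\<rfloor>"
  define I where "I = N div (2 * k)"
  define z where "z = \<rho> / (2 * real k) * real n"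
  have N: "real N \<le> \<rho> * real n" "\<rho> * real n < real N + 1"
    using assms by (auto simp: N_def)
  have IN: "N = 2 * k * I + N mod (2 * k)" "N mod (2 * k) < 2 * k" using k by (auto simp: I_def)
  have "real I \<le> z"
  proof -
    have "2 * real k * real I \<le> real N" using IN(1) by (metis le_add1 of_nat_le_iff of_nat_mult of_nat_numeral)
    then show ?thesis using N(1) k by (simp add: z_def field_simps)
  qed
  moreover have "z \<le> real I + 1"
  proof -
    have "N + 1 \<le> 2 * k * (I + 1)" using IN by simp
    then have "real N + 1 \<le> 2 * real k * (real I + 1)" by (metis (mono_tags, lifting) of_nat_1 of_nat_add of_nat_le_iff of_nat_mult of_nat_numeral)
    then show ?thesis using N(2) k by (simp add: z_def field_simps)
  qed
  ultimately have "\<bar>min (real I) (depth m R) - min z (depth m R)\<bar> \<le> 2" for m by (auto simp: min_def)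
  then have "\<bar>\<Sum>m\<in>{1..2 * k}. min (real I) (depth m R) - min z (depth m R)\<bar> \<le> (\<Sum>m\<in>{1..2 * k}. 2)"
    by (intro order_trans[OF sum_abs] sum_mono)
  moreover have "real_of_int (profile_lcs R I) = (\<Sum>m\<in>{1..2 * k}. min (real I) (depth m R))"
  proof -
    have "real_of_int (int (min a b)) = min (real a) (real b)" for a b by (simp add: min_def)
    then show ?thesis unfolding layers.eq_sum_layers[of R I] of_int_sum by (simp only:)
  qed
  ultimately have 1: "\<bar>real_of_int (profile_lcs R I) - (\<Sum>m\<in>{1..2 * k}. min z (depth m R))\<bar> \<le> 4 * real k"
    by (simp add: sum_subtractf)
  have "profile_lcs R I \<le> lcs R N" "lcs R N \<le> profile_lcs R I + int (2 * k)"
    using lcs_to_mono[of "2 * k * I" N site R] lcs_to_add_le[of site R "2 * k * I" "N mod (2 * k)"] IN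
    by (auto simp: profile_lcs_def)
  then have "\<bar>real_of_int (lcs R N) - real_of_int (profile_lcs R I)\<bar> \<le> 2 * real k" by linarith
  then show ?thesis using 1 unfolding N_def[symmetric] z_def[symmetric] by linarith
qed

end

section \<open>Nondegeneracy and asymptotics of a single layer, and their sum\<close>

context updown
begin

abbreviation "expect n \<equiv> avg (words letters n)"

lemma prefix_eq: "map site [0..<2 * k * I] = concat (replicate I W)"
proof (induction I)
  case (Suc I)
  have "[0..<2 * k * Suc I] = [0..<2 * k * I] @ [2 * k * I..<2 * k * I + 2 * k]"
    using upt_add_eq_append[of 0 "2 * k * I" "2 * k"] by (simp add: algebra_simps)
  moreover have "map site [2 * k * I..<2 * k * I + 2 * k] = W"
    by (rule nth_equalityI) auto
  ultimately have "map site [0..<2 * k * Suc I] = concat (replicate I W) @ W"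
    using Suc by simp
  then show ?case by (simp add: concat_replicate_trivial flip: replicate_append_same)
qed simp

lemma LCS_replicate: "LCS (replicate n x) v = min n (count_list v x)"
proof (rule antisym)
  obtain w where w: "subseq w (replicate n x)" "subseq w v" "length w = LCS (replicate n x) v"
    by (rule LCS_witness)
  have "set w \<subseteq> {x}"
  proof
    fix y assume "y \<in> set w"
    from list_emb_set[OF w(1) this] obtain z where "z \<in> set (replicate n x)" "y = z" .
    then show "y \<in> {x}" by (simp split: if_splits)
  qed
  then have "filter ((=) x) w = w" by (auto simp: filter_id_conv)
  then have "subseq w (filter ((=) x) v)" using w(2) subseq_filter by metis
  then have "length w \<le> length (filter ((=) x) v)" by (rule list_emb_length)
  then have "length w \<le> count_list v x" by (simp only: count_list_eq_length_filter)
  then show "LCS (replicate n x) v \<le> min n (count_list v x)" using w(3) LCS_le_left[of "replicate n x" v] by simp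
  let ?j = "min n (count_list v x)"
  have "replicate (count_list v x) x = filter (\<lambda>y. y = x) v"
    by (induction v) auto
  then have "subseq (replicate (count_list v x) x) v" by (metis subseq_filter_left)
  moreover have sub: "subseq (replicate ?j x) (replicate j' x)" if "?j \<le> j'" for j'
    using that by (metis le_add_diff_inverse replicate_add subseq_order.refl subseq_rev_drop_many)
  ultimately have "subseq (replicate ?j x) v" "subseq (replicate ?j x) (replicate n x)"
    using subseq_order.order_trans by (meson min.cobounded2, meson min.cobounded1)
  then show "?j \<le> LCS (replicate n x) v" using LCS_ge by fastforce
qed

text \<open>Each period contains the letter \<open>1\<close> twice, so the increments equal
  \<open>2\<close> until the word is used up.\<close>

lemma layer_replicate:
  assumes "1 \<le> m" shows "layers.layer (replicate (2 * k * T) 1) m = (if m \<le> 2 then k * T else 0)"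
proof -
  let ?R = "replicate (2 * k * T) (1::nat)"
  have cnt: "count_list (concat (replicate I W)) 1 = 2 * I" for I
  proof (induction I)
    case (Suc I)
    have "[1..<Suc k] = 1 # [2..<Suc k]" using k upt_conv_Cons[of 1 "Suc k"] by (simp add: numeral_2_eq_2)
    then have "count_list W 1 = 2" by (simp add: updown_word_def count_list_0_iff)
    then show ?case using Suc by simp
  qed simp
  have f: "profile_lcs ?R I = int (min (2 * k * T) (2 * I))" for I
    unfolding profile_lcs_def lcs_to_def prefix_eq LCS_replicate cnt ..
  have "{i. int m \<le> profile_lcs ?R (Suc i) - profile_lcs ?R i} = (if m \<le> 2 then {..<k * T} else {})"
    using assms unfolding f by auto
  then show ?thesis unfolding layers.layer_def by simp
qed

lemma layer_periodic:
  assumes "1 \<le> m" "m \<le> 2 * k" shows "layers.layer (concat (replicate T W)) m = T"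
proof -
  let ?R = "concat (replicate T W)"
  have len: "length (concat (replicate I W)) = 2 * k * I" for I by (induction I) auto
  have f: "profile_lcs ?R I = int (2 * k * min T I)" for I
  proof -
    have sub: "subseq (concat (replicate (min T I) W)) (concat (replicate J W))" if "min T I \<le> J" for J
      using that by (metis concat_append le_add_diff_inverse replicate_add subseq_order.refl subseq_rev_drop_many)
    have "2 * k * min T I \<le> LCS ?R (concat (replicate I W))"
      using LCS_ge[OF sub[of T] sub[of I]] len by simp
    moreover have "LCS ?R (concat (replicate I W)) \<le> 2 * k * min T I"
      using LCS_le_left[of ?R "concat (replicate I W)"] LCS_le_right[of ?R "concat (replicate I W)"] len
      by (simp add: min_def)
    ultimately show ?thesis unfolding profile_lcs_def lcs_to_def prefix_eq by simp
  qed
  have "int m \<le> profile_lcs ?R (Suc i) - profile_lcs ?R i \<longleftrightarrow> i < T" for i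
  proof (cases "i < T")
    case True
    then have "min T (Suc i) = Suc i" "min T i = i" by auto
    then show ?thesis unfolding f using True assms by (simp add: algebra_simps)
  next
    case False
    then have "min T (Suc i) = T" "min T i = T" by auto
    then show ?thesis unfolding f using False assms by simp
  qed
  then show ?thesis unfolding layers.layer_def by simp
qed

text \<open>At depth \<open>m\<close> the constant word reaches \<open>k * T\<close> or
  \<open>0\<close> and the periodic word of the same length reaches \<open>T\<close>; since
  \<open>k\<close> is at least \<open>2\<close>, these differ by at least \<open>T\<close>. This
  supplies the nondegeneracy of the martingale.\<close>

lemma separating_words:
  assumes "1 \<le> m" "m \<le> 2 * k"
  shows "\<exists>n. \<exists>u\<in>words letters n. \<exists>w\<in>words letters n. real T \<le> \<bar>depth m u - depth m w\<bar>"
proof -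
  let ?u = "replicate (2 * k * T) (1::nat)" and ?w = "concat (replicate T W)"
  have u:  "?u \<in> words letters (2 * k * T)" using k s by (auto simp: words_def)
  have "length ?w = 2 * k * T" by (induction T) auto
  moreover have "set ?w \<subseteq> letters" using s by auto
  ultimately have w: "?w \<in> words letters (2 * k * T)" by (simp add: words_def)
  have "2 * real T \<le> real k * real T" using k by (intro mult_right_mono) auto
  then have "real T \<le> \<bar>depth m ?u - depth m ?w\<bar>"
    unfolding layer_replicate[OF assms(1)] layer_periodic[OF assms] by simp
  then show ?thesis using u w by blast
qed

text \<open>The functional \<open>S\<close> follows \<open>z * n - depth m\<close> up to a constant,
  and its positive part is what \<open>min\<close> cuts off from \<open>z * n\<close>. The drift of
  \<open>S\<close> is \<open>z\<close> minus the speed difference, so the square-root term appears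
  exactly when they agree.\<close>

lemma speed_diff_bound:
  assumes m: "1 \<le> m" "m \<le> 2 * k"
  obtains K where "\<And>n. \<bar>expect n (depth m) - (speed (m - 1) - speed m) * real n\<bar> \<le> K"
    "\<exists>\<tau>. 0 \<le> \<tau> \<and> (0 < \<tau> \<longleftrightarrow> z = speed (m - 1) - speed m) \<and>
      (\<forall>n. \<bar>expect n (\<lambda>R. min (z * real n) (depth m R))
        - (min z (speed (m - 1) - speed m) * real n - \<tau> * sqrt (real n))\<bar> \<le> K)"
proof -
  have m1: "m - 1 \<le> 2 * k" using m by simp
  obtain g1 K1 where g1: "\<And>c. c \<in> profiles k (m - 1) \<Longrightarrow> \<bar>g1 c\<bar> \<le> K1"
    "\<And>c. c \<in> profiles k (m - 1) \<Longrightarrow> g1 c - avg letters (\<lambda>a. g1 (ud_step k a c))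
      = avg letters (\<lambda>a. of_bool (ring_flux W a c)) - speed (m - 1)"
    by (rule flux_poisson[OF m1]) (rule that)
  obtain g2 K2 where g2: "\<And>c. c \<in> profiles k m \<Longrightarrow> \<bar>g2 c\<bar> \<le> K2"
    "\<And>c. c \<in> profiles k m \<Longrightarrow> g2 c - avg letters (\<lambda>a. g2 (ud_step k a c))
      = avg letters (\<lambda>a. of_bool (ring_flux W a c)) - speed m"
    by (rule flux_poisson[OF m(2)]) (rule that)
  let ?X = "profiles k (m - 1) \<times> profiles k m"
  obtain L where "chain letters pair_step ?X L" using pair_chain[OF m] .
  then interpret chain letters pair_step ?X L .
  define flux :: "nat \<Rightarrow> bool list \<times> bool list \<Rightarrow> real" where
    "flux a x = of_bool (ring_flux W a (fst x)) - of_bool (ring_flux W a (snd x))" for a x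
  define \<phi> where "\<phi> a x = z - flux a x" for a x
  define g where "g x = - (g1 (fst x) - g2 (snd x))" for x
  define d where "d = speed (m - 1) - speed m"
  interpret additive_chain letters pair_step ?X L \<phi> g "z - d" "\<bar>z\<bar> + 1" "K1 + K2"
  proof
    show "\<bar>\<phi> a x\<bar> \<le> \<bar>z\<bar> + 1" for a x by (auto simp: \<phi>_def flux_def)
    fix x assume x: "x \<in> ?X"
    then have x': "fst x \<in> profiles k (m - 1)" "snd x \<in> profiles k m" by auto
    show "\<bar>g x\<bar> \<le> K1 + K2" using g1(1)[OF x'(1)] g2(1)[OF x'(2)] unfolding g_def by linarith
    have "avg letters (\<lambda>a. g (pair_step a x)) =
        - (avg letters (\<lambda>a. g1 (ud_step k a (fst x))) - avg letters (\<lambda>a. g2 (ud_step k a (snd x))))"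
      using avg_cmult[of letters "- 1" "\<lambda>a. g1 (ud_step k a (fst x)) - g2 (ud_step k a (snd x))"]
      by (simp add: g_def pair_step_def avg_diff)
    moreover have "avg letters (\<lambda>a. \<phi> a x) = z - (avg letters (\<lambda>a. of_bool (ring_flux W a (fst x)))
        - avg letters (\<lambda>a. of_bool (ring_flux W a (snd x))))"
      unfolding \<phi>_def flux_def avg_diff avg_A_const ..
    ultimately show "g x - avg letters (\<lambda>a. g (pair_step a x)) = avg letters (\<lambda>a. \<phi> a x) - (z - d)"
      using g1(2)[OF x'(1)] g2(2)[OF x'(2)] unfolding g_def d_def by linarith
  qed
  have S_flux: "S x R = z * real (length R) - real_of_int (total_flux W (fst x) R - total_flux W (snd x) R)" for x R
    by (induction R arbitrary: x)
      (auto simp: total_flux_def \<phi>_def flux_def pair_step_def algebra_simps split: if_splits)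
  have S_depth: "\<bar>S x R - (z * real n - depth m R)\<bar> \<le> 2 * real k" if "x \<in> ?X" "R \<in> words letters n" for x R n
  proof -
    have "fst x \<in> profiles k (m - 1)" "snd x \<in> profiles k m" "length R = n" using that by (auto simp: words_def)
    then show ?thesis using depth_flux[OF m, of "fst x" "snd x" R] unfolding S_flux by (simp add: abs_le_iff)
  qed
  obtain x where x: "x \<in> ?X" using X_nonempty by blast
  have nondeg: "\<exists>n. \<exists>u\<in>words letters n. \<exists>w\<in>words letters n. \<forall>x\<in>?X. C \<le> \<bar>S x u - S x w\<bar>" for C
  proof -
    \<comment> \<open>The margin \<open>4 * k\<close> pays for passing from depths to flux
      differences at both words.\<close>
    obtain n u w where uw: "u \<in> words letters n" "w \<in> words letters n"
      "real (nat \<lceil>C\<rceil> + 4 * k) \<le> \<bar>depth m u - depth m w\<bar>"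
      using separating_words[OF m, of "nat \<lceil>C\<rceil> + 4 * k"] by blast
    have "C \<le> \<bar>S x u - S x w\<bar>" if "x \<in> ?X" for x
    proof -
      have "C + 4 * real k \<le> real (nat \<lceil>C\<rceil> + 4 * k)" using real_nat_ceiling_ge[of C] by simp
      then show ?thesis using uw(3) S_depth[OF that uw(1)] S_depth[OF that uw(2)] by linarith
    qed
    then show ?thesis using uw by blast
  qed
  obtain \<tau> K where \<tau>: "0 \<le> \<tau>" "0 < \<tau> \<longleftrightarrow> z - d = 0"
    "\<And>n. \<bar>expect n (\<lambda>w. max 0 (S x w)) - (max 0 (z - d) * real n + \<tau> * sqrt (real n))\<bar> \<le> K"
    using pos_part_asymptotics[OF x nondeg] by blast
  have mean: "\<bar>expect n (depth m) - d * real n\<bar> \<le> 2 * real k + 2 * (K1 + K2)" for n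
  proof -
    have "\<bar>expect n (S x) - expect n (\<lambda>R. z * real n - depth m R)\<bar> \<le> 2 * real k"
      by (rule avg_close) (rule S_depth[OF x])
    moreover have "expect n (\<lambda>R. z * real n - depth m R) = z * real n - expect n (depth m)"
      by (simp only: avg_diff avg_words_const)
    ultimately show ?thesis using mean_S[OF x, of n] by (simp add: left_diff_distrib)
  qed
  have minim: "\<bar>expect n (\<lambda>R. min (z * real n) (depth m R))
        - (min z d * real n - \<tau> * sqrt (real n))\<bar> \<le> 2 * real k + K" for n
  proof -
    have "\<bar>expect n (\<lambda>R. min (z * real n) (depth m R))
        - expect n (\<lambda>R. z * real n - max 0 (S x R))\<bar> \<le> 2 * real k"
    proof (rule avg_close)
      fix R assume "R \<in> words letters n"
      from S_depth[OF x this]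
      show "\<bar>min (z * real n) (depth m R) - (z * real n - max 0 (S x R))\<bar> \<le> 2 * real k"
        by (auto simp: min_def max_def)
    qed
    moreover have "expect n (\<lambda>R. z * real n - max 0 (S x R)) =
        z * real n - expect n (\<lambda>R. max 0 (S x R))"
      by (simp only: avg_diff avg_words_const)
    moreover have "min z d * real n = z * real n - max 0 (z - d) * real n"
      by (auto simp: min_def max_def algebra_simps)
    ultimately show ?thesis using \<tau>(3)[of n] by linarith
  qed
  define K' where "K' = max (2 * real k + 2 * (K1 + K2)) (2 * real k + K)"
  show ?thesis
  proof (rule that[of K'])
    show "\<bar>expect n (depth m) - (speed (m - 1) - speed m) * real n\<bar> \<le> K'" for n
      using mean[of n] unfolding K'_def d_def by linarith
    show "\<exists>\<tau>. 0 \<le> \<tau> \<and> (0 < \<tau> \<longleftrightarrow> z = speed (m - 1) - speed m) \<and>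
      (\<forall>n. \<bar>expect n (\<lambda>R. min (z * real n) (depth m R))
        - (min z (speed (m - 1) - speed m) * real n - \<tau> * sqrt (real n))\<bar> \<le> K')"
    proof (intro exI[of _ \<tau>] conjI allI)
      show "\<bar>expect n (\<lambda>R. min (z * real n) (depth m R))
          - (min z (speed (m - 1) - speed m) * real n - \<tau> * sqrt (real n))\<bar> \<le> K'" for n
        using minim[of n] unfolding K'_def d_def by linarith
    qed (use \<tau>(1,2) d_def in auto)
  qed
qed

text \<open>Thresholds are numbered from the shallowest layer upwards, while depths decrease in the
  layer index; hence threshold \<open>j\<close> belongs to layer
  \<open>2 * k + 1 - j\<close>.\<close>

lemma threshold_eq:
  assumes "1 \<le> j" "j \<le> 2 * k"
  shows "threshold k s j = 2 * real k * (speed (2 * k + 1 - j - 1) - speed (2 * k + 1 - j))"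
proof -
  have e: "int (2 * k + 1 - j - 1) = 2 * int k - int j" "int (2 * k + 1 - j) = 2 * int k + 1 - int j"
    using assms by linarith+
  have i: "2 * int k - (2 * int k - int j) = int j" "2 * int k - (2 * int k + 1 - int j) = int j - 1" "int j - 1 - 1 = int j - 2" by auto
  show ?thesis unfolding threshold_def speed_def e i by (simp add: right_diff_distrib)
qed

lemma linear_growth_le:
  fixes a b K :: real
  assumes "\<And>n. a * real n \<le> b * real n + K" shows "a \<le> b"
proof (rule ccontr)
  assume "\<not> a \<le> b"
  then have ab: "0 < a - b" by simp
  obtain n where "K / (a - b) < real n" using reals_Archimedean2 by blast
  then have "K < (a - b) * real n" using ab by (simp add: field_simps)
  then show False using assms[of n] by (simp add: algebra_simps)
qed

text \<open>The inequality is read off from the dynamics instead of the binomial sums: depths are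
  ordered for every word, hence so are their means, which grow linearly with the speed differences
  as slopes.\<close>

lemma threshold_Suc_le:
  assumes "1 \<le> j" "Suc j \<le> 2 * k"
  shows "threshold k s j \<le> threshold k s (Suc j)"
proof -
  define m where "m = 2 * k - j"
  have m: "1 \<le> m" "m \<le> 2 * k" "Suc m \<le> 2 * k" using assms by (auto simp: m_def)
  obtain K1 where K1: "\<And>n. \<bar>expect n (depth m) - (speed (m - 1) - speed m) * real n\<bar> \<le> K1"
    using speed_diff_bound[OF m(1,2), of 0] by metis
  obtain K2 where K2: "\<And>n. \<bar>expect n (depth (Suc m)) - (speed (Suc m - 1) - speed (Suc m)) * real n\<bar> \<le> K2"
    using speed_diff_bound[OF _ m(3), of 0] by (metis le_add1 plus_1_eq_Suc)
  have "(speed (Suc m - 1) - speed (Suc m)) * real n \<le> (speed (m - 1) - speed m) * real n + (K1 + K2)" for n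
  proof -
    have "expect n (depth (Suc m)) \<le> expect n (depth m)"
      using layers.layer_antimono[OF m(1), of "Suc m"] by (intro avg_mono) simp
    then show ?thesis using K1[of n] K2[of n] by linarith
  qed
  then have "speed (Suc m - 1) - speed (Suc m) \<le> speed (m - 1) - speed m" by (rule linear_growth_le)
  moreover have "2 * k + 1 - j = Suc m" "2 * k + 1 - Suc j = m" using assms by (auto simp: m_def)
  ultimately show ?thesis
    using threshold_eq[of j] threshold_eq[of "Suc j"] assms k by (simp add: mult_left_mono)
qed

lemma threshold_mono:
  assumes "1 \<le> i" "i \<le> j" "j \<le> 2 * k" shows "threshold k s i \<le> threshold k s j"
  using assms(2,3)
proof (induction j rule: dec_induct)
  case (step j)
  then show ?case using threshold_Suc_le[of j] assms(1) by simp
qed simp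

lemma phase_props:
  shows "phase k s \<rho> \<le> 2 * k"
    and "1 \<le> j \<Longrightarrow> j \<le> 2 * k \<Longrightarrow> threshold k s j \<le> \<rho> \<longleftrightarrow> j \<le> phase k s \<rho>"
proof -
  let ?P = "insert 0 {m \<in> {1..2 * k}. threshold k s m \<le> \<rho>}"
  have fin: "finite ?P" by simp
  have mem: "phase k s \<rho> \<in> ?P" unfolding phase_def by (rule Max_in[OF fin]) simp
  then show le: "phase k s \<rho> \<le> 2 * k" by auto
  assume j: "1 \<le> j" "j \<le> 2 * k"
  show "threshold k s j \<le> \<rho> \<longleftrightarrow> j \<le> phase k s \<rho>"
  proof
    assume "threshold k s j \<le> \<rho>"
    then show "j \<le> phase k s \<rho>" unfolding phase_def using j by (intro Max_ge[OF fin]) auto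
  next
    assume "j \<le> phase k s \<rho>"
    then show "threshold k s j \<le> \<rho>"
      using threshold_mono[OF j(1), of "phase k s \<rho>"] mem j le by auto
  qed
qed

text \<open>The terms up to the phase telescope to the quotient of binomial sums; each later term is
  \<open>\<rho> / (2 * real k)\<close>.\<close>

lemma sum_min_thresholds:
  "(\<Sum>j\<in>{1..2 * k}. min (\<rho> / (2 * real k)) (threshold k s j / (2 * real k))) = linear_coeff k s \<rho> (phase k s \<rho>)"
proof -
  let ?F = "\<lambda>j. min (\<rho> / (2 * real k)) (threshold k s j / (2 * real k))"
  define p where "p = phase k s \<rho>"
  have p: "p \<le> 2 * k" unfolding p_def by (rule phase_props)
  have kp: "0 < 2 * real k" using k by simp
  have telescope: "(\<Sum>j\<in>{1..q}. threshold k s j / (2 * real k)) =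
      binom_sum k (int q - 1) / (real s * binom_sum k (int q))" for q
  proof (induction q)
    case 0 then show ?case by (simp add: binom_sum_neg)
  next
    case (Suc q)
    then show ?case using kp by (simp add: threshold_def diff_divide_distrib)
  qed
  have "(\<Sum>j\<in>{1..2 * k}. ?F j) =
    (\<Sum>j\<in>{1..p}. ?F j)
    + (\<Sum>j\<in>{Suc p..2 * k}. ?F j)"
    using p sum.ub_add_nat[of 1 p ?F "2 * k - p"] by simp
  also have "(\<Sum>j\<in>{1..p}. ?F j) = (\<Sum>j\<in>{1..p}. threshold k s j / (2 * real k))"
    using phase_props(2)[of _ \<rho>] p kp by (intro sum.cong refl min_absorb2 divide_right_mono) (auto simp: p_def)
  also have "(\<Sum>j\<in>{Suc p..2 * k}. ?F j) = (\<Sum>j\<in>{Suc p..2 * k}. \<rho> / (2 * real k))"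
  proof (intro sum.cong refl min_absorb1 divide_right_mono)
    fix j assume "j \<in> {Suc p..2 * k}"
    then show "\<rho> \<le> threshold k s j" using phase_props(2)[of j \<rho>] by (auto simp: p_def)
  qed (use kp in simp)
  also have "\<dots> = (1 - real p / (2 * real k)) * \<rho>"
    using p kp by (simp add: of_nat_diff field_simps)
  finally show ?thesis unfolding telescope linear_coeff_def p_def by simp
qed

text \<open>Every layer contributes its own square-root term, so \<open>\<tau>\<close> is a sum of
  nonnegative terms, positive exactly if some layer is critical.\<close>

theorem mean_lcs:
  assumes \<rho>: "0 \<le> \<rho>"
  shows "\<exists>\<tau> C. 0 \<le> \<tau> \<and> (0 < \<tau> \<longleftrightarrow> 1 \<le> phase k s \<rho> \<and> threshold k s (phase k s \<rho>) = \<rho>) \<and>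
    (\<forall>n. \<bar>expect n (\<lambda>R. real_of_int (lcs R (nat \<lfloor>\<rho> * real n\<rfloor>)))
      - (linear_coeff k s \<rho> (phase k s \<rho>) * real n - \<tau> * sqrt (real n))\<bar> \<le> C)"
proof -
  define z where "z = \<rho> / (2 * real k)"
  have kp: "0 < 2 * real k" using k by simp
  let ?thr = "\<lambda>m. threshold k s (2 * k + 1 - m) / (2 * real k)"
  have thr: "speed (m - 1) - speed m = ?thr m" if "m \<in> {1..2 * k}" for m
  proof -
    have j: "1 \<le> 2 * k + 1 - m" "2 * k + 1 - m \<le> 2 * k" "2 * k + 1 - (2 * k + 1 - m) = m"
      using that by auto
    then show ?thesis unfolding threshold_eq[OF j(1,2)] j(3) using kp by simp
  qed
  have "\<forall>m\<in>{1..2 * k}. \<exists>\<tau> K. 0 \<le> \<tau> \<and> (0 < \<tau> \<longleftrightarrow> z = ?thr m) \<and>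
      (\<forall>n. \<bar>expect n (\<lambda>R. min (z * real n) (depth m R))
        - (min z (?thr m) * real n - \<tau> * sqrt (real n))\<bar> \<le> K)" (is "\<forall>m\<in>_. ?Q m")
  proof
    fix m assume m: "m \<in> {1..2 * k}"
    then have "1 \<le> m" "m \<le> 2 * k" by auto
    from speed_diff_bound[OF this, of z] show "?Q m" unfolding thr[OF m] by metis
  qed
  then obtain t K where t: "\<And>m. m \<in> {1..2 * k} \<Longrightarrow> 0 \<le> t m" "\<And>m. m \<in> {1..2 * k} \<Longrightarrow> 0 < t m \<longleftrightarrow> z = ?thr m"
    and K: "\<And>m n. m \<in> {1..2 * k} \<Longrightarrow> \<bar>expect n (\<lambda>R. min (z * real n) (depth m R))
        - (min z (?thr m) * real n - t m * sqrt (real n))\<bar> \<le> K m"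
    by metis
  have fin: "finite (words letters n)" "words letters n \<noteq> {}" for n
    using words_nonempty[of letters n] k s by auto
  have flip: "(\<Sum>m\<in>{1..2 * k}. F (2 * k + 1 - m)) = (\<Sum>j\<in>{1..2 * k}. F j)" for F :: "nat \<Rightarrow> real"
    by (rule sum.reindex_bij_witness[of _ "\<lambda>j. 2 * k + 1 - j" "\<lambda>m. 2 * k + 1 - m"]) auto
  define \<tau> where "\<tau> = (\<Sum>m\<in>{1..2 * k}. t m)"
  have main: "\<bar>expect n (\<lambda>R. real_of_int (lcs R (nat \<lfloor>\<rho> * real n\<rfloor>)))
      - (linear_coeff k s \<rho> (phase k s \<rho>) * real n - \<tau> * sqrt (real n))\<bar> \<le> 6 * real k + (\<Sum>m\<in>{1..2 * k}. K m)" for n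
  proof -
    have "\<bar>expect n (\<lambda>R. real_of_int (lcs R (nat \<lfloor>\<rho> * real n\<rfloor>)))
        - expect n (\<lambda>R. \<Sum>m\<in>{1..2 * k}. min (z * real n) (depth m R))\<bar> \<le> 6 * real k"
      unfolding avg_diff[symmetric] real_norm_def[symmetric]
      by (rule norm_avg_le[OF fin]) (use lcs_layers[OF \<rho>] in \<open>simp add: z_def\<close>)
    moreover have "\<bar>expect n (\<lambda>R. \<Sum>m\<in>{1..2 * k}. min (z * real n) (depth m R))
        - (\<Sum>m\<in>{1..2 * k}. min z (?thr m) * real n - t m * sqrt (real n))\<bar> \<le> (\<Sum>m\<in>{1..2 * k}. K m)"
      unfolding avg_sum sum_subtractf[symmetric] by (intro order_trans[OF sum_abs] sum_mono K)
    moreover have "(\<Sum>m\<in>{1..2 * k}. min z (?thr m) * real n - t m * sqrt (real n)) =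
        linear_coeff k s \<rho> (phase k s \<rho>) * real n - \<tau> * sqrt (real n)"
      unfolding sum_subtractf sum_distrib_right[symmetric] \<tau>_def z_def
        flip[of "\<lambda>j. min (\<rho> / (2 * real k)) (threshold k s j / (2 * real k))"] sum_min_thresholds ..
    ultimately show ?thesis by linarith
  qed
  have "0 \<le> \<tau>" unfolding \<tau>_def by (intro sum_nonneg t)
  moreover have "0 < \<tau> \<longleftrightarrow> 1 \<le> phase k s \<rho> \<and> threshold k s (phase k s \<rho>) = \<rho>"
  proof -
    have "0 < \<tau> \<longleftrightarrow> (\<exists>m\<in>{1..2 * k}. 0 < t m)"
      unfolding \<tau>_def using t(1) sum_nonneg_eq_0_iff[of "{1..2 * k}" t] sum_nonneg[of "{1..2 * k}" t]
      by (metis finite_atLeastAtMost less_le)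
    also have "\<dots> \<longleftrightarrow> (\<exists>j\<in>{1..2 * k}. threshold k s j = \<rho>)"
    proof -
      have *: "0 < t m \<longleftrightarrow> threshold k s (2 * k + 1 - m) = \<rho>" if "m \<in> {1..2 * k}" for m
        using t(2)[OF that] kp by (auto simp: z_def)
      have swap: "2 * k + 1 - j \<in> {1..2 * k}" "2 * k + 1 - (2 * k + 1 - j) = j" if "j \<in> {1..2 * k}" for j
        using that by auto
      show ?thesis using * swap by metis
    qed
    \<comment> \<open>Several thresholds may equal \<open>\<rho>\<close>. Any such index is at most
      the phase, and monotonicity then squeezes the threshold of the phase to \<open>\<rho>\<close>
      as well.\<close>
    also have "\<dots> \<longleftrightarrow> 1 \<le> phase k s \<rho> \<and> threshold k s (phase k s \<rho>) = \<rho>"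
    proof (intro iffI; (elim bexE conjE)?)
      fix j assume j: "j \<in> {1..2 * k}" "threshold k s j = \<rho>"
      then have "j \<le> phase k s \<rho>" using phase_props(2)[of j \<rho>] by auto
      moreover from this have "threshold k s j \<le> threshold k s (phase k s \<rho>)"
        using threshold_mono[of j "phase k s \<rho>"] phase_props(1)[of \<rho>] j by auto
      moreover have "threshold k s (phase k s \<rho>) \<le> \<rho>"
        using phase_props(1)[of \<rho>] phase_props(2)[of "phase k s \<rho>" \<rho>] calculation(1) j by auto
      ultimately show "1 \<le> phase k s \<rho> \<and> threshold k s (phase k s \<rho>) = \<rho>" using j by auto
    next
      assume "1 \<le> phase k s \<rho>" "threshold k s (phase k s \<rho>) = \<rho>"
      then show "\<exists>j\<in>{1..2 * k}. threshold k s j = \<rho>" using phase_props(1)[of \<rho>] by auto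
    qed
    finally show ?thesis .
  qed
  ultimately show ?thesis using main by blast
qed

end

subsection \<open>Independence of the alphabet\<close>

lemma periodic_prefix_eq: "W \<noteq> [] \<Longrightarrow> periodic_prefix W N = map (\<lambda>i. W ! (i mod length W)) [0..<N]"
proof -
  have snth: "W \<noteq> [] \<Longrightarrow> cycle W !! i = W ! (i mod length W)" for W :: "'a list" and i
  proof (induction i arbitrary: W)
    case 0 then show ?case by (simp add: hd_conv_nth)
  next
    case (Suc i)
    have "(tl W @ [hd W]) ! (i mod length W) = W ! (Suc i mod length W)"
    proof (cases "Suc (i mod length W) = length W")
      case True
      then have e: "i mod length W = length (tl W)" "Suc i mod length W = 0" by (simp_all add: mod_Suc)
      have "(tl W @ [hd W]) ! (i mod length W) = hd W" unfolding e(1) by (rule nth_append_length)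
      then show ?thesis using Suc.prems e(2) by (simp add: hd_conv_nth)
    next
      case False
      then have "i mod length W < length W - 1"
        using Suc.prems by (metis Suc_lessI diff_Suc_1 length_greater_0_conv less_Suc_eq_le mod_less_divisor Suc_le_eq le_antisym less_diff_conv add.commute plus_1_eq_Suc)
      then show ?thesis using False by (simp add: nth_append mod_Suc nth_tl)
    qed
    then show ?case using Suc.IH[of "tl W @ [hd W]"] Suc.prems by simp
  qed
  assume "W \<noteq> []"
  then show ?thesis
    unfolding periodic_prefix_def by (intro nth_equalityI) (simp_all add: snth)
qed

lemma lcs_to_map:
  assumes "\<And>a i. a \<in> set R \<Longrightarrow> s i = f a \<longleftrightarrow> s i = a"
  shows "lcs_to s (map f R) N = lcs_to s R N"
  using assms
proof (induction R arbitrary: N rule: rev_induct)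
  case (snoc a R)
  have IH: "lcs_to s (map f R) N = lcs_to s R N" for N by (rule snoc.IH) (use snoc.prems in auto)
  show ?case by (induction N) (use snoc.prems in \<open>auto simp: lcs_to_snoc_Suc IH\<close>)
qed simp

text \<open>Letters outside \<open>{1..k}\<close> never match the periodic word, so a bijection
  fixing \<open>{1..k}\<close> preserves the LCS, and only the size of \<open>A\<close>
  matters.\<close>

lemma expected_LCS_eq:
  assumes k: "2 \<le> k" and A: "finite A" "{1..k} \<subseteq> A"
  shows "expected_LCS A k \<rho> n = avg (words {1..card A} n)
    (\<lambda>R. real_of_int (lcs_to (\<lambda>i. updown_word k ! (i mod (2 * k))) R (nat \<lfloor>\<rho> * real n\<rfloor>)))"
proof -
  let ?s = "\<lambda>i. updown_word k ! (i mod (2 * k))"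
  define N where "N = nat \<lfloor>\<rho> * real n\<rfloor>"
  have ne: "A \<noteq> {}" using A k by auto
  have W: "updown_word k \<noteq> []" using k by (metis length_updown list.size(3) mult_eq_0_iff not_numeral_le_zero zero_neq_numeral)
  have s_in: "?s i \<in> {1..k}" for i
    using nth_mem[of "i mod (2 * k)" "updown_word k"] k by simp
  have sA: "k \<le> card A" using card_mono[OF A] by simp
  have "card (A - {1..k}) = card ({1..card A} - {1..k})"
    using A sA by (simp add: card_Diff_subset)
  then obtain h where h: "bij_betw h (A - {1..k}) ({1..card A} - {1..k})"
    using A by (metis finite_Diff finite_atLeastAtMost finite_same_card_bij)
  define f where "f a = (if a \<in> {1..k} then a else h a)" for a
  have "bij_betw f ({1..k} \<union> (A - {1..k})) ({1..k} \<union> ({1..card A} - {1..k}))"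
  proof (rule bij_betw_combine)
    show "bij_betw f {1..k} {1..k}" by (rule bij_betw_cong[THEN iffD1, OF _ bij_betw_id]) (simp add: f_def)
    show "bij_betw f (A - {1..k}) ({1..card A} - {1..k})"
      by (rule bij_betw_cong[THEN iffD1, OF _ h]) (auto simp: f_def)
  qed auto
  moreover have "{1..k} \<union> (A - {1..k}) = A" "{1..k} \<union> ({1..card A} - {1..k}) = {1..card A}" using A sA by auto
  ultimately have f: "bij_betw f A {1..card A}" by simp
  have f_off: "f a \<notin> {1..k}" if "a \<in> A" "a \<notin> {1..k}" for a
    using that bij_betwE[OF h] by (auto simp: f_def)
  have letter: "?s i = f a \<longleftrightarrow> ?s i = a" if "a \<in> A" for a i
    using f_off[OF that] s_in[of i] by (cases "a \<in> {1..k}") (auto simp: f_def)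
  have bij: "bij_betw (map f) (words A n) (words {1..card A} n)"
  proof (rule bij_betw_byWitness[where f' = "map (inv_into A f)"])
    show "\<forall>w\<in>words A n. map (inv_into A f) (map f w) = w"
      by (auto simp: words_def subset_iff bij_betw_inv_into_left[OF f] intro!: map_idI)
    show "\<forall>w\<in>words {1..card A} n. map f (map (inv_into A f) w) = w"
      using bij_betw_inv_into_right[OF f] by (auto simp: words_def subset_iff intro!: map_idI)
    show "map f ` words A n \<subseteq> words {1..card A} n"
      using bij_betwE[OF f] by (fastforce simp: words_def)
    show "map (inv_into A f) ` words {1..card A} n \<subseteq> words A n"
      using bij_betwE[OF bij_betw_inv_into[OF f]] by (fastforce simp: words_def)
  qed
  have "expected_LCS A k \<rho> n = avg (words A n) (\<lambda>R. real (LCS R (periodic_prefix (updown_word k) N)))"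
    unfolding expected_LCS_def random_word_def N_def[symmetric] words_def[symmetric]
    using finite_words[OF A(1), of n] words_nonempty[OF ne, of n]
    by (subst integral_pmf_of_set) (auto simp: avg_def divide_inverse mult.commute)
  also have "\<dots> = avg (words A n) (\<lambda>R. real_of_int (lcs_to ?s R N))"
    using periodic_prefix_eq[OF W] by (simp add: lcs_to_def)
  also have "\<dots> = avg (words A n) (\<lambda>R. real_of_int (lcs_to ?s (map f R) N))"
    by (rule avg_cong, subst lcs_to_map) (auto simp: words_def subset_iff letter)
  also have "\<dots> = avg (words {1..card A} n) (\<lambda>R. real_of_int (lcs_to ?s R N))"
    by (rule avg_bij[OF bij, symmetric])
  finally show ?thesis unfolding N_def .
qed

theorem theorem2:
  "\<exists>(\<tau> :: nat \<Rightarrow> nat \<Rightarrow> real \<Rightarrow> real) (C :: nat \<Rightarrow> nat \<Rightarrow> real \<Rightarrow> real).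
     \<forall>(k :: nat) (A :: nat set) (\<rho> :: real).
       k \<ge> 2 \<longrightarrow> finite A \<longrightarrow> {1..k} \<subseteq> A \<longrightarrow> \<rho> \<ge> 0 \<longrightarrow>
       (let s = card A; m = phase k s \<rho> in
          (\<forall>n :: nat.
             \<bar>expected_LCS A k \<rho> n
               - (linear_coeff k s \<rho> m * real n - \<tau> k s \<rho> * sqrt (real n))\<bar> \<le> C k s \<rho>)
          \<and> \<tau> k s \<rho> \<ge> 0
          \<and> (\<tau> k s \<rho> > 0 \<longleftrightarrow> m \<ge> 1 \<and> threshold k s m = \<rho>))"
proof -
  define good where "good k s \<rho> p \<longleftrightarrow> 0 \<le> fst p \<and>
      (0 < fst p \<longleftrightarrow> 1 \<le> phase k s \<rho> \<and> threshold k s (phase k s \<rho>) = \<rho>) \<and>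
      (\<forall>n. \<bar>avg (words {1..s} n) (\<lambda>R. real_of_int (lcs_to (\<lambda>i. updown_word k ! (i mod (2 * k))) R (nat \<lfloor>\<rho> * real n\<rfloor>)))
        - (linear_coeff k s \<rho> (phase k s \<rho>) * real n - fst p * sqrt (real n))\<bar> \<le> snd p)"
    for k s :: nat and \<rho> :: real and p :: "real \<times> real"
  \<comment> \<open>The constants are chosen for the alphabet \<open>{1..s}\<close>, so that they
    depend on \<open>k\<close>, \<open>s\<close> and \<open>\<rho>\<close> but neither on
    \<open>A\<close> nor on \<open>n\<close>.\<close>
  define w where "w k s \<rho> = (SOME p. good k s \<rho> p)" for k s \<rho>
  have w: "good k s \<rho> (w k s \<rho>)" if "2 \<le> k" "k \<le> s" "0 \<le> \<rho>" for k s \<rho>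
  proof -
    have "updown k s" by (simp add: updown_def that)
    from updown.mean_lcs[OF this that(3)] have "\<exists>p. good k s \<rho> p" unfolding good_def by auto
    then show ?thesis unfolding w_def by (rule someI_ex)
  qed
  show ?thesis
  proof (rule exI[of _ "\<lambda>k s \<rho>. fst (w k s \<rho>)"], rule exI[of _ "\<lambda>k s \<rho>. snd (w k s \<rho>)"], intro allI impI)
    fix k :: nat and A :: "nat set" and \<rho> :: real
    assume k: "k \<ge> 2" and A: "finite A" "{1..k} \<subseteq> A" and \<rho>: "\<rho> \<ge> 0"
    have "k \<le> card A" using card_mono[OF A] by simp
    from w[OF k this \<rho>] show "let s = card A; m = phase k s \<rho> in
          (\<forall>n :: nat.
             \<bar>expected_LCS A k \<rho> n
               - (linear_coeff k s \<rho> m * real n - fst (w k s \<rho>) * sqrt (real n))\<bar> \<le> snd (w k s \<rho>))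
          \<and> fst (w k s \<rho>) \<ge> 0
          \<and> (fst (w k s \<rho>) > 0 \<longleftrightarrow> m \<ge> 1 \<and> threshold k s m = \<rho>)"
      unfolding good_def Let_def expected_LCS_eq[OF k A] by blast
  qed
qed

end
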